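(* Let $\Omega\subset\mathbb{R}^N$, $N\ge2$, be a bounded Lipschitz domain with $0\in\partial\Omega$ such that $\partial\Omega$ is of class $C^2$ near $0$, and let $\lambda\ge0$. Suppose $u\in H^1_0(\Omega)\cap C(\Omega)$ is nonnegative and satisfies $$-\Delta u-\frac{N^2}{4}|x|^{-2}u\ \ge\ -\lambda u\quad\text{in }\Omega$$ in the weak sense, i.e. $\int_\Omega\nabla u\cdot\nabla\varphi\,dx-\frac{N^2}{4}\int_\Omega|x|^{-2}u\varphi\,dx\ge-\lambda\int_\Omega u\varphi\,dx$ for all nonnegative $\varphi\in C^\infty_c(\Omega)$. Then $u\equiv0$ in $\Omega$. *)

theory Defs
  imports "HOL-Analysis.Analysis"
begin

coinductive smooth_fun :: "('a::euclidean_space \<Rightarrow> real) \<Rightarrow> bool" where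
  "(\<And>x. (f has_derivative (\<lambda>h. G x \<bullet> h)) (at x)) \<Longrightarrow> (\<And>v. smooth_fun (\<lambda>x. G x \<bullet> v))
   \<Longrightarrow> smooth_fun f"

definition test_fun :: "'a::euclidean_space set \<Rightarrow> ('a \<Rightarrow> real) \<Rightarrow> bool" where
  "test_fun \<Omega> \<phi> \<longleftrightarrow> smooth_fun \<phi> \<and> compact (closure {x. \<phi> x \<noteq> 0})
                    \<and> closure {x. \<phi> x \<noteq> 0} \<subseteq> \<Omega>"

definition grad :: "('a::euclidean_space \<Rightarrow> real) \<Rightarrow> 'a \<Rightarrow> 'a" where
  "grad f x = (SOME v. (f has_derivative (\<lambda>h. v \<bullet> h)) (at x))"

definition L2_on :: "'a::euclidean_space set \<Rightarrow> ('a \<Rightarrow> 'b::euclidean_space) \<Rightarrow> bool" where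
  "L2_on \<Omega> f \<longleftrightarrow> f \<in> borel_measurable (lebesgue_on \<Omega>)
                  \<and> set_integrable lebesgue \<Omega> (\<lambda>x. (norm (f x))\<^sup>2)"

text \<open>u belongs to H^1_0(Omega) with weak gradient Du: H^1_0 is the closure of
  C_c^infinity(Omega) in the H^1 norm, i.e. there are test functions phi_k with
  phi_k \<rightarrow> u and grad phi_k \<rightarrow> Du in L^2(Omega).\<close>
definition H10_with_grad :: "'a::euclidean_space set \<Rightarrow> ('a \<Rightarrow> real) \<Rightarrow> ('a \<Rightarrow> 'a) \<Rightarrow> bool" where
  "H10_with_grad \<Omega> u Du \<longleftrightarrow> L2_on \<Omega> u \<and> L2_on \<Omega> Du \<and>
     (\<exists>\<phi> :: nat \<Rightarrow> 'a \<Rightarrow> real. (\<forall>k. test_fun \<Omega> (\<phi> k)) \<and>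
        (\<lambda>k. LINT x:\<Omega>|lebesgue. (\<phi> k x - u x)\<^sup>2) \<longlonglongrightarrow> 0 \<and>
        (\<lambda>k. LINT x:\<Omega>|lebesgue. (norm (grad (\<phi> k) x - Du x))\<^sup>2) \<longlonglongrightarrow> 0)"

text \<open>Local graph representation of Omega near a boundary point p: after choosing a
  unit direction e (the last coordinate axis of a rotated frame), Omega coincides in
  ball p r with the supergraph of g over the hyperplane orthogonal to e.\<close>
definition local_graph :: "'a::euclidean_space set \<Rightarrow> 'a \<Rightarrow> real \<Rightarrow> 'a \<Rightarrow> ('a \<Rightarrow> real) \<Rightarrow> bool" where
  "local_graph \<Omega> p r e g \<longleftrightarrow> r > 0 \<and> norm e = 1 \<and>
     \<Omega> \<inter> ball p r = {x \<in> ball p r. x \<bullet> e > g (x - (x \<bullet> e) *\<^sub>R e)}"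

definition lipschitz_domain :: "'a::euclidean_space set \<Rightarrow> bool" where
  "lipschitz_domain \<Omega> \<longleftrightarrow> open \<Omega> \<and> connected \<Omega> \<and>
     (\<forall>p\<in>frontier \<Omega>. \<exists>r e g C. local_graph \<Omega> p r e g \<and>
        C-lipschitz_on {y. y \<bullet> e = 0} g)"

definition C2_fun :: "('a::euclidean_space \<Rightarrow> real) \<Rightarrow> bool" where
  "C2_fun g \<longleftrightarrow> (\<exists>G H. (\<forall>x. (g has_derivative (\<lambda>h. G x \<bullet> h)) (at x)) \<and>
                        (\<forall>x. (G has_derivative H x) (at x)) \<and>
                        (\<forall>v. continuous_on UNIV (\<lambda>x. H x v)))"

definition C2_boundary_near :: "'a::euclidean_space set \<Rightarrow> 'a \<Rightarrow> bool" where
  "C2_boundary_near \<Omega> p \<longleftrightarrow> (\<exists>r e g. local_graph \<Omega> p r e g \<and> C2_fun g)"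

end

theory Submission
  imports Defs
begin

text \<open>Let \<open>n\<close> be the dimension. Everything rests on the test functions \<open>\<phi> = F (w)\<close> with \<open>F\<close> smooth and convex,
  \<open>F = 0\<close> on the negative axis and \<open>w\<close> defined on a ball inside the domain: convexity gives \<open>\<Delta>\<phi> \<ge> F' (w) \<Delta>w\<close>,
  so a barrier \<open>w\<close> may be cut off at a positive level for free, and \<open>u\<close> itself needs no boundary values.

  By the regularity at \<open>0\<close> the domain contains a ball touching its boundary at \<open>0\<close>. On it one has the barriers
  \<open>w = q \<psi> f (\<tau>)\<close> with \<open>\<tau>\<close> close to \<open>- ln \<bar>x\<bar>\<close> near \<open>0\<close>, for which the Hardy operator acts, up to terms of relative size
  \<open>exp (- \<tau>)\<close>, as \<open>- f''\<close>; the absence of a zero order term reflects that \<open>n\<^sup>2/4\<close> is the critical constant.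
  The function \<open>f\<close> must be positive on a bounded interval only, so it cannot be convex, but it may be strictly
  convex near a fixed \<open>\<tau>\<close> and satisfy \<open>f'' \<ge> - 2/k\<close> on an interval of length \<open>k\<close>. The supersolution inequality then bounds the
  mass of \<open>u\<close> near the fixed level by \<open>2/k\<close> times a moment of \<open>u\<close> over \<open>\<tau> < k\<close>. Testing \<open>u \<in> H\<^sup>1\<^sub>0\<close> against the
  divergence of a vector field parallel to the normal shows that this moment is \<open>O (sqrt k)\<close>, whence \<open>u\<close> vanishes on an open set.
  Hopf's barrier spreads the zeros over the connected domain.\<close>

text \<open>In the half space the critical equation has the explicit solutions
  \<open>y_n |y|^(-n/2) f (ln |y|)\<close> with \<open>f\<close> affine. Already
  \<open>f = 1\<close> is positive, so in this model the differential inequality alone does not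
  force vanishing near the singularity; what rules this solution out is its infinite energy,
  divergent only logarithmically. The energy must therefore enter quantitatively. The moment in
  question has density about \<open>q |x|^(-n/2-2)\<close> on \<open>|x| > exp (- k)\<close>. For
  the explicit solution it grows like \<open>k\<close> and would exactly balance the loss
  \<open>2/k\<close>; finite energy lowers it to \<open>sqrt k\<close>, and the remaining factor
  \<open>1 / sqrt k\<close> tends to zero. The loss itself is forced: nothing is known about
  \<open>u\<close> at the origin, so a test function has to stay away from it, and the profile must
  return to zero at a finite \<open>\<tau>\<close>. The barrier also has to be cut at a level
  \<open>\<delta> > 0\<close>, because only its superlevel sets are compact in the domain. The
  limits are taken in the order \<open>\<delta>\<close> to zero with \<open>k\<close> fixed, then
  \<open>k\<close> to infinity, since the error of the cut contains a power of
  \<open>exp k\<close>.\<close>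

section \<open>Smooth functions\<close>

text \<open>The recursion starts with no condition at all: one more derivative already yields continuity.\<close>

primrec cdiff :: "nat \<Rightarrow> 'a::euclidean_space set \<Rightarrow> ('a \<Rightarrow> real) \<Rightarrow> bool" where
  "cdiff 0 S f \<longleftrightarrow> True"
| "cdiff (Suc k) S f \<longleftrightarrow> (\<exists>G. (\<forall>x\<in>S. (f has_derivative (\<lambda>h. G x \<bullet> h)) (at x)) \<and>
                           (\<forall>v. cdiff k S (\<lambda>x. G x \<bullet> v)))"

definition smooth_on :: "'a::euclidean_space set \<Rightarrow> ('a \<Rightarrow> real) \<Rightarrow> bool" where
  "smooth_on S f \<longleftrightarrow> (\<forall>k. cdiff k S f)"

lemma grad_unique:
  assumes "(f has_derivative (\<lambda>h. v \<bullet> h)) (at x)" "(f has_derivative (\<lambda>h. w \<bullet> h)) (at x)"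
  shows "v = w"
proof -
  have "(\<lambda>h. v \<bullet> h) = (\<lambda>h. w \<bullet> h)"
    using assms has_derivative_unique by blast
  then show ?thesis
    by (metis vector_eq_rdot)
qed

lemma grad_eq: "(f has_derivative (\<lambda>h. v \<bullet> h)) (at x) \<Longrightarrow> grad f x = v"
  unfolding grad_def using grad_unique by (metis (mono_tags, lifting) someI_ex)

lemma cdiffI:
  assumes "\<And>x. x \<in> S \<Longrightarrow> (f has_derivative (\<lambda>h. G x \<bullet> h)) (at x)" "\<And>v. cdiff k S (\<lambda>x. G x \<bullet> v)"
  shows "cdiff (Suc k) S f"
  using assms by auto

lemma cdiff_Suc_mono: "cdiff (Suc k) S f \<Longrightarrow> cdiff k S f"
proof (induction k arbitrary: f)
  case (Suc k)
  then obtain G where "\<forall>x\<in>S. (f has_derivative (\<lambda>h. G x \<bullet> h)) (at x)"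
    and "\<And>v. cdiff (Suc k) S (\<lambda>x. G x \<bullet> v)" by auto
  then show ?case using Suc.IH by (intro cdiffI[of S f G]) blast+
qed simp

lemma cdiff_cong:
  assumes "open S" "\<And>x. x \<in> S \<Longrightarrow> f x = g x" "cdiff k S f"
  shows "cdiff k S g"
proof (cases k)
  case (Suc k')
  with assms obtain G where G: "\<And>x. x \<in> S \<Longrightarrow> (f has_derivative (\<lambda>h. G x \<bullet> h)) (at x)"
    "\<And>v. cdiff k' S (\<lambda>x. G x \<bullet> v)" by auto
  then show ?thesis
    unfolding Suc using has_derivative_transform_within_open[OF G(1) assms(1)] assms(2)
    by (intro cdiffI[of S g G]) blast+
qed simp

text \<open>On the overlap the two gradients coincide by uniqueness, so one choice serves the union.
  Applied to an open set and the complement of a compact subset, this makes an extension by zero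
  smooth.\<close>

lemma cdiff_Un: "open S \<Longrightarrow> open T \<Longrightarrow> cdiff k S f \<Longrightarrow> cdiff k T f \<Longrightarrow> cdiff k (S \<union> T) f"
proof (induction k arbitrary: f)
  case (Suc k)
  obtain G where G: "\<And>x. x \<in> S \<Longrightarrow> (f has_derivative (\<lambda>h. G x \<bullet> h)) (at x)"
    "\<And>v. cdiff k S (\<lambda>x. G x \<bullet> v)" using Suc.prems(3) by auto
  obtain H where H: "\<And>x. x \<in> T \<Longrightarrow> (f has_derivative (\<lambda>h. H x \<bullet> h)) (at x)"
    "\<And>v. cdiff k T (\<lambda>x. H x \<bullet> v)" using Suc.prems(4) by auto
  define J where "J x = (if x \<in> S then G x else H x)" for x
  have J: "x \<in> T \<Longrightarrow> J x = H x" "x \<in> S \<Longrightarrow> J x = G x" for x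
    using grad_unique[OF G(1) H(1)] by (auto simp: J_def)
  show ?case
  proof (intro cdiffI[of _ f J])
    show "(f has_derivative (\<lambda>h. J x \<bullet> h)) (at x)" if "x \<in> S \<union> T" for x
      using that G(1)[of x] H(1)[of x] by (auto simp: J_def)
    show "cdiff k (S \<union> T) (\<lambda>x. J x \<bullet> v)" for v
    proof (rule Suc.IH[OF Suc.prems(1,2)])
      show "cdiff k S (\<lambda>x. J x \<bullet> v)"
        by (rule cdiff_cong[OF Suc.prems(1) _ G(2)]) (simp add: J)
      show "cdiff k T (\<lambda>x. J x \<bullet> v)"
        by (rule cdiff_cong[OF Suc.prems(2) _ H(2)]) (simp add: J)
    qed
  qed
qed simp

lemma cdiff_const: "cdiff k S (\<lambda>x. c)"
  by (induction k arbitrary: c) (auto intro!: exI[of _ "\<lambda>_. 0"])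

lemma cdiff_inner_left: "cdiff k S (\<lambda>x. x \<bullet> v)"
proof (cases k)
  case (Suc k')
  show ?thesis unfolding Suc
    by (rule cdiffI[where G = "\<lambda>_. v"])
       (auto intro!: derivative_eq_intros cdiff_const simp: inner_commute)
qed simp

lemma cdiff_add: "cdiff k S f \<Longrightarrow> cdiff k S g \<Longrightarrow> cdiff k S (\<lambda>x. f x + g x)"
proof (induction k arbitrary: f g)
  case (Suc k)
  obtain F where F: "\<And>x. x \<in> S \<Longrightarrow> (f has_derivative (\<lambda>h. F x \<bullet> h)) (at x)"
    "\<And>v. cdiff k S (\<lambda>x. F x \<bullet> v)" using Suc.prems(1) by auto
  obtain G where G: "\<And>x. x \<in> S \<Longrightarrow> (g has_derivative (\<lambda>h. G x \<bullet> h)) (at x)"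
    "\<And>v. cdiff k S (\<lambda>x. G x \<bullet> v)" using Suc.prems(2) by auto
  show ?case
    using has_derivative_add[OF F(1) G(1)] Suc.IH[OF F(2) G(2)]
    by (intro cdiffI[where G = "\<lambda>x. F x + G x"]) (simp_all only: inner_add_left)
qed simp

lemma cdiff_mult: "cdiff k S f \<Longrightarrow> cdiff k S g \<Longrightarrow> cdiff k S (\<lambda>x. f x * g x)"
proof (induction k arbitrary: f g)
  case (Suc k)
  obtain F where F: "\<And>x. x \<in> S \<Longrightarrow> (f has_derivative (\<lambda>h. F x \<bullet> h)) (at x)"
    "\<And>v. cdiff k S (\<lambda>x. F x \<bullet> v)" using Suc.prems(1) by auto
  obtain G where G: "\<And>x. x \<in> S \<Longrightarrow> (g has_derivative (\<lambda>h. G x \<bullet> h)) (at x)"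
    "\<And>v. cdiff k S (\<lambda>x. G x \<bullet> v)" using Suc.prems(2) by auto
  show ?case
  proof (rule cdiffI[where G = "\<lambda>x. f x *\<^sub>R G x + g x *\<^sub>R F x"])
    show "((\<lambda>x. f x * g x) has_derivative (\<lambda>h. (f x *\<^sub>R G x + g x *\<^sub>R F x) \<bullet> h)) (at x)"
      if "x \<in> S" for x
      using has_derivative_mult[OF F(1)[OF that] G(1)[OF that]] by (simp add: inner_add_left mult.commute)
    show "cdiff k S (\<lambda>x. (f x *\<^sub>R G x + g x *\<^sub>R F x) \<bullet> v)" for v
      using cdiff_add[OF Suc.IH[OF cdiff_Suc_mono[OF Suc.prems(1)] G(2)[of v]]
          Suc.IH[OF cdiff_Suc_mono[OF Suc.prems(2)] F(2)[of v]]]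
      by (simp add: inner_add_left)
  qed
qed simp

lemma cdiff_sum: "(\<And>i. i \<in> I \<Longrightarrow> cdiff k S (f i)) \<Longrightarrow> cdiff k S (\<lambda>x. \<Sum>i\<in>I. f i x)"
  by (induction I rule: infinite_finite_induct) (simp_all add: cdiff_const cdiff_add)

text \<open>Smoothness of a composition needs only that the derivatives of the outer function stay
  in a family closed under differentiation, up to finite linear combinations.\<close>

lemma cdiff_compose_family:
  assumes der: "\<And>n x. x \<in> S \<Longrightarrow> (g n has_real_derivative (a n * g (p n) (w x) + b n * g (r n) (w x))) (at (w x))"
    and w: "smooth_on S w"
  shows "cdiff k S (\<lambda>x. g n (w x))"
proof (induction k arbitrary: n)
  case (Suc k)
  obtain W where W: "\<And>x. x \<in> S \<Longrightarrow> (w has_derivative (\<lambda>h. W x \<bullet> h)) (at x)"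
    "\<And>v. cdiff k S (\<lambda>x. W x \<bullet> v)"
    using w[unfolded smooth_on_def, rule_format, of "Suc k"] by auto
  let ?d = "\<lambda>x. a n * g (p n) (w x) + b n * g (r n) (w x)"
  show ?case
  proof (rule cdiffI[where G = "\<lambda>x. ?d x *\<^sub>R W x"])
    show "((\<lambda>x. g n (w x)) has_derivative (\<lambda>h. (?d x *\<^sub>R W x) \<bullet> h)) (at x)" if "x \<in> S" for x
      using has_derivative_compose[OF W(1)[OF that] has_field_derivative_imp_has_derivative[OF der[OF that]]]
      by (simp add: mult_ac)
    show "cdiff k S (\<lambda>x. (?d x *\<^sub>R W x) \<bullet> v)" for v
      using cdiff_mult[OF cdiff_add[OF cdiff_mult[OF cdiff_const Suc.IH] cdiff_mult[OF cdiff_const Suc.IH]] W(2)[of v]]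
      by simp
  qed
qed simp

lemma smooth_on_const: "smooth_on S (\<lambda>x. c)"
  and smooth_on_inner_left: "smooth_on S (\<lambda>x. x \<bullet> v)"
  by (simp_all add: smooth_on_def cdiff_const cdiff_inner_left)

lemma smooth_on_add: "smooth_on S f \<Longrightarrow> smooth_on S g \<Longrightarrow> smooth_on S (\<lambda>x. f x + g x)"
  and smooth_on_mult: "smooth_on S f \<Longrightarrow> smooth_on S g \<Longrightarrow> smooth_on S (\<lambda>x. f x * g x)"
  by (simp_all add: smooth_on_def cdiff_add cdiff_mult)

lemma smooth_on_diff: "smooth_on S f \<Longrightarrow> smooth_on S g \<Longrightarrow> smooth_on S (\<lambda>x. f x - g x)"
  using smooth_on_add[of S f "\<lambda>x. - 1 * g x"] smooth_on_mult[OF smooth_on_const[of S "-1"], of g] by simp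

lemma smooth_on_norm2: "smooth_on S (\<lambda>x. x \<bullet> x)"
  unfolding smooth_on_def
  by (subst euclidean_inner) (intro allI cdiff_sum cdiff_mult cdiff_inner_left)

lemma smooth_on_exp: "smooth_on S f \<Longrightarrow> smooth_on S (\<lambda>x. exp (f x))"
  unfolding smooth_on_def[of S "\<lambda>x. exp (f x)"]
  by (intro allI cdiff_compose_family[where g = "\<lambda>_. exp" and a = "\<lambda>_. 1" and b = "\<lambda>_. 0"])
     (auto intro!: derivative_eq_intros)

lemma DERIV_inverse_pow:
  fixes y :: real
  assumes "y \<noteq> 0"
  shows "((\<lambda>y. inverse y ^ n) has_real_derivative (- real n * inverse y ^ Suc n)) (at y)"
proof (cases n)
  case (Suc m)
  have "((\<lambda>y. inverse y ^ n) has_real_derivative (real n * (- (inverse y ^ Suc (Suc 0)) * inverse y ^ (n - Suc 0)))) (at y)"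
    by (rule DERIV_power[OF DERIV_inverse[OF assms]])
  then show ?thesis
    by (simp add: Suc algebra_simps)
qed simp

lemma smooth_on_inverse:
  assumes "smooth_on S f" "\<And>x. x \<in> S \<Longrightarrow> f x > 0"
  shows "smooth_on S (\<lambda>x. inverse (f x))"
proof -
  have "cdiff k S (\<lambda>x. (\<lambda>n y. inverse y ^ n) 1 (f x))" for k
    by (rule cdiff_compose_family[where a = "\<lambda>n. - real n" and p = Suc and b = "\<lambda>_. 0" and r = id and w = f])
       (use assms DERIV_inverse_pow in \<open>auto simp: less_imp_neq[THEN not_sym]\<close>)
  then show ?thesis
    by (simp add: smooth_on_def)
qed

text \<open>One differentiation by hand turns the logarithm into an inverse, for which a closed
  family is available; hence the order \<open>Suc k\<close> is proved and then lowered.\<close>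

lemma smooth_on_ln:
  assumes "smooth_on S f" "\<And>x. x \<in> S \<Longrightarrow> f x > 0"
  shows "smooth_on S (\<lambda>x. ln (f x))"
  unfolding smooth_on_def
proof (intro allI)
  fix k
  obtain W where W: "\<And>x. x \<in> S \<Longrightarrow> (f has_derivative (\<lambda>h. W x \<bullet> h)) (at x)"
    "\<And>v. cdiff k S (\<lambda>x. W x \<bullet> v)"
    using assms(1)[unfolded smooth_on_def, rule_format, of "Suc k"] by auto
  have "cdiff (Suc k) S (\<lambda>x. ln (f x))"
  proof (rule cdiffI[where G = "\<lambda>x. inverse (f x) *\<^sub>R W x"])
    show "((\<lambda>x. ln (f x)) has_derivative (\<lambda>h. (inverse (f x) *\<^sub>R W x) \<bullet> h)) (at x)" if "x \<in> S" for x
      using has_derivative_ln[OF assms(2)[OF that] W(1)[OF that]] by (simp add: mult.commute)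
    show "cdiff k S (\<lambda>x. (inverse (f x) *\<^sub>R W x) \<bullet> v)" for v
      using cdiff_mult[OF smooth_on_inverse[OF assms, unfolded smooth_on_def, rule_format] W(2)[of v]] by simp
  qed
  then show "cdiff k S (\<lambda>x. ln (f x))"
    by (rule cdiff_Suc_mono)
qed

text \<open>\<open>cdiff\<close> may choose a different gradient for every order, while the
  coinductive predicate needs a single one; uniqueness of gradients identifies the choices, and the
  coinduction step closes.\<close>

lemma smooth_fun_iff: "smooth_fun f \<longleftrightarrow> smooth_on UNIV f"
proof
  have "smooth_fun f \<Longrightarrow> cdiff k UNIV f" for k
  proof (induction k arbitrary: f)
    case (Suc k)
    from Suc.prems show ?case
      by (cases rule: smooth_fun.cases) (use Suc.IH in auto)
  qed simp
  then show "smooth_fun f \<Longrightarrow> smooth_on UNIV f" by (simp add: smooth_on_def)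
next
  assume "smooth_on UNIV f"
  then show "smooth_fun f"
  proof (coinduction arbitrary: f)
    case smooth_fun
    then obtain G where G: "\<And>x. (f has_derivative (\<lambda>h. G x \<bullet> h)) (at x)"
      unfolding smooth_on_def using cdiff.simps(2)[of 0 UNIV f] by fast
    have "cdiff k UNIV (\<lambda>x. G x \<bullet> v)" for k v
    proof -
      obtain G' where G': "\<And>x. (f has_derivative (\<lambda>h. G' x \<bullet> h)) (at x)"
        "\<And>v. cdiff k UNIV (\<lambda>x. G' x \<bullet> v)"
        using smooth_fun unfolding smooth_on_def using cdiff.simps(2)[of k UNIV f] by fast
      have "G' = G" using grad_unique[OF G G'(1)] by auto
      then show ?thesis using G'(2) by simp
    qed
    with G show ?case by (auto simp: smooth_on_def)
  qed
qed

section \<open>The flat functions \<open>exp (- 1/s) s^(-n)\<close> and the convex truncation built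
  from them\<close>

definition bump :: "nat \<Rightarrow> real \<Rightarrow> real" where
  "bump n s = (if s > 0 then exp (- inverse s) * inverse s ^ n else 0)"

lemma bump_nonneg: "bump n s \<ge> 0"
  by (simp add: bump_def)

lemma bump_tendsto: "(bump n \<longlongrightarrow> 0) (at_right 0)"
proof -
  have "((\<lambda>y::real. y ^ n / exp y) \<longlongrightarrow> 0) at_top"
    by (rule tendsto_power_div_exp_0)
  from filterlim_compose[OF this filterlim_inverse_at_top_right]
  have "((\<lambda>s::real. inverse s ^ n / exp (inverse s)) \<longlongrightarrow> 0) (at_right 0)" .
  then show ?thesis
    by (rule Lim_transform_eventually)
       (auto simp: eventually_at_filter bump_def exp_minus field_simps)
qed

text \<open>The family is stable under differentiation. At zero the right difference quotient of
  \<open>bump n\<close> is \<open>bump (n + 1)\<close>, which tends to zero because the exponential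
  beats every power.\<close>

lemma bump_deriv:
  "(bump n has_real_derivative (bump (n+2) s - real n * bump (n+1) s)) (at s)"
proof -
  consider "s > 0" | "s < 0" | "s = 0" by linarith
  then show ?thesis
  proof cases
    case 1
    have "((\<lambda>s. exp (- inverse s)) has_real_derivative exp (- inverse s) * inverse s ^ 2) (at s)"
      using 1 by (auto intro!: derivative_eq_intros simp: power2_eq_square)
    from DERIV_mult[OF this DERIV_inverse_pow[of s n]] 1
    have "((\<lambda>s. exp (- inverse s) * inverse s ^ n) has_real_derivative (bump (n+2) s - real n * bump (n+1) s)) (at s)"
      by (simp add: bump_def power2_eq_square algebra_simps)
    then show ?thesis
      by (rule has_field_derivative_transform_within_open[where S = "{0<..}"]) (use 1 in \<open>auto simp: bump_def\<close>)
  next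
    case 2
    have "((\<lambda>s. 0) has_real_derivative (bump (n+2) s - real n * bump (n+1) s)) (at s)"
      using 2 by (auto intro!: derivative_eq_intros simp: bump_def)
    then show ?thesis
      by (rule has_field_derivative_transform_within_open[where S = "{..<0}"]) (use 2 in \<open>auto simp: bump_def\<close>)
  next
    case 3
    have "((\<lambda>h. bump n h / h) \<longlongrightarrow> 0) (at_right 0)"
      by (rule Lim_transform_eventually[OF bump_tendsto[of "Suc n"]])
         (auto simp: eventually_at_filter bump_def field_simps)
    moreover have "((\<lambda>h. bump n h / h) \<longlongrightarrow> 0) (at_left 0)"
      by (rule Lim_transform_eventually[OF tendsto_const])
         (auto simp: eventually_at_filter bump_def)
    ultimately have "((\<lambda>h. bump n h / h) \<longlongrightarrow> 0) (at 0)"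
      by (simp add: filterlim_at_split)
    then show ?thesis
      using 3 by (simp add: DERIV_def bump_def)
  qed
qed

lemma cdiff_bump: "smooth_on S w \<Longrightarrow> cdiff k S (\<lambda>x. bump n (w x))"
  by (rule cdiff_compose_family[where a = "\<lambda>_. 1" and p = "\<lambda>n. n+2" and b = "\<lambda>n. - real n" and r = "\<lambda>n. n+1"])
     (use bump_deriv in \<open>auto simp del: add_2_eq_Suc'\<close>)

text \<open>A smooth convex substitute \<open>s exp (- 1/s)\<close> for the positive part of \<open>s\<close>.\<close>

definition cpos :: "real \<Rightarrow> real" where
  "cpos s = s * bump 0 s"

lemma cpos_deriv: "(cpos has_real_derivative (bump 0 s + bump 1 s)) (at s)"
proof -
  have "s * bump 2 s = bump 1 s"
    by (auto simp: bump_def power2_eq_square field_simps)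
  then show ?thesis
    unfolding cpos_def using bump_deriv[of 0 s]
    by (auto intro!: derivative_eq_intros simp: numeral_2_eq_2 mult.commute)
qed

lemma cpos_deriv2: "((\<lambda>s. bump 0 s + bump 1 s) has_real_derivative bump 3 s) (at s)"
  using DERIV_add[OF bump_deriv[of 0 s] bump_deriv[of 1 s]] by (simp add: numeral_3_eq_3 numeral_2_eq_2)

lemma smooth_on_cpos: "smooth_on S w \<Longrightarrow> smooth_on S (\<lambda>x. cpos (w x))"
  unfolding cpos_def
  by (rule smooth_on_mult) (auto simp: smooth_on_def intro: cdiff_bump)

lemma cpos_simps: "s \<le> 0 \<Longrightarrow> cpos s = 0" "cpos s \<ge> 0" "s > 0 \<Longrightarrow> cpos s > 0"
  by (auto simp: cpos_def bump_def)

text \<open>The upper bound is \<open>1 + 1/s \<le> exp (1/s)\<close>; it keeps the loss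
  \<open>2/k\<close> from being amplified. The lower bound for \<open>s \<ge> 1\<close> is the
  quantitative gain where the barrier is at least twice the cut-off level.\<close>

lemma cpos_deriv_bounds: "bump 0 s + bump 1 s \<ge> 0" "bump 0 s + bump 1 s \<le> 1"
  "s \<ge> 1 \<Longrightarrow> bump 0 s + bump 1 s \<ge> exp (-1)"
proof -
  show "bump 0 s + bump 1 s \<le> 1"
  proof (cases "s > 0")
    case True
    have "1 + inverse s \<le> exp (inverse s)" by (rule exp_ge_add_one_self)
    then have "exp (- inverse s) * (1 + inverse s) \<le> exp (- inverse s) * exp (inverse s)"
      by (intro mult_left_mono) auto
    also have "\<dots> = 1" by (simp flip: exp_add)
    finally show ?thesis using True by (simp add: bump_def algebra_simps)
  qed (simp add: bump_def)
  assume "s \<ge> 1"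
  then have "exp (-1) \<le> exp (- inverse s)" by (simp add: inverse_le_1_iff)
  moreover have "bump 0 s = exp (- inverse s)" using \<open>s \<ge> 1\<close> by (simp add: bump_def)
  ultimately show "bump 0 s + bump 1 s \<ge> exp (-1)" using bump_nonneg[of 1 s] by linarith
qed (simp add: bump_nonneg)

text \<open>Writing the barrier as \<open>\<delta> (v + 1)\<close>, this compares its linearised
  truncation with \<open>cpos v\<close>. The gap is bounded, so cutting at level
  \<open>\<delta>\<close> costs a zero order error proportional to \<open>\<delta>\<close>.\<close>

lemma cpos_defect:
  "0 \<le> (bump 0 s + bump 1 s) * (s + 1) - cpos s" "(bump 0 s + bump 1 s) * (s + 1) - cpos s \<le> 2"
proof -
  have eq: "(bump 0 s + bump 1 s) * (s + 1) - cpos s = 2 * bump 0 s + bump 1 s"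
    by (auto simp: bump_def cpos_def field_simps)
  show "0 \<le> (bump 0 s + bump 1 s) * (s + 1) - cpos s"
    unfolding eq by (simp add: bump_nonneg)
  show "(bump 0 s + bump 1 s) * (s + 1) - cpos s \<le> 2"
    unfolding eq using cpos_deriv_bounds(2)[of s] bump_nonneg[of 1 s] bump_nonneg[of 0 s] by linarith
qed

section \<open>Laplacians and integration by parts\<close>

text \<open>Gradient and Laplacian are carried as explicit witnesses, so that product and chain rule
  produce formulas; the Laplacian is the trace of the derivative of \<open>G\<close>.\<close>

definition has_lap :: "'a::euclidean_space set \<Rightarrow> ('a \<Rightarrow> real) \<Rightarrow> ('a \<Rightarrow> 'a) \<Rightarrow> ('a \<Rightarrow> real) \<Rightarrow> bool" where
  "has_lap S f G L \<longleftrightarrow> (\<forall>x\<in>S. (f has_derivative (\<lambda>h. G x \<bullet> h)) (at x) \<and>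
     (\<exists>H. (G has_derivative H) (at x) \<and> L x = (\<Sum>i\<in>Basis. H i \<bullet> i)))"

lemma has_lapD: "has_lap S f G L \<Longrightarrow> x \<in> S \<Longrightarrow> (f has_derivative (\<lambda>h. G x \<bullet> h)) (at x)"
  by (simp add: has_lap_def)

text \<open>Identifies the Laplacian of a globally smooth function with a formula computed on an
  open piece only.\<close>

lemma has_lap_unique:
  assumes "has_lap S f G L" "has_lap T f G' L'" "open S" "x \<in> S" "S \<subseteq> T"
  shows "G x = G' x" "L x = L' x"
proof -
  have eq: "G y = G' y" if "y \<in> S" for y
    using grad_unique[OF has_lapD[OF assms(1)] has_lapD[OF assms(2)]] that assms by auto
  then show "G x = G' x" using assms by auto
  obtain H where H: "(G has_derivative H) (at x)" "L x = (\<Sum>i\<in>Basis. H i \<bullet> i)"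
    using assms unfolding has_lap_def by blast
  obtain H' where H': "(G' has_derivative H') (at x)" "L' x = (\<Sum>i\<in>Basis. H' i \<bullet> i)"
    using assms unfolding has_lap_def by blast
  have "(G' has_derivative H) (at x)"
    using has_derivative_transform_within_open[OF H(1) assms(3,4)] eq by auto
  then show "L x = L' x"
    using H' H has_derivative_unique by metis
qed

lemma has_lap_cong:
  assumes "has_lap S f G L" "open S" "\<And>x. x \<in> S \<Longrightarrow> f x = g x"
  shows "has_lap S g G L"
  using assms has_derivative_transform_within_open[of f _ _ UNIV S g] unfolding has_lap_def by blast

lemma has_lap_cong_deriv:
  assumes "has_lap S f G L" "open S" "\<And>x. x \<in> S \<Longrightarrow> f x = f' x" "\<And>x. x \<in> S \<Longrightarrow> G x = G' x"
    "\<And>x. x \<in> S \<Longrightarrow> L x = L' x"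
  shows "has_lap S f' G' L'"
  unfolding has_lap_def
proof (intro ballI conjI)
  fix x assume x: "x \<in> S"
  show "(f' has_derivative (\<lambda>h. G' x \<bullet> h)) (at x)"
    using has_lapD[OF has_lap_cong[OF assms(1-3)] x] assms(4)[OF x] by simp
  obtain H where H: "(G has_derivative H) (at x)" "L x = (\<Sum>i\<in>Basis. H i \<bullet> i)"
    using assms(1) x unfolding has_lap_def by blast
  show "\<exists>H. (G' has_derivative H) (at x) \<and> L' x = (\<Sum>i\<in>Basis. H i \<bullet> i)"
    using has_derivative_transform_within_open[OF H(1) assms(2) x assms(4)] H(2) assms(5)[OF x] by metis
qed

lemma has_lap_const: "has_lap S (\<lambda>x. c) (\<lambda>x. 0) (\<lambda>x. 0)"
  unfolding has_lap_def by (auto intro!: exI[of _ "\<lambda>_. 0"] derivative_eq_intros)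

lemma has_lap_inner_left: "has_lap S (\<lambda>x. x \<bullet> v) (\<lambda>x. v) (\<lambda>x. 0)"
  unfolding has_lap_def
  by (auto intro!: exI[of _ "\<lambda>_. 0"] derivative_eq_intros simp: inner_commute)

lemma has_lap_norm2_shift:
  fixes z :: "'a::euclidean_space"
  shows "has_lap S (\<lambda>x. (a *\<^sub>R x - z) \<bullet> (a *\<^sub>R x - z)) (\<lambda>x. (2 * a) *\<^sub>R (a *\<^sub>R x - z)) (\<lambda>x. 2 * a\<^sup>2 * real DIM('a))"
  unfolding has_lap_def
proof (intro ballI conjI)
  fix x :: 'a
  show "((\<lambda>x. (a *\<^sub>R x - z) \<bullet> (a *\<^sub>R x - z)) has_derivative (\<lambda>h. (2 * a) *\<^sub>R (a *\<^sub>R x - z) \<bullet> h)) (at x)"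
    by (auto intro!: derivative_eq_intros simp: algebra_simps inner_commute)
  have "((\<lambda>x. (2 * a) *\<^sub>R (a *\<^sub>R x - z)) has_derivative (\<lambda>h. (2 * a) *\<^sub>R a *\<^sub>R h)) (at x)"
    by (auto intro!: derivative_eq_intros)
  then show "\<exists>H. ((\<lambda>x. (2 * a) *\<^sub>R (a *\<^sub>R x - z)) has_derivative H) (at x) \<and>
      2 * a\<^sup>2 * real DIM('a) = (\<Sum>i\<in>Basis. H i \<bullet> i)"
    by (intro exI[of _ "\<lambda>h. (2 * a) *\<^sub>R a *\<^sub>R h"]) (simp add: power2_eq_square)
qed

lemma has_lap_add:
  assumes "has_lap S f F L" "has_lap S g G M"
  shows "has_lap S (\<lambda>x. f x + g x) (\<lambda>x. F x + G x) (\<lambda>x. L x + M x)"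
  unfolding has_lap_def
proof (intro ballI conjI)
  fix x assume x: "x \<in> S"
  show "((\<lambda>x. f x + g x) has_derivative (\<lambda>h. (F x + G x) \<bullet> h)) (at x)"
    using has_derivative_add[OF has_lapD[OF assms(1) x] has_lapD[OF assms(2) x]] by (simp add: inner_add_left)
  obtain HF where HF: "(F has_derivative HF) (at x)" "L x = (\<Sum>i\<in>Basis. HF i \<bullet> i)"
    using assms x unfolding has_lap_def by blast
  obtain HG where HG: "(G has_derivative HG) (at x)" "M x = (\<Sum>i\<in>Basis. HG i \<bullet> i)"
    using assms x unfolding has_lap_def by blast
  show "\<exists>H. ((\<lambda>x. F x + G x) has_derivative H) (at x) \<and> L x + M x = (\<Sum>i\<in>Basis. H i \<bullet> i)"
    by (intro exI conjI, rule has_derivative_add[OF HF(1) HG(1)])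
       (simp add: HF(2) HG(2) inner_add_left sum.distrib)
qed

lemma has_lap_mult:
  assumes "has_lap S f F L" "has_lap S g G M"
  shows "has_lap S (\<lambda>x. f x * g x) (\<lambda>x. f x *\<^sub>R G x + g x *\<^sub>R F x)
           (\<lambda>x. f x * M x + 2 * (F x \<bullet> G x) + g x * L x)"
  unfolding has_lap_def
proof (intro ballI conjI)
  fix x assume x: "x \<in> S"
  note f = has_lapD[OF assms(1) x] and g = has_lapD[OF assms(2) x]
  show "((\<lambda>x. f x * g x) has_derivative (\<lambda>h. (f x *\<^sub>R G x + g x *\<^sub>R F x) \<bullet> h)) (at x)"
    using has_derivative_mult[OF f g] by (simp add: inner_add_left mult.commute)
  obtain HF where HF: "(F has_derivative HF) (at x)" "L x = (\<Sum>i\<in>Basis. HF i \<bullet> i)"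
    using assms x unfolding has_lap_def by blast
  obtain HG where HG: "(G has_derivative HG) (at x)" "M x = (\<Sum>i\<in>Basis. HG i \<bullet> i)"
    using assms x unfolding has_lap_def by blast
  show "\<exists>H. ((\<lambda>x. f x *\<^sub>R G x + g x *\<^sub>R F x) has_derivative H) (at x) \<and>
      f x * M x + 2 * (F x \<bullet> G x) + g x * L x = (\<Sum>i\<in>Basis. H i \<bullet> i)"
    by (intro exI conjI, rule has_derivative_add[OF has_derivative_scaleR[OF f HG(1)] has_derivative_scaleR[OF g HF(1)]])
       (simp add: HF(2) HG(2) inner_add_left sum.distrib sum_distrib_left euclidean_inner[of "F x" "G x"] mult_ac)
qed

lemma has_lap_cmult:
  assumes "has_lap S f F L"
  shows "has_lap S (\<lambda>x. c * f x) (\<lambda>x. c *\<^sub>R F x) (\<lambda>x. c * L x)"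
  using has_lap_mult[OF has_lap_const[of S c] assms] by simp

lemma has_lap_compose:
  assumes w: "has_lap S w W L"
    and d1: "\<And>x. x \<in> S \<Longrightarrow> (\<phi> has_real_derivative \<phi>1 (w x)) (at (w x))"
    and d2: "\<And>x. x \<in> S \<Longrightarrow> (\<phi>1 has_real_derivative \<phi>2 (w x)) (at (w x))"
  shows "has_lap S (\<lambda>x. \<phi> (w x)) (\<lambda>x. \<phi>1 (w x) *\<^sub>R W x) (\<lambda>x. \<phi>2 (w x) * (norm (W x))\<^sup>2 + \<phi>1 (w x) * L x)"
  unfolding has_lap_def
proof (intro ballI conjI)
  fix x assume x: "x \<in> S"
  note f = has_lapD[OF w x]
  show "((\<lambda>x. \<phi> (w x)) has_derivative (\<lambda>h. (\<phi>1 (w x) *\<^sub>R W x) \<bullet> h)) (at x)"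
    using has_derivative_compose[OF f has_field_derivative_imp_has_derivative[OF d1[OF x]]] by simp
  have 1: "((\<lambda>x. \<phi>1 (w x)) has_derivative (\<lambda>h. \<phi>2 (w x) * (W x \<bullet> h))) (at x)"
    using has_derivative_compose[OF f has_field_derivative_imp_has_derivative[OF d2[OF x]]] by simp
  obtain H where H: "(W has_derivative H) (at x)" "L x = (\<Sum>i\<in>Basis. H i \<bullet> i)"
    using w x unfolding has_lap_def by blast
  show "\<exists>H. ((\<lambda>x. \<phi>1 (w x) *\<^sub>R W x) has_derivative H) (at x) \<and>
      \<phi>2 (w x) * (norm (W x))\<^sup>2 + \<phi>1 (w x) * L x = (\<Sum>i\<in>Basis. H i \<bullet> i)"
    by (intro exI conjI, rule has_derivative_scaleR[OF 1 H(1)])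
       (simp add: H(2) inner_add_left sum.distrib sum_distrib_left power2_norm_eq_inner
         euclidean_inner[of "W x" "W x"] mult_ac)
qed

text \<open>The Laplacian is delivered as a sum of pure second derivatives, each with a continuous
  witness, because integration by parts is done one coordinate at a time.\<close>

lemma smooth_fun_has_lap:
  assumes "smooth_fun f"
  obtains G K where "has_lap UNIV f G (\<lambda>x. \<Sum>i\<in>Basis. K i x \<bullet> i)"
    "\<And>v. continuous_on UNIV (\<lambda>x. G x \<bullet> v)"
    "\<And>i x. i \<in> Basis \<Longrightarrow> ((\<lambda>x. G x \<bullet> i) has_derivative (\<lambda>h. K i x \<bullet> h)) (at x)"
    "\<And>i v. i \<in> Basis \<Longrightarrow> continuous_on UNIV (\<lambda>x. K i x \<bullet> v)"
proof -
  have cont: "continuous_on UNIV g" if "smooth_fun g" for g :: "'a \<Rightarrow> real"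
    using that by (cases rule: smooth_fun.cases)
      (meson continuous_at_imp_continuous_on has_derivative_continuous)
  obtain G where G: "\<And>x. (f has_derivative (\<lambda>h. G x \<bullet> h)) (at x)" "\<And>v. smooth_fun (\<lambda>x. G x \<bullet> v)"
    using assms by (cases rule: smooth_fun.cases) blast
  have "\<exists>K. (\<forall>x. ((\<lambda>x. G x \<bullet> i) has_derivative (\<lambda>h. K x \<bullet> h)) (at x)) \<and> (\<forall>v. smooth_fun (\<lambda>x. K x \<bullet> v))" for i
    using G(2)[of i] by (cases rule: smooth_fun.cases) blast
  then obtain K where K: "\<And>i x. ((\<lambda>x. G x \<bullet> i) has_derivative (\<lambda>h. K i x \<bullet> h)) (at x)"
    "\<And>i v. smooth_fun (\<lambda>x. K i x \<bullet> v)" by metis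
  have "(G has_derivative (\<lambda>h. \<Sum>i\<in>Basis. (K i x \<bullet> h) *\<^sub>R i)) (at x)" for x
    by (subst has_derivative_componentwise_within) (use K in \<open>auto simp: inner_sum_left_Basis\<close>)
  then have "has_lap UNIV f G (\<lambda>x. \<Sum>i\<in>Basis. K i x \<bullet> i)"
    unfolding has_lap_def using G(1)
    by (auto intro!: exI[of _ "\<lambda>h. \<Sum>i\<in>Basis. (K i _ \<bullet> h) *\<^sub>R i"] simp: inner_sum_left_Basis)
  then show ?thesis using that K G(2) cont by blast
qed

text \<open>By translation invariance the integral of a difference quotient vanishes; let the step tend to zero.\<close>

lemma integral_directional_derivative_eq_0:
  fixes \<psi> :: "'a::euclidean_space \<Rightarrow> real"
  assumes der: "\<And>x. (\<psi> has_derivative (\<lambda>h. P x \<bullet> h)) (at x)"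
    and cont: "continuous_on UNIV (\<lambda>x. P x \<bullet> v)"
    and supp: "\<And>x. norm x > R \<Longrightarrow> \<psi> x = 0"
  shows "integral\<^sup>L lebesgue (\<lambda>x. P x \<bullet> v) = 0"
proof -
  have P0: "P x = 0" if "norm x > R" for x
  proof -
    have "open {x::'a. norm x > R}"
      by (intro open_Collect_less continuous_intros)
    then have "(\<psi> has_derivative (\<lambda>h. 0 \<bullet> h)) (at x)"
      using has_derivative_transform_within_open[of "\<lambda>_. 0" "\<lambda>h. 0" x UNIV "{x. norm x > R}" \<psi>] that supp by auto
    then show ?thesis using grad_unique[OF der] by blast
  qed
  have "compact ((\<lambda>x. P x \<bullet> v) ` cball 0 R)"
    by (intro compact_continuous_image continuous_on_subset[OF cont]) auto
  then obtain B0 where B0: "\<And>x. norm x \<le> R \<Longrightarrow> \<bar>P x \<bullet> v\<bar> \<le> B0"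
    by (force dest!: compact_imp_bounded simp: bounded_iff)
  define B where "B = max B0 0"
  have B: "\<bar>P x \<bullet> v\<bar> \<le> B" for x
    using B0[of x] P0[of x] by (cases "norm x \<le> R") (auto simp: B_def)
  have contpsi: "continuous_on UNIV \<psi>"
    using der by (meson continuous_at_imp_continuous_on has_derivative_continuous)
  define s where "s n x = (\<psi> (x + (1 / real (Suc n)) *\<^sub>R v) - \<psi> x) * real (Suc n)" for n x
  \<comment> \<open>Every step is at most \<open>norm v\<close> long, so all difference quotients
    vanish outside this radius and share one dominating function.\<close>
  define R' where "R' = R + norm v"
  have along: "((\<lambda>t. \<psi> (x + t *\<^sub>R v)) has_real_derivative P (x + t *\<^sub>R v) \<bullet> v) (at t)" for x t
  proof -
    have "((\<lambda>t. x + t *\<^sub>R v) has_derivative (\<lambda>h. h *\<^sub>R v)) (at t)"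
      by (auto intro!: derivative_eq_intros)
    from has_derivative_compose[OF this der] show ?thesis
      by (simp add: has_field_derivative_def mult.commute[of _ "P (x + t *\<^sub>R v) \<bullet> v"])
  qed
  have sbound: "\<bar>s n x\<bar> \<le> indicator (cball 0 R') x * B" for n x
  proof (cases "x \<in> cball 0 R'")
    case True
    obtain \<xi> where "\<psi> (x + (1 / real (Suc n)) *\<^sub>R v) - \<psi> (x + 0 *\<^sub>R v) = (1 / real (Suc n) - 0) * (P (x + \<xi> *\<^sub>R v) \<bullet> v)"
      using MVT2[of 0 "1 / real (Suc n)", OF _ along[of x]] by auto
    then have "s n x = P (x + \<xi> *\<^sub>R v) \<bullet> v"
      by (simp add: s_def)
    then show ?thesis using True B by simp
  next
    case False
    have "norm ((1 / real (Suc n)) *\<^sub>R v) \<le> norm v"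
      by (simp add: divide_le_eq mult_ge1_I algebra_simps)
    then have "norm (x + (1 / real (Suc n)) *\<^sub>R v) > R"
      using False norm_diff_ineq[of x "(1 / real (Suc n)) *\<^sub>R v"] by (simp add: R'_def)
    moreover have "norm x > R"
      using False norm_ge_zero[of v] by (simp add: R'_def del: norm_ge_zero)
    ultimately have "s n x = 0"
      using supp by (simp add: s_def)
    then show ?thesis using False by simp
  qed
  have pw: "(\<lambda>n. s n x) \<longlonglongrightarrow> P x \<bullet> v" for x
  proof -
    have "((\<lambda>h. (\<psi> (x + (0 + h) *\<^sub>R v) - \<psi> (x + 0 *\<^sub>R v)) / h) \<longlongrightarrow> P x \<bullet> v) (at 0)"
      using along[of x 0] by (simp add: DERIV_def)
    moreover have "filterlim (\<lambda>n. 1 / real (Suc n)) (at 0) sequentially"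
      using LIMSEQ_Suc[OF lim_1_over_n[where 'a = real]] by (simp add: filterlim_at)
    ultimately show ?thesis
      using filterlim_compose[of "\<lambda>h. (\<psi> (x + (0 + h) *\<^sub>R v) - \<psi> (x + 0 *\<^sub>R v)) / h" "nhds (P x \<bullet> v)" "at 0" "\<lambda>n. 1 / real (Suc n)" sequentially]
      by (simp add: s_def)
  qed
  have meas: "continuous_on UNIV f \<Longrightarrow> f \<in> borel_measurable lborel" for f :: "'a \<Rightarrow> real"
    by (simp add: borel_measurable_continuous_onI)
  have scont: "continuous_on UNIV (s n)" for n
    unfolding s_def by (intro continuous_intros continuous_on_compose2[OF contpsi]) auto
  have "compact (\<psi> ` cball 0 R)"
    by (intro compact_continuous_image continuous_on_subset[OF contpsi]) auto
  then obtain C where C: "\<And>x. norm x \<le> R \<Longrightarrow> \<bar>\<psi> x\<bar> \<le> C"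
    by (force dest!: compact_imp_bounded simp: bounded_iff)
  have int: "integrable lborel \<psi>"
  proof (rule integrableI_bounded_set)
    show "AE x in lborel. x \<in> cball 0 R \<longrightarrow> norm (\<psi> x) \<le> C" using C by auto
    show "AE x in lborel. x \<notin> cball 0 R \<longrightarrow> \<psi> x = 0" using supp by auto
  qed (use meas[OF contpsi] emeasure_lborel_cbox_finite emeasure_lborel_cball_finite in auto)
  have shift: "integrable lborel (\<lambda>x. \<psi> (c + x))" "integral\<^sup>L lborel (\<lambda>x. \<psi> (c + x)) = integral\<^sup>L lborel \<psi>" for c
    using integrable_distr_eq[of "(+) c" lborel borel \<psi>] integral_distr[of "(+) c" lborel borel \<psi>]
      int meas[OF contpsi] by (simp_all add: lborel_distr_plus)
  have "integral\<^sup>L lborel (s n) = 0" for n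
    unfolding s_def using int shift by (simp add: add.commute[of _ "_ *\<^sub>R v"])
  moreover have "(\<lambda>n. integral\<^sup>L lborel (s n)) \<longlonglongrightarrow> integral\<^sup>L lborel (\<lambda>x. P x \<bullet> v)"
  proof (rule integral_dominated_convergence)
    show "integrable lborel (\<lambda>x. indicator (cball 0 R') x * B)"
      using emeasure_lborel_cball_finite[of 0 R'] by (intro integrable_mult_left) auto
    show "AE x in lborel. norm (s n x) \<le> indicator (cball 0 R') x * B" for n
      using sbound by auto
  qed (use meas[OF cont] meas[OF scont] pw in auto)
  ultimately have "integral\<^sup>L lborel (\<lambda>x. P x \<bullet> v) = 0"
    using LIMSEQ_unique[of "\<lambda>n. 0" 0] by simp
  then show ?thesis
    by (subst integral_completion) (use meas[OF cont] in auto)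
qed

text \<open>The integral of \<open>(a + t b)^2\<close> is nonnegative for every \<open>t\<close>. If
  the quadratic coefficient vanishes, a suitable \<open>t\<close> forces the mixed term to vanish as
  well.\<close>

lemma integral_Cauchy_Schwarz:
  fixes a b :: "'x \<Rightarrow> real"
  assumes "integrable M (\<lambda>x. (a x)\<^sup>2)" "integrable M (\<lambda>x. (b x)\<^sup>2)" "integrable M (\<lambda>x. a x * b x)"
  shows "(integral\<^sup>L M (\<lambda>x. a x * b x))\<^sup>2 \<le> integral\<^sup>L M (\<lambda>x. (a x)\<^sup>2) * integral\<^sup>L M (\<lambda>x. (b x)\<^sup>2)"
proof -
  define A B C where "A = integral\<^sup>L M (\<lambda>x. (a x)\<^sup>2)" and "B = integral\<^sup>L M (\<lambda>x. a x * b x)"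
    and "C = integral\<^sup>L M (\<lambda>x. (b x)\<^sup>2)"
  have q: "0 \<le> A + 2 * t * B + t\<^sup>2 * C" for t
  proof -
    have "0 \<le> integral\<^sup>L M (\<lambda>x. (a x + t * b x)\<^sup>2)"
      by (rule integral_nonneg_AE) auto
    also have "(\<lambda>x. (a x + t * b x)\<^sup>2) = (\<lambda>x. (a x)\<^sup>2 + 2 * t * (a x * b x) + t\<^sup>2 * (b x)\<^sup>2)"
      by (auto simp: power2_eq_square algebra_simps)
    also have "integral\<^sup>L M \<dots> = A + 2 * t * B + t\<^sup>2 * C"
      unfolding A_def B_def C_def using assms by simp
    finally show ?thesis .
  qed
  have "B\<^sup>2 \<le> A * C"
  proof (cases "C = 0")
    case True
    have "B = 0"
    proof (rule ccontr)
      assume "B \<noteq> 0"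
      then have "A + 2 * (- (A + 1) / (2 * B)) * B = - 1" by (simp add: field_simps)
      then show False using q[of "- (A + 1) / (2 * B)"] True by simp
    qed
    then show ?thesis using True by simp
  next
    case False
    have "C \<ge> 0" unfolding C_def by (rule integral_nonneg_AE) auto
    with False have "C > 0" by simp
    have "A + 2 * (- B / C) * B + (- B / C)\<^sup>2 * C = A - B\<^sup>2 / C"
      using False by (simp add: field_simps power2_eq_square)
    with q[of "- B / C"] have "B\<^sup>2 / C \<le> A" by simp
    then show ?thesis using \<open>C > 0\<close> by (simp add: field_simps)
  qed
  then show ?thesis by (simp add: A_def B_def C_def)
qed

lemma vanishing_limit_L2:
  fixes a :: "nat \<Rightarrow> 'x \<Rightarrow> real" and h :: "'x \<Rightarrow> real"
  assumes "\<And>k. integrable M (\<lambda>x. (a k x)\<^sup>2)" "integrable M (\<lambda>x. (h x)\<^sup>2)"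
    and "\<And>k. integrable M (\<lambda>x. a k x * h x)" "(\<lambda>k. integral\<^sup>L M (\<lambda>x. (a k x)\<^sup>2)) \<longlonglongrightarrow> 0"
  shows "(\<lambda>k. integral\<^sup>L M (\<lambda>x. a k x * h x)) \<longlonglongrightarrow> 0"
proof -
  have "(\<lambda>k. (integral\<^sup>L M (\<lambda>x. a k x * h x))\<^sup>2) \<longlonglongrightarrow> 0"
  proof (rule tendsto_sandwich[OF _ _ tendsto_const])
    show "(\<lambda>k. integral\<^sup>L M (\<lambda>x. (a k x)\<^sup>2) * integral\<^sup>L M (\<lambda>x. (h x)\<^sup>2)) \<longlonglongrightarrow> 0"
      using tendsto_mult_right[OF assms(4), of "integral\<^sup>L M (\<lambda>x. (h x)\<^sup>2)"] by simp
  qed (use integral_Cauchy_Schwarz[OF assms(1,2,3)] in auto)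
  from tendsto_real_sqrt[OF this] show ?thesis
    by (simp add: tendsto_rabs_zero_iff)
qed

section \<open>Integrals against a function in \<open>H^1_0\<close> of a bounded open set\<close>

locale weak_setting =
  fixes \<Omega> :: "'a::euclidean_space set" and u :: "'a \<Rightarrow> real" and Du :: "'a \<Rightarrow> 'a"
  assumes open_dom: "open \<Omega>" and bounded_dom: "bounded \<Omega>"
    and H10: "H10_with_grad \<Omega> u Du"
begin

abbreviation "M \<equiv> lebesgue_on \<Omega>"

lemma sets_dom: "\<Omega> \<in> sets lebesgue"
  using open_dom by (simp add: borel_open)

lemma space_M: "space M = \<Omega>"
  by (simp add: space_restrict_space)

lemma set_lebesgue_integral_M: "set_lebesgue_integral lebesgue \<Omega> f = integral\<^sup>L M f"
  for f :: "'a \<Rightarrow> real"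
  using sets_dom by (simp add: set_lebesgue_integral_def integral_restrict_space)

lemma integrable_M_iff: "integrable M f \<longleftrightarrow> set_integrable lebesgue \<Omega> f" for f :: "'a \<Rightarrow> real"
  using sets_dom by (simp add: set_integrable_def integrable_restrict_space)

lemma finite_M: "finite_measure M"
  by (rule finite_measure_lebesgue_on[OF lmeasurable_open[OF bounded_dom open_dom]])

lemma u_meas: "u \<in> borel_measurable M" and u_L2: "integrable M (\<lambda>x. (u x)\<^sup>2)"
  and Du_meas: "Du \<in> borel_measurable M" and Du_L2: "integrable M (\<lambda>x. (norm (Du x))\<^sup>2)"
  using H10 by (auto simp: H10_with_grad_def L2_on_def integrable_M_iff)

lemma continuous_meas: "continuous_on \<Omega> f \<Longrightarrow> f \<in> borel_measurable M" for f :: "'a \<Rightarrow> real"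
  using sets_dom by (rule continuous_imp_measurable_on_sets_lebesgue[rotated])

lemma continuous_bounded:
  fixes g :: "'a \<Rightarrow> real"
  assumes "continuous_on UNIV g"
  shows "\<exists>B. \<forall>x\<in>\<Omega>. \<bar>g x\<bar> \<le> B"
proof -
  have "compact (g ` closure \<Omega>)"
    using bounded_dom by (intro compact_continuous_image continuous_on_subset[OF assms]) auto
  then obtain B where "\<forall>y\<in>g ` closure \<Omega>. norm y \<le> B"
    using compact_imp_bounded bounded_iff by blast
  then show ?thesis using closure_subset[of \<Omega>] by (intro exI[of _ B]) auto
qed

lemma bounded_integrable:
  fixes g :: "'a \<Rightarrow> real"
  assumes "g \<in> borel_measurable M" "\<And>x. x \<in> \<Omega> \<Longrightarrow> \<bar>g x\<bar> \<le> B"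
  shows "integrable M g"
  by (rule finite_measure.integrable_const_bound[OF finite_M _ assms(1), of B])
     (use assms(2) in \<open>auto simp: space_M intro!: AE_I2\<close>)

lemma L2_times_bounded:
  fixes f g :: "'a \<Rightarrow> real"
  assumes f: "f \<in> borel_measurable M" "integrable M (\<lambda>x. (f x)\<^sup>2)"
    and g: "g \<in> borel_measurable M" "\<And>x. x \<in> \<Omega> \<Longrightarrow> \<bar>g x\<bar> \<le> B"
  shows "integrable M (\<lambda>x. f x * g x)"
proof (rule Bochner_Integration.integrable_bound)
  show "integrable M (\<lambda>x. (f x)\<^sup>2 + B\<^sup>2)"
    by (intro Bochner_Integration.integrable_add f(2) finite_measure.integrable_const[OF finite_M])
  show "AE x in M. norm (f x * g x) \<le> norm ((f x)\<^sup>2 + B\<^sup>2)"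
  proof (rule AE_I2)
    fix x assume "x \<in> space M"
    then have "\<bar>g x\<bar> \<le> B" using g(2) by (simp add: space_M)
    then have "\<bar>f x * g x\<bar> \<le> \<bar>f x\<bar> * B" by (simp add: abs_mult mult_left_mono)
    also have "\<dots> \<le> (f x)\<^sup>2 + B\<^sup>2"
      using sum_squares_bound[of "\<bar>f x\<bar>" B] mult_nonneg_nonneg[OF abs_ge_zero, of B "f x"] \<open>\<bar>g x\<bar> \<le> B\<close>
        abs_ge_zero[of "g x"] unfolding power2_abs by linarith
    finally show "norm (f x * g x) \<le> norm ((f x)\<^sup>2 + B\<^sup>2)" by simp
  qed
qed (use f g in measurable)

lemma bounded_minus_L2:
  fixes f g :: "'a \<Rightarrow> real"
  assumes f: "f \<in> borel_measurable M" "integrable M (\<lambda>x. (f x)\<^sup>2)"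
    and g: "g \<in> borel_measurable M" "\<And>x. x \<in> \<Omega> \<Longrightarrow> \<bar>g x\<bar> \<le> B"
  shows "integrable M (\<lambda>x. (g x - f x)\<^sup>2)"
proof -
  have "integrable M (\<lambda>x. (g x)\<^sup>2)"
    using g power_mono[OF g(2), of _ 2] by (intro bounded_integrable[where B = "B\<^sup>2"]) auto
  then have "integrable M (\<lambda>x. (g x)\<^sup>2 - 2 * (f x * g x) + (f x)\<^sup>2)"
    using f(2) L2_times_bounded[OF f g] by auto
  then show ?thesis by (simp add: power2_diff algebra_simps)
qed

lemma u_times_bounded: "g \<in> borel_measurable M \<Longrightarrow> (\<And>x. x \<in> \<Omega> \<Longrightarrow> \<bar>g x\<bar> \<le> B) \<Longrightarrow> integrable M (\<lambda>x. u x * g x)"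
  by (rule L2_times_bounded[OF u_meas u_L2])

lemma Du_component: "(\<lambda>x. Du x \<bullet> v) \<in> borel_measurable M" "integrable M (\<lambda>x. (Du x \<bullet> v)\<^sup>2)"
proof -
  show m: "(\<lambda>x. Du x \<bullet> v) \<in> borel_measurable M" using Du_meas by measurable
  show "integrable M (\<lambda>x. (Du x \<bullet> v)\<^sup>2)"
  proof (rule Bochner_Integration.integrable_bound)
    show "integrable M (\<lambda>x. (norm (Du x))\<^sup>2 * (norm v)\<^sup>2)" using Du_L2 by simp
    show "AE x in M. norm ((Du x \<bullet> v)\<^sup>2) \<le> norm ((norm (Du x))\<^sup>2 * (norm v)\<^sup>2)"
      using Cauchy_Schwarz_ineq2[of "Du _" v] by (auto intro!: AE_I2 abs_le_square_iff[THEN iffD1] simp flip: power_mult_distrib simp: abs_mult)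
  qed (use m in measurable)
qed

text \<open>The complement of the support is an open neighbourhood of every point outside the
  domain, so the gradient vanishes there too and integrals over the domain extend to the whole
  space.\<close>

lemma test_fun_gradient:
  assumes "test_fun \<Omega> \<phi>"
  obtains G where "\<And>x. (\<phi> has_derivative (\<lambda>h. G x \<bullet> h)) (at x)" "\<And>x. grad \<phi> x = G x"
    "\<And>v. continuous_on UNIV (\<lambda>x. G x \<bullet> v)" "\<And>x. x \<notin> \<Omega> \<Longrightarrow> \<phi> x = 0" "\<And>x. x \<notin> \<Omega> \<Longrightarrow> G x = 0"
    "continuous_on UNIV \<phi>"
proof -
  have sm: "smooth_fun \<phi>" using assms by (simp add: test_fun_def)
  obtain G L where G: "has_lap UNIV \<phi> G L" "\<And>v. continuous_on UNIV (\<lambda>x. G x \<bullet> v)"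
    by (rule smooth_fun_has_lap[OF sm]) (rule that, assumption, blast)
  note d = has_lapD[OF G(1) UNIV_I]
  have z: "\<phi> x = 0" if "x \<notin> closure {x. \<phi> x \<noteq> 0}" for x
    using that closure_subset[of "{x. \<phi> x \<noteq> 0}"] by blast
  have supp: "closure {x. \<phi> x \<noteq> 0} \<subseteq> \<Omega>"
    using assms by (simp add: test_fun_def)
  have "G x = 0" if "x \<notin> \<Omega>" for x
  proof -
    have "(\<phi> has_derivative (\<lambda>h. 0 \<bullet> h)) (at x)"
    proof (rule has_derivative_transform_within_open)
      show "((\<lambda>_. 0) has_derivative (\<lambda>h. 0 \<bullet> h)) (at x)" by simp
      show "open (- closure {x. \<phi> x \<noteq> 0})" by (rule open_Compl[OF closed_closure])
      show "x \<in> - closure {x. \<phi> x \<noteq> 0}" using contra_subsetD[OF supp that] by simp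
      show "0 = \<phi> y" if "y \<in> - closure {x. \<phi> x \<noteq> 0}" for y using z[of y] that by simp
    qed
    then show ?thesis by (rule grad_unique[OF d])
  qed
  moreover have "\<phi> x = 0" if "x \<notin> \<Omega>" for x by (rule z) (rule contra_subsetD[OF supp that])
  moreover have "continuous_on UNIV \<phi>"
    using d by (meson continuous_at_imp_continuous_on has_derivative_continuous)
  ultimately show ?thesis by (intro that[OF d grad_eq[OF d] G(2)])
qed

text \<open>No boundary term: \<open>u\<close> is a limit of test functions, whose products with \<open>h\<close> have compact support.\<close>

lemma integration_by_parts:
  assumes h: "\<And>x. (h has_derivative (\<lambda>k. H x \<bullet> k)) (at x)"
    and Hv: "continuous_on UNIV (\<lambda>x. H x \<bullet> v)"
  shows "integrable M (\<lambda>x. (Du x \<bullet> v) * h x)" "integrable M (\<lambda>x. u x * (H x \<bullet> v))"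
    and "integral\<^sup>L M (\<lambda>x. (Du x \<bullet> v) * h x) + integral\<^sup>L M (\<lambda>x. u x * (H x \<bullet> v)) = 0"
proof -
  have conth: "continuous_on UNIV h"
    using h by (meson continuous_at_imp_continuous_on has_derivative_continuous)
  have meas: "continuous_on UNIV f \<Longrightarrow> f \<in> borel_measurable M" for f :: "'a \<Rightarrow> real"
    by (rule continuous_meas) (rule continuous_on_subset, auto)
  obtain B1 where B1: "\<And>x. x \<in> \<Omega> \<Longrightarrow> \<bar>h x\<bar> \<le> B1" using continuous_bounded[OF conth] by blast
  obtain B2 where B2: "\<And>x. x \<in> \<Omega> \<Longrightarrow> \<bar>H x \<bullet> v\<bar> \<le> B2" using continuous_bounded[OF Hv] by blast
  show i1: "integrable M (\<lambda>x. (Du x \<bullet> v) * h x)"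
    by (rule L2_times_bounded[OF Du_component meas[OF conth] B1])
  show i2: "integrable M (\<lambda>x. u x * (H x \<bullet> v))"
    by (rule u_times_bounded[OF meas[OF Hv] B2])
  obtain \<phi> where test: "\<And>k. test_fun \<Omega> (\<phi> k)"
    and lim_u: "(\<lambda>k. integral\<^sup>L M (\<lambda>x. (\<phi> k x - u x)\<^sup>2)) \<longlonglongrightarrow> 0"
    and lim_Du: "(\<lambda>k. integral\<^sup>L M (\<lambda>x. (norm (grad (\<phi> k) x - Du x))\<^sup>2)) \<longlonglongrightarrow> 0"
    using H10 by (auto simp: H10_with_grad_def set_lebesgue_integral_M)
  define a where "a k x = grad (\<phi> k) x \<bullet> v - Du x \<bullet> v" for k x
  define b where "b k x = \<phi> k x - u x" for k x
  \<comment> \<open>The identity among these facts is the exact formula for the test function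
    \<open>\<phi> k\<close> with the terms of \<open>u\<close> moved to the right. The right side
    does not depend on \<open>k\<close> and the left side tends to zero, so the right side is
    zero.\<close>
  have *: "integrable M (\<lambda>x. (a k x)\<^sup>2)" "integrable M (\<lambda>x. (b k x)\<^sup>2)"
     "integrable M (\<lambda>x. a k x * h x)" "integrable M (\<lambda>x. b k x * (H x \<bullet> v))"
     "integral\<^sup>L M (\<lambda>x. a k x * h x) + integral\<^sup>L M (\<lambda>x. b k x * (H x \<bullet> v)) =
       - (integral\<^sup>L M (\<lambda>x. (Du x \<bullet> v) * h x) + integral\<^sup>L M (\<lambda>x. u x * (H x \<bullet> v)))"
     "integral\<^sup>L M (\<lambda>x. (a k x)\<^sup>2) \<le> integral\<^sup>L M (\<lambda>x. (norm (grad (\<phi> k) x - Du x))\<^sup>2) * (norm v)\<^sup>2" for k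
  proof -
    obtain G where G: "\<And>x. (\<phi> k has_derivative (\<lambda>h. G x \<bullet> h)) (at x)" "\<And>x. grad (\<phi> k) x = G x"
      "\<And>v. continuous_on UNIV (\<lambda>x. G x \<bullet> v)" "\<And>x. x \<notin> \<Omega> \<Longrightarrow> \<phi> k x = 0" "\<And>x. x \<notin> \<Omega> \<Longrightarrow> G x = 0"
      "continuous_on UNIV (\<phi> k)"
      by (rule test_fun_gradient[OF test[of k]]) (rule that, blast+)
    obtain B3 where B3: "\<And>x. x \<in> \<Omega> \<Longrightarrow> \<bar>\<phi> k x\<bar> \<le> B3" using continuous_bounded[OF G(6)] by blast
    have gi: "integrable M (\<lambda>x. (G x \<bullet> w - Du x \<bullet> w)\<^sup>2)" for w
    proof -
      obtain B where "\<And>x. x \<in> \<Omega> \<Longrightarrow> \<bar>G x \<bullet> w\<bar> \<le> B" using continuous_bounded[OF G(3)] by blast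
      then show ?thesis by (intro bounded_minus_L2[OF Du_component meas[OF G(3)]])
    qed
    show ai: "integrable M (\<lambda>x. (a k x)\<^sup>2)" using gi by (simp add: a_def G(2))
    show bi: "integrable M (\<lambda>x. (b k x)\<^sup>2)"
      unfolding b_def by (rule bounded_minus_L2[OF u_meas u_L2 meas[OF G(6)] B3])
    have am: "a k \<in> borel_measurable M"
      unfolding a_def G(2) using meas[OF G(3)[of v]] Du_component(1)[of v] by measurable
    have bm: "b k \<in> borel_measurable M"
      unfolding b_def using meas[OF G(6)] u_meas by measurable
    show ahi: "integrable M (\<lambda>x. a k x * h x)"
      by (rule L2_times_bounded[OF am ai meas[OF conth] B1])
    show bhi: "integrable M (\<lambda>x. b k x * (H x \<bullet> v))"
      by (rule L2_times_bounded[OF bm bi meas[OF Hv] B2])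
    obtain R where R: "\<And>x. x \<in> \<Omega> \<Longrightarrow> norm x \<le> R"
      using bounded_dom by (auto simp: bounded_iff)
    have z: "integral\<^sup>L lebesgue (\<lambda>x. (\<phi> k x *\<^sub>R H x + h x *\<^sub>R G x) \<bullet> v) = 0"
    proof (rule integral_directional_derivative_eq_0)
      show "((\<lambda>x. \<phi> k x * h x) has_derivative (\<lambda>w. (\<phi> k x *\<^sub>R H x + h x *\<^sub>R G x) \<bullet> w)) (at x)" for x
        using has_derivative_mult[OF G(1) h] by (simp add: inner_add_left mult.commute)
      show "continuous_on UNIV (\<lambda>x. (\<phi> k x *\<^sub>R H x + h x *\<^sub>R G x) \<bullet> v)"
        unfolding inner_add_left inner_scaleR_left by (intro continuous_intros Hv G conth)
      show "\<phi> k x * h x = 0" if "R < norm x" for x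
        using R[of x] G(4)[of x] that by force
    qed
    have eq: "(\<lambda>x. (\<phi> k x *\<^sub>R H x + h x *\<^sub>R G x) \<bullet> v) =
      (\<lambda>x. indicator \<Omega> x *\<^sub>R ((\<phi> k x *\<^sub>R H x + h x *\<^sub>R G x) \<bullet> v))"
      using G(4,5) by (intro ext, case_tac "x \<in> \<Omega>") simp_all
    have "integral\<^sup>L lebesgue (\<lambda>x. indicator \<Omega> x *\<^sub>R ((\<phi> k x *\<^sub>R H x + h x *\<^sub>R G x) \<bullet> v)) = 0"
      unfolding eq[symmetric] by (rule z)
    then have "integral\<^sup>L M (\<lambda>x. (\<phi> k x *\<^sub>R H x + h x *\<^sub>R G x) \<bullet> v) = 0"
      using sets_dom by (simp add: integral_restrict_space)
    also have "(\<lambda>x. (\<phi> k x *\<^sub>R H x + h x *\<^sub>R G x) \<bullet> v) =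
      (\<lambda>x. a k x * h x + b k x * (H x \<bullet> v) + (Du x \<bullet> v) * h x + u x * (H x \<bullet> v))"
      by (auto simp: a_def b_def G(2) algebra_simps)
    finally show "integral\<^sup>L M (\<lambda>x. a k x * h x) + integral\<^sup>L M (\<lambda>x. b k x * (H x \<bullet> v)) =
       - (integral\<^sup>L M (\<lambda>x. (Du x \<bullet> v) * h x) + integral\<^sup>L M (\<lambda>x. u x * (H x \<bullet> v)))"
      using ahi bhi i1 i2 by simp
    have "integral\<^sup>L M (\<lambda>x. (a k x)\<^sup>2) \<le> integral\<^sup>L M (\<lambda>x. (norm (grad (\<phi> k) x - Du x))\<^sup>2 * (norm v)\<^sup>2)"
    proof (rule integral_mono[OF ai])
      have "(\<lambda>x. (norm (grad (\<phi> k) x - Du x))\<^sup>2) = (\<lambda>x. \<Sum>i\<in>Basis. (G x \<bullet> i - Du x \<bullet> i)\<^sup>2)"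
        unfolding power2_norm_eq_inner
        by (rule ext, subst euclidean_inner) (simp add: G(2) inner_diff_left power2_eq_square)
      then have "integrable M (\<lambda>x. (norm (grad (\<phi> k) x - Du x))\<^sup>2)" using gi by simp
      then show "integrable M (\<lambda>x. (norm (grad (\<phi> k) x - Du x))\<^sup>2 * (norm v)\<^sup>2)" by simp
      show "(a k x)\<^sup>2 \<le> (norm (grad (\<phi> k) x - Du x))\<^sup>2 * (norm v)\<^sup>2" for x
        using Cauchy_Schwarz_ineq2[of "grad (\<phi> k) x - Du x" v]
        unfolding a_def power_mult_distrib[symmetric] inner_diff_left[symmetric]
        by (intro abs_le_square_iff[THEN iffD1]) (simp add: abs_mult)
    qed
    then show "integral\<^sup>L M (\<lambda>x. (a k x)\<^sup>2) \<le> integral\<^sup>L M (\<lambda>x. (norm (grad (\<phi> k) x - Du x))\<^sup>2) * (norm v)\<^sup>2"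
      by simp
  qed
  have "(\<lambda>k. integral\<^sup>L M (\<lambda>x. (a k x)\<^sup>2)) \<longlonglongrightarrow> 0"
  proof (rule tendsto_sandwich[OF _ _ tendsto_const])
    show "(\<lambda>k. integral\<^sup>L M (\<lambda>x. (norm (grad (\<phi> k) x - Du x))\<^sup>2) * (norm v)\<^sup>2) \<longlonglongrightarrow> 0"
      using tendsto_mult_right[OF lim_Du, of "(norm v)\<^sup>2"] by simp
  qed (use *(6) in \<open>auto intro!: eventuallyI integral_nonneg_AE\<close>)
  moreover have "(\<lambda>k. integral\<^sup>L M (\<lambda>x. (b k x)\<^sup>2)) \<longlonglongrightarrow> 0"
    using lim_u by (simp add: b_def)
  moreover have "integrable M (\<lambda>x. (h x)\<^sup>2)" "integrable M (\<lambda>x. (H x \<bullet> v)\<^sup>2)"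
    using bounded_minus_L2[of "\<lambda>_. 0", OF _ _ meas[OF conth] B1]
      bounded_minus_L2[of "\<lambda>_. 0", OF _ _ meas[OF Hv] B2] by simp_all
  ultimately have "(\<lambda>k. integral\<^sup>L M (\<lambda>x. a k x * h x) + integral\<^sup>L M (\<lambda>x. b k x * (H x \<bullet> v))) \<longlonglongrightarrow> 0 + 0"
    using * by (intro tendsto_add vanishing_limit_L2) auto
  then show "integral\<^sup>L M (\<lambda>x. (Du x \<bullet> v) * h x) + integral\<^sup>L M (\<lambda>x. u x * (H x \<bullet> v)) = 0"
    unfolding *(5) by (simp add: LIMSEQ_const_iff)
qed

text \<open>Integration by parts in each coordinate direction, with the corresponding component of
  the gradient of \<open>\<phi>\<close> as smooth factor. It removes \<open>Du\<close> from the
  supersolution inequality, leaving integrals of \<open>u\<close> against explicit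
  functions.\<close>

lemma weak_laplacian:
  assumes "test_fun \<Omega> \<phi>" "has_lap UNIV \<phi> G L"
  shows "integrable M (\<lambda>x. u x * L x)"
    and "integral\<^sup>L M (\<lambda>x. Du x \<bullet> grad \<phi> x) = - integral\<^sup>L M (\<lambda>x. u x * L x)"
proof -
  have sm: "smooth_fun \<phi>" using assms by (simp add: test_fun_def)
  obtain G' K where K: "has_lap UNIV \<phi> G' (\<lambda>x. \<Sum>i\<in>Basis. K i x \<bullet> i)"
    "\<And>i x. i \<in> Basis \<Longrightarrow> ((\<lambda>x. G' x \<bullet> i) has_derivative (\<lambda>h. K i x \<bullet> h)) (at x)"
    "\<And>i v. i \<in> Basis \<Longrightarrow> continuous_on UNIV (\<lambda>x. K i x \<bullet> v)"
    by (rule smooth_fun_has_lap[OF sm]) (rule that, assumption, blast+)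
  have L: "L x = (\<Sum>i\<in>Basis. K i x \<bullet> i)" and G: "grad \<phi> x = G' x" for x
    using has_lap_unique(2)[OF assms(2) K(1)] grad_eq[OF has_lapD[OF K(1)]] by auto
  have ibp: "integrable M (\<lambda>x. (Du x \<bullet> i) * (G' x \<bullet> i))" "integrable M (\<lambda>x. u x * (K i x \<bullet> i))"
    "integral\<^sup>L M (\<lambda>x. (Du x \<bullet> i) * (G' x \<bullet> i)) = - integral\<^sup>L M (\<lambda>x. u x * (K i x \<bullet> i))"
    if "i \<in> Basis" for i
    using integration_by_parts[OF K(2)[OF that] K(3)[OF that], of i] by auto
  show "integrable M (\<lambda>x. u x * L x)"
    unfolding L sum_distrib_left using ibp by auto
  show "integral\<^sup>L M (\<lambda>x. Du x \<bullet> grad \<phi> x) = - integral\<^sup>L M (\<lambda>x. u x * L x)"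
    unfolding L G sum_distrib_left using ibp
    by (subst euclidean_inner) (simp add: sum_negf)
qed

end

section \<open>Comparison and propagation of zeros\<close>

abbreviation dcpos :: "real \<Rightarrow> real" where
  "dcpos s \<equiv> bump 0 s + bump 1 s"

lemma continuous_on_bump: "continuous_on A f \<Longrightarrow> continuous_on A (\<lambda>x. bump n (f x))"
proof (rule continuous_on_compose2[of UNIV "bump n"])
  show "continuous_on UNIV (bump n)"
    using bump_deriv by (meson DERIV_isCont continuous_at_imp_continuous_on)
qed auto

lemma continuous_on_cpos: "continuous_on A f \<Longrightarrow> continuous_on A (\<lambda>x. cpos (f x))"
  unfolding cpos_def by (intro continuous_intros continuous_on_bump)

lemma smooth_on_differentiable: "smooth_on S f \<Longrightarrow> x \<in> S \<Longrightarrow> f differentiable (at x)"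
  unfolding smooth_on_def differentiable_def by (drule spec[of _ "Suc 0"]) auto

lemma smooth_on_continuous: "smooth_on S f \<Longrightarrow> continuous_on S f"
  by (meson continuous_at_imp_continuous_on differentiable_imp_continuous_within smooth_on_differentiable)

text \<open>The constant \<open>c\<close> stays free: comparison and propagation of zeros use only
  its sign, and the critical value enters in \<open>contact\<close>.\<close>

locale supersolution = weak_setting +
  fixes c lam :: real
  assumes zero_notin: "0 \<notin> \<Omega>" and c_nonneg: "c \<ge> 0" and lam_nonneg: "lam \<ge> 0"
    and u_cont: "continuous_on \<Omega> u" and u_nonneg: "\<And>x. x \<in> \<Omega> \<Longrightarrow> u x \<ge> 0"
    and supersol: "\<And>\<phi>. test_fun \<Omega> \<phi> \<Longrightarrow> (\<And>x. \<phi> x \<ge> 0) \<Longrightarrow>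
          integral\<^sup>L (lebesgue_on \<Omega>) (\<lambda>x. Du x \<bullet> grad \<phi> x)
            - c * integral\<^sup>L (lebesgue_on \<Omega>) (\<lambda>x. u x * \<phi> x / (norm x)\<^sup>2)
          \<ge> - lam * integral\<^sup>L (lebesgue_on \<Omega>) (\<lambda>x. u x * \<phi> x)"
begin

text \<open>The set where \<open>f\<close> is nonzero is open and null, hence empty.\<close>

lemma AE_zero_imp_zero:
  assumes U: "open U" "U \<subseteq> \<Omega>" "continuous_on U f" and ae: "AE x in M. x \<in> U \<longrightarrow> f x = (0::real)" and x: "x \<in> U"
  shows "f x = 0"
proof -
  have "open (U \<inter> f -` (- {0}))"
    by (rule continuous_open_preimage[OF U(3,1)]) auto
  moreover have "U \<inter> f -` (- {0}) = {x \<in> U. f x \<noteq> 0}" by auto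
  ultimately have op: "open {x \<in> U. f x \<noteq> 0}" by simp
  have "AE x in lebesgue. x \<in> \<Omega> \<longrightarrow> x \<in> U \<longrightarrow> f x = 0"
    using ae sets_dom by (simp add: AE_restrict_space_iff)
  moreover have "{x \<in> U. f x \<noteq> 0} \<in> sets lebesgue"
    using op by (simp add: borel_open)
  ultimately have "{x \<in> U. f x \<noteq> 0} \<in> null_sets lebesgue"
    using U(2) by (subst AE_iff_null_sets) (auto elim: eventually_mono)
  then have "{x \<in> U. f x \<noteq> 0} = {}"
    using op open_not_negligible by (auto simp: negligible_iff_null_sets)
  then show ?thesis using x by blast
qed

lemma compact_support:
  fixes g :: "'a \<Rightarrow> real"
  assumes g: "continuous_on \<Omega> g" and K: "compact K" "K \<subseteq> \<Omega>" and z: "\<And>x. x \<in> \<Omega> - K \<Longrightarrow> g x = 0"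
  shows "integrable M (\<lambda>x. u x * g x)"
proof -
  have "compact (g ` K)"
    by (intro compact_continuous_image continuous_on_subset[OF g] K)
  then obtain B0 where B0: "\<forall>y\<in>g ` K. norm y \<le> B0"
    using compact_imp_bounded bounded_iff by blast
  have "\<bar>g x\<bar> \<le> max B0 0" if "x \<in> \<Omega>" for x
    using z[of x] B0 that by (cases "x \<in> K") (auto simp: le_max_iff_disj)
  then show ?thesis by (rule u_times_bounded[OF continuous_meas[OF g]])
qed

text \<open>On \<open>S\<close>, this is the operator \<open>- \<Delta> - c / |x|^2 + lam\<close>
  applied to \<open>cpos \<circ> v\<close>, without the term \<open>cpos'' (v) |V|^2\<close> of the
  Laplacian, whose sign is favourable.\<close>

definition comparison :: "'a set \<Rightarrow> ('a \<Rightarrow> real) \<Rightarrow> ('a \<Rightarrow> real) \<Rightarrow> 'a \<Rightarrow> real" where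
  "comparison S v L x = (if x \<in> S then - (dcpos (v x) * L x) - c * (cpos (v x) / (norm x)\<^sup>2) + lam * cpos (v x) else 0)"

text \<open>Convexity of \<open>cpos\<close> gives \<open>\<Delta> (cpos \<circ> v) \<ge> cpos' (v) \<Delta> v\<close>, so that \<open>cpos \<circ> v\<close>,
  extended by zero, is a test function whatever happens at the boundary of the set where \<open>v > 0\<close>.\<close>

lemma comparison_inequality:
  assumes S: "open S" and v: "smooth_on S v" "has_lap S v V L" "continuous_on S L"
    and K: "compact {x \<in> S. v x \<ge> 0}" "{x \<in> S. v x \<ge> 0} \<subseteq> \<Omega>"
  shows "continuous_on \<Omega> (comparison S v L)" "integrable M (\<lambda>x. u x * comparison S v L x)"
    and "0 \<le> integral\<^sup>L M (\<lambda>x. u x * comparison S v L x)"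
proof -
  define K where "K = {x \<in> S. v x \<ge> 0}"
  have compK: "compact K" and Ksub: "K \<subseteq> \<Omega>" and KS: "K \<subseteq> S" using K by (auto simp: K_def)
  have openK: "open (- K)" using compK by (simp add: compact_imp_closed open_Compl)
  have outK: "v x < 0" if "x \<in> S" "x \<notin> K" for x using that by (auto simp: K_def)
  have bump0: "bump n (v x) = 0" if "x \<in> S" "x \<notin> K" for x n using outK[OF that] by (simp add: bump_def)
  have norm_pos: "norm x \<noteq> 0" if "x \<in> \<Omega>" for x using zero_notin that by auto
  have contv: "continuous_on S v" by (rule smooth_on_continuous[OF v(1)])
  define Z where "Z = comparison S v L"
  have Z0: "Z x = 0" if "x \<notin> K" for x
    using bump0 cpos_simps(1)[of "v x"] outK[of x] that by (auto simp: Z_def comparison_def)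
  \<comment> \<open>The formula is used on \<open>S\<close> and zero off \<open>K\<close>; both
    apply on the overlap because \<open>v\<close> is strictly negative in \<open>S - K\<close>. The
    smoothness of \<open>\<phi>\<close> below rests on the same two descriptions.\<close>
  have split: "\<Omega> = (S \<inter> \<Omega>) \<union> (\<Omega> - K)" using KS by auto
  have openSK: "open (S \<inter> \<Omega>)" "open (\<Omega> - K)"
    using S open_dom openK compK by (auto simp: compact_imp_closed open_Diff)
  have Zcont: "continuous_on \<Omega> Z"
  proof (subst split, rule continuous_on_open_Un[OF openSK])
    have "continuous_on (S \<inter> \<Omega>) (\<lambda>x. - (dcpos (v x) * L x) - c * (cpos (v x) / (norm x)\<^sup>2) + lam * cpos (v x))"
      using norm_pos
      by (intro continuous_intros continuous_on_bump continuous_on_cpos continuous_on_subset[OF contv] continuous_on_subset[OF v(3)]) auto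
    then show "continuous_on (S \<inter> \<Omega>) Z"
      by (rule continuous_on_eq) (auto simp: Z_def comparison_def)
    show "continuous_on (\<Omega> - K) Z"
      by (rule continuous_on_eq[of _ "\<lambda>_. 0"]) (auto simp: Z0)
  qed
  then show "continuous_on \<Omega> (comparison S v L)" by (simp add: Z_def)
  have Zint: "integrable M (\<lambda>x. u x * Z x)"
    by (rule compact_support[OF Zcont compK Ksub]) (simp add: Z0)
  then show "integrable M (\<lambda>x. u x * comparison S v L x)" by (simp add: Z_def)
  define \<phi> where "\<phi> x = (if x \<in> S then cpos (v x) else 0)" for x
  have \<phi>_S: "x \<in> S \<Longrightarrow> cpos (v x) = \<phi> x" and \<phi>_K: "x \<in> - K \<Longrightarrow> 0 = \<phi> x" for x
    using outK[of x] by (auto simp: \<phi>_def cpos_simps)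
  have "smooth_on S (\<lambda>x. cpos (v x))" by (rule smooth_on_cpos[OF v(1)])
  then have "cdiff k (S \<union> - K) \<phi>" for k
    unfolding smooth_on_def
    by (intro cdiff_Un S openK cdiff_cong[OF S \<phi>_S] cdiff_cong[OF openK \<phi>_K] cdiff_const) auto
  moreover have "S \<union> - K = UNIV" using KS by auto
  ultimately have sm: "smooth_fun \<phi>" by (simp add: smooth_fun_iff smooth_on_def)
  have "{x. \<phi> x \<noteq> 0} \<subseteq> K" using \<phi>_K by force
  then have "closure {x. \<phi> x \<noteq> 0} \<subseteq> K" using compK by (simp add: closure_minimal compact_imp_closed)
  then have test: "test_fun \<Omega> \<phi>"
    unfolding test_fun_def using sm Ksub \<open>{x. \<phi> x \<noteq> 0} \<subseteq> K\<close> bounded_subset[OF compact_imp_bounded[OF compK]]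
    by (simp add: compact_closure subset_trans)
  obtain G L\<phi> where G': "has_lap UNIV \<phi> G L\<phi>"
    by (rule smooth_fun_has_lap[OF sm]) (rule that)
  have LS: "L\<phi> x = bump 3 (v x) * (norm (V x))\<^sup>2 + dcpos (v x) * L x" if "x \<in> S" for x
  proof -
    have "has_lap S (\<lambda>x. cpos (v x)) (\<lambda>x. dcpos (v x) *\<^sub>R V x) (\<lambda>x. bump 3 (v x) * (norm (V x))\<^sup>2 + dcpos (v x) * L x)"
      by (rule has_lap_compose[OF v(2)]) (use cpos_deriv cpos_deriv2 in auto)
    from has_lap_unique(2)[OF has_lap_cong[OF this S \<phi>_S] G' S that] show ?thesis by simp
  qed
  have LK: "L\<phi> x = 0" if "x \<notin> K" for x
    using has_lap_unique(2)[OF has_lap_cong[OF has_lap_const[of "- K" 0] openK \<phi>_K] G' openK, of x] that by simp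
  have \<phi>cont: "continuous_on \<Omega> \<phi>"
    using has_lapD[OF G'] has_derivative_continuous by (metis UNIV_I continuous_at_imp_continuous_on)
  have i1: "integrable M (\<lambda>x. u x * \<phi> x)"
    by (rule compact_support[OF \<phi>cont compK Ksub]) (use \<phi>_K in force)
  define \<psi> where "\<psi> x = \<phi> x / (norm x)\<^sup>2" for x
  have i2: "integrable M (\<lambda>x. u x * \<psi> x)"
  proof (rule compact_support[OF _ compK Ksub])
    show "continuous_on \<Omega> \<psi>"
      unfolding \<psi>_def using norm_pos by (intro continuous_intros \<phi>cont) auto
    show "\<psi> x = 0" if "x \<in> \<Omega> - K" for x using \<phi>_K[of x] that by (simp add: \<psi>_def)
  qed
  note wl = weak_laplacian[OF test G']
  have "0 \<le> integral\<^sup>L M (\<lambda>x. Du x \<bullet> grad \<phi> x) - c * integral\<^sup>L M (\<lambda>x. u x * \<psi> x)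
      + lam * integral\<^sup>L M (\<lambda>x. u x * \<phi> x)"
  proof -
    have "\<phi> x \<ge> 0" for x by (simp add: \<phi>_def cpos_simps)
    from supersol[OF test this] show ?thesis by (simp add: \<psi>_def)
  qed
  also have "\<dots> = integral\<^sup>L M (\<lambda>x. u x * (- L\<phi> x - c * \<psi> x + lam * \<phi> x))"
  proof -
    have "integral\<^sup>L M (\<lambda>x. u x * (- L\<phi> x - c * \<psi> x + lam * \<phi> x)) =
      integral\<^sup>L M (\<lambda>x. - (u x * L\<phi> x) - c * (u x * \<psi> x) + lam * (u x * \<phi> x))"
      by (rule arg_cong[where f = "integral\<^sup>L M"]) (auto simp: algebra_simps)
    also have "\<dots> = - integral\<^sup>L M (\<lambda>x. u x * L\<phi> x) - c * integral\<^sup>L M (\<lambda>x. u x * \<psi> x)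
      + lam * integral\<^sup>L M (\<lambda>x. u x * \<phi> x)"
      using i1 i2 wl(1) by simp
    finally show ?thesis using wl(2) by simp
  qed
  also have "\<dots> \<le> integral\<^sup>L M (\<lambda>x. u x * Z x)"
  proof (rule integral_mono[OF _ Zint])
    have "integrable M (\<lambda>x. - (u x * L\<phi> x) - c * (u x * \<psi> x) + lam * (u x * \<phi> x))"
      using i1 i2 wl(1) by simp
    then show "integrable M (\<lambda>x. u x * (- L\<phi> x - c * \<psi> x + lam * \<phi> x))"
      by (rule back_subst[of "integrable M"]) (auto simp: algebra_simps)
    fix x assume "x \<in> space M"
    then have x: "u x \<ge> 0" using u_nonneg by (simp add: space_M)
    have "- L\<phi> x - c * \<psi> x + lam * \<phi> x \<le> Z x"
    proof (cases "x \<in> S")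
      case True
      have "bump 3 (v x) * (norm (V x))\<^sup>2 \<ge> 0" using bump_nonneg by simp
      then show ?thesis using True by (simp add: LS Z_def comparison_def \<phi>_def \<psi>_def)
    next
      case False
      then have "x \<notin> K" using KS by auto
      then show ?thesis using \<phi>_K[of x] by (simp add: LK Z0 \<psi>_def)
    qed
    then show "u x * (- L\<phi> x - c * \<psi> x + lam * \<phi> x) \<le> u x * Z x"
      using x by (rule mult_left_mono)
  qed
  finally show "0 \<le> integral\<^sup>L M (\<lambda>x. u x * comparison S v L x)" by (simp add: Z_def)
qed


lemma AE_zero_if_nonpos:
  fixes f :: "'a \<Rightarrow> real"
  assumes "integrable M f" "\<And>x. x \<in> \<Omega> \<Longrightarrow> f x \<le> 0" "0 \<le> integral\<^sup>L M f"
  shows "AE x in M. f x = 0"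
proof -
  have "integral\<^sup>L M (\<lambda>x. - f x) = 0"
  proof (rule antisym)
    show "integral\<^sup>L M (\<lambda>x. - f x) \<ge> 0"
      using assms(2) by (intro integral_nonneg_AE AE_I2) (auto simp: space_M)
  qed (use assms in simp)
  then have "AE x in M. - f x = 0"
    using assms by (subst (asm) integral_nonneg_eq_0_iff_AE) (auto simp: space_M intro!: AE_I2)
  then show ?thesis by simp
qed

text \<open>Hopf's barrier \<open>exp (- \<alpha> \<bar>x - z\<bar>\<^sup>2)\<close> is a strict subsolution outside the smaller ball.\<close>

lemma zero_spreads:
  assumes zero: "\<And>y. y \<in> ball z s \<Longrightarrow> u y = 0" and s: "s > 0" and R: "cball z R \<subseteq> \<Omega>" and x: "x \<in> ball z R"
  shows "u x = 0"
proof (cases "x \<in> ball z s")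
  case True
  then show ?thesis by (rule zero)
next
  case False
  define n where "n = real DIM('a)"
  \<comment> \<open>Outside \<open>ball z s\<close> the term \<open>4 \<alpha>^2 r\<close> of the
    Laplacian then exceeds \<open>2 \<alpha> n + lam\<close> by at least one; the last summand gives
    \<open>\<alpha> \<ge> 1\<close>.\<close>
  define \<alpha> where "\<alpha> = (2 * n + lam + 1) / (4 * s\<^sup>2) + 1"
  have n: "n \<ge> 0" by (simp add: n_def)
  have \<alpha>1: "\<alpha> \<ge> 1" using n lam_nonneg by (simp add: \<alpha>_def)
  have \<alpha>: "4 * \<alpha>\<^sup>2 * s\<^sup>2 \<ge> 2 * \<alpha> * n + lam + 1"
  proof -
    have "4 * \<alpha> * s\<^sup>2 = 2 * n + lam + 1 + 4 * s\<^sup>2"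
      using s by (simp add: \<alpha>_def field_simps)
    then have "4 * \<alpha> * s\<^sup>2 \<ge> 2 * n + lam + 1" by simp
    then have "\<alpha> * (4 * \<alpha> * s\<^sup>2) \<ge> \<alpha> * (2 * n + lam + 1)"
      using \<alpha>1 by (intro mult_left_mono) auto
    moreover have "\<alpha> * (lam + 1) \<ge> 1 * (lam + 1)"
      using \<alpha>1 lam_nonneg by (intro mult_right_mono) auto
    ultimately show ?thesis by (simp add: power2_eq_square algebra_simps)
  qed
  define r where "r y = (1 *\<^sub>R y - z) \<bullet> (1 *\<^sub>R y - z)" for y
  have r_dist: "r y = (dist z y)\<^sup>2" for y
    by (subst dist_commute) (simp add: r_def dist_norm power2_norm_eq_inner)
  \<comment> \<open>Normalised so that \<open>v\<close> is \<open>1\<close> at the point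
    \<open>x\<close> and \<open>-1\<close> on the sphere of radius \<open>R\<close>; hence
    \<open>v \<ge> 0\<close> happens only inside the larger ball.\<close>
  define \<delta> where "\<delta> = (exp (- \<alpha> * r x) - exp (- \<alpha> * R\<^sup>2)) / 2"
  have "r x < R\<^sup>2"
    using x unfolding r_dist by (intro power_strict_mono) auto
  then have \<delta>: "\<delta> > 0" using \<alpha>1 by (simp add: \<delta>_def)
  define v where "v y = exp (- \<alpha> * r y) * (1 / \<delta>) - (exp (- \<alpha> * R\<^sup>2) / \<delta> + 1)" for y
  have smr: "smooth_on UNIV r"
  proof -
    have "r = (\<lambda>y. y \<bullet> y - 2 * (y \<bullet> z) + z \<bullet> z)"
      by (auto simp: r_def algebra_simps inner_commute)
    then show ?thesis
      by (simp add: smooth_on_add smooth_on_diff smooth_on_mult smooth_on_const smooth_on_norm2 smooth_on_inner_left)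
  qed
  have smv: "smooth_on UNIV v"
    unfolding v_def using smr
    by (intro smooth_on_diff smooth_on_mult smooth_on_exp smooth_on_const)
  define L where "L y = \<alpha>\<^sup>2 / \<delta> * exp (- \<alpha> * r y) * (norm (2 *\<^sub>R (1 *\<^sub>R y - z)))\<^sup>2 + - \<alpha> / \<delta> * exp (- \<alpha> * r y) * (2 * n)" for y
  have lapr: "has_lap UNIV r (\<lambda>y. 2 *\<^sub>R (1 *\<^sub>R y - z)) (\<lambda>_. 2 * n)"
    using has_lap_norm2_shift[of UNIV 1 z] by (simp add: r_def[abs_def] n_def)
  have lap: "has_lap UNIV v (\<lambda>y. (- \<alpha> / \<delta> * exp (- \<alpha> * r y)) *\<^sub>R (2 *\<^sub>R (1 *\<^sub>R y - z))) L"
    unfolding L_def v_def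
    by (rule has_lap_compose[OF lapr, where \<phi> = "\<lambda>t. exp (- \<alpha> * t) * (1 / \<delta>) - (exp (- \<alpha> * R\<^sup>2) / \<delta> + 1)"
          and ?\<phi>1.0 = "\<lambda>t. - \<alpha> / \<delta> * exp (- \<alpha> * t)" and ?\<phi>2.0 = "\<lambda>t. \<alpha>\<^sup>2 / \<delta> * exp (- \<alpha> * t)"])
       (use \<delta> in \<open>auto intro!: derivative_eq_intros simp: power2_eq_square\<close>)
  have contr: "continuous_on A r" for A
    unfolding r_def by (intro continuous_intros)
  have contv: "continuous_on UNIV v"
    unfolding v_def by (intro continuous_intros contr)
  have sub: "{y \<in> UNIV. v y \<ge> 0} \<subseteq> cball z R"
  proof
    fix y assume "y \<in> {y \<in> UNIV. v y \<ge> 0}"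
    then have "exp (- \<alpha> * r y) * (1 / \<delta>) > exp (- \<alpha> * R\<^sup>2) * (1 / \<delta>)" by (simp add: v_def)
    then have "exp (- \<alpha> * r y) > exp (- \<alpha> * R\<^sup>2)" using \<delta> by (simp add: divide_less_cancel)
    then have "(dist z y)\<^sup>2 < R\<^sup>2" using \<alpha>1 by (simp add: r_dist)
    moreover have "R > 0" using x by (metis ball_eq_empty empty_iff not_le_imp_less)
    ultimately show "y \<in> cball z R" by (simp add: power2_less_imp_less less_imp_le)
  qed
  have "closed {y \<in> UNIV. v y \<ge> 0}"
    using contv by (simp add: closed_Collect_le continuous_on_const)
  then have "compact {y \<in> UNIV. v y \<ge> 0}"
    using sub compact_Int_closed[of "cball z R" "{y \<in> UNIV. v y \<ge> 0}"] by (metis compact_cball inf.absorb_iff2)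
  moreover have "continuous_on UNIV L"
    unfolding L_def by (intro continuous_intros contr)
  ultimately have comp: "continuous_on \<Omega> (comparison UNIV v L)"
    "integrable M (\<lambda>x. u x * comparison UNIV v L x)"
    "0 \<le> integral\<^sup>L M (\<lambda>x. u x * comparison UNIV v L x)"
    using comparison_inequality[OF open_UNIV smv lap] sub R by auto
  have le: "comparison UNIV v L y \<le> - (dcpos (v y) * exp (- \<alpha> * r y) / \<delta>)" if "y \<notin> ball z s" for y
  proof -
    have "(dist z y)\<^sup>2 \<ge> s\<^sup>2" using that s by (intro power_mono) auto
    then have "4 * \<alpha>\<^sup>2 * r y \<ge> 4 * \<alpha>\<^sup>2 * s\<^sup>2" by (simp add: r_dist mult_left_mono)
    then have ineq: "lam - (4 * \<alpha>\<^sup>2 * r y - 2 * \<alpha> * n) \<le> - 1" using \<alpha> by linarith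
    have Leq: "L y = exp (- \<alpha> * r y) / \<delta> * (4 * \<alpha>\<^sup>2 * r y - 2 * \<alpha> * n)"
    proof -
      have "(norm (2 *\<^sub>R (1 *\<^sub>R y - z)))\<^sup>2 = 4 * r y"
        by (simp add: r_def power_mult_distrib power2_norm_eq_inner)
      then show ?thesis
        unfolding L_def by (simp add: algebra_simps)
    qed
    \<comment> \<open>Convexity gives \<open>cpos s \<le> s cpos' (s)\<close>, which turns the term
      with \<open>lam\<close> into a multiple of \<open>cpos'\<close> comparable with the Laplacian
      term.\<close>
    have "cpos (v y) \<le> dcpos (v y) * (exp (- \<alpha> * r y) / \<delta>)"
    proof (cases "v y > 0")
      case True
      have "cpos (v y) \<le> dcpos (v y) * v y"
        using True bump_nonneg[of 1 "v y"] by (simp add: cpos_def algebra_simps)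
      also have "\<dots> \<le> dcpos (v y) * (exp (- \<alpha> * r y) / \<delta>)"
      proof (rule mult_left_mono)
        have "exp (- \<alpha> * R\<^sup>2) / \<delta> \<ge> 0" using \<delta> by simp
        then show "v y \<le> exp (- \<alpha> * r y) / \<delta>" by (simp add: v_def)
      qed (rule cpos_deriv_bounds)
      finally show ?thesis .
    qed (simp add: cpos_def bump_def)
    then have *: "lam * cpos (v y) \<le> lam * (dcpos (v y) * (exp (- \<alpha> * r y) / \<delta>))"
      by (rule mult_left_mono[OF _ lam_nonneg])
    have "c * (cpos (v y) / (norm y)\<^sup>2) \<ge> 0"
      using c_nonneg cpos_simps by simp
    have "comparison UNIV v L y \<le> dcpos (v y) * (exp (- \<alpha> * r y) / \<delta>) * (lam - (4 * \<alpha>\<^sup>2 * r y - 2 * \<alpha> * n))"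
    proof -
      have "- (d * (e * q)) + lam * (d * e) = d * e * (lam - q)" for d e q :: real
        by (simp add: algebra_simps)
      from this[of "dcpos (v y)" "exp (- \<alpha> * r y) / \<delta>" "4 * \<alpha>\<^sup>2 * r y - 2 * \<alpha> * n"] * \<open>c * (cpos (v y) / (norm y)\<^sup>2) \<ge> 0\<close>
      show ?thesis unfolding comparison_def Leq if_P[OF UNIV_I] by linarith
    qed
    also have "\<dots> \<le> dcpos (v y) * (exp (- \<alpha> * r y) / \<delta>) * (- 1)"
      using cpos_deriv_bounds(1)[of "v y"] \<delta> by (intro mult_left_mono ineq mult_nonneg_nonneg) auto
    finally show ?thesis by simp
  qed
  \<comment> \<open>In the small ball \<open>u\<close> vanishes, outside it
    \<open>comparison\<close> is nonpositive. A nonpositive integrand with nonnegative integral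
    vanishes almost everywhere, while \<open>comparison\<close> is strictly negative at
    \<open>x\<close>.\<close>
  have "AE y in M. u y * comparison UNIV v L y = 0"
  proof (rule AE_zero_if_nonpos[OF comp(2) _ comp(3)])
    fix y assume y: "y \<in> \<Omega>"
    show "u y * comparison UNIV v L y \<le> 0"
    proof (cases "y \<in> ball z s")
      case False
      have "0 \<le> dcpos (v y) * exp (- \<alpha> * r y) / \<delta>"
        using cpos_deriv_bounds(1)[of "v y"] \<delta> by simp
      then have "comparison UNIV v L y \<le> 0" using le[OF False] by simp
      then show ?thesis using u_nonneg[OF y] by (simp add: mult_nonneg_nonpos)
    qed (simp add: zero)
  qed
  then have "AE y in M. y \<in> \<Omega> \<longrightarrow> u y * comparison UNIV v L y = 0" by (rule eventually_mono) simp
  moreover have "x \<in> \<Omega>" using x R ball_subset_cball by blast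
  ultimately have "u x * comparison UNIV v L x = 0"
    by (rule AE_zero_imp_zero[OF open_dom order_refl continuous_on_mult[OF u_cont comp(1)]])
  moreover have "comparison UNIV v L x < 0"
  proof -
    have "exp (- \<alpha> * r x) = 2 * \<delta> + exp (- \<alpha> * R\<^sup>2)" 
    proof -
      have "a = 2 * ((a - b) / 2) + b" for a b :: real by (simp add: field_simps)
      then show ?thesis unfolding \<delta>_def .
    qed
    then have "v x = (2 * \<delta> + exp (- \<alpha> * R\<^sup>2)) * (1 / \<delta>) - (exp (- \<alpha> * R\<^sup>2) / \<delta> + 1)"
      by (simp only: v_def)
    then have "v x = 1" using \<delta> by (simp add: field_simps)
    then have "0 < dcpos (v x) * exp (- \<alpha> * r x) / \<delta>"
      using \<delta> by (simp add: bump_def)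
    then show ?thesis using le[OF False] by simp
  qed
  ultimately show ?thesis by simp
qed

text \<open>The interior of the zero set is relatively closed: near a limit point \<open>y\<close>
  choose a centre \<open>z\<close> in it at distance below \<open>e / 3\<close>. The ball of radius
  \<open>e / 2\<close> around \<open>z\<close> contains \<open>y\<close> and stays within
  \<open>cball y e\<close>, so \<open>zero_spreads\<close> reaches \<open>y\<close>.\<close>

lemma zero_on_domain:
  assumes "connected \<Omega>" "open U" "U \<subseteq> \<Omega>" "U \<noteq> {}" "\<And>x. x \<in> U \<Longrightarrow> u x = 0" "x \<in> \<Omega>"
  shows "u x = 0"
proof -
  define Z where "Z = interior {x \<in> \<Omega>. u x = 0}"
  have Z: "y \<in> Z" if y_in: "y \<in> \<Omega>" and y_cl: "y \<in> closure Z" for y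
  proof -
    obtain e where e: "e > 0" "cball y e \<subseteq> \<Omega>"
      using open_contains_cball_eq[OF open_dom, rule_format, THEN iffD1, OF y_in] by auto
    obtain z where z: "z \<in> Z" "dist z y < e / 3"
      using closure_approachable[THEN iffD1, OF y_cl, rule_format, of "e / 3"] e(1) by auto
    obtain s where s: "s > 0" "ball z s \<subseteq> {x \<in> \<Omega>. u x = 0}"
      using z(1) unfolding Z_def mem_interior by auto
    have sub: "cball z (e / 2) \<subseteq> \<Omega>"
    proof -
      have "cball z (e / 2) \<subseteq> cball y e"
        using z(2) e(1) by (intro cball_subset_cball_iff[THEN iffD2]) auto
      then show ?thesis using e by auto
    qed
    have "u w = 0" if "w \<in> ball z (e / 2)" for w
      using s by (intro zero_spreads[OF _ s(1) sub that]) auto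
    then have "ball z (e / 2) \<subseteq> {x \<in> \<Omega>. u x = 0}"
      using sub ball_subset_cball by blast
    then have "ball z (e / 2) \<subseteq> Z" unfolding Z_def by (simp add: interior_maximal)
    then show "y \<in> Z" using z(2) e(1) by auto
  qed
  have "U \<subseteq> Z" unfolding Z_def using assms by (intro interior_maximal) auto
  have Zsub: "Z \<subseteq> {x \<in> \<Omega>. u x = 0}" unfolding Z_def by (rule interior_subset)
  have "Z \<inter> \<Omega> = {} \<or> - closure Z \<inter> \<Omega> = {}"
  proof (rule connectedD[OF assms(1)])
    show "Z \<inter> - closure Z \<inter> \<Omega> = {}" using closure_subset by auto
    show "\<Omega> \<subseteq> Z \<union> - closure Z" using Z by auto
  qed (auto simp: Z_def)
  then show ?thesis using Z Zsub \<open>U \<subseteq> Z\<close> assms(3,4,6) by blast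
qed

end

section \<open>The boundary near the origin\<close>

text \<open>Continuity is given only for \<open>H x v\<close> with \<open>v\<close> fixed, so the
  operator norm on the unit ball is bounded through the basis vectors. This makes \<open>G\<close>
  Lipschitz at the origin, and the mean value inequality for \<open>g\<close> minus its linear part
  on the ball of radius \<open>norm y\<close> yields the quadratic remainder.\<close>

lemma C2_fun_Taylor:
  fixes g :: "'a::euclidean_space \<Rightarrow> real"
  assumes "C2_fun g"
  obtains G0 C where "C \<ge> 0" "\<And>y. norm y \<le> 1 \<Longrightarrow> \<bar>g y - g 0 - G0 \<bullet> y\<bar> \<le> C * (norm y)\<^sup>2"
proof -
  obtain G H where G: "\<And>x. (g has_derivative (\<lambda>h. G x \<bullet> h)) (at x)"
    and H: "\<And>x. (G has_derivative H x) (at x)" and Hc: "\<And>v. continuous_on UNIV (\<lambda>x. H x v)"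
    using assms unfolding C2_fun_def by blast
  have "\<exists>B. \<forall>x\<in>cball 0 1. norm (H x v) \<le> B" for v
  proof -
    have "compact ((\<lambda>x. H x v) ` cball 0 1)"
      by (intro compact_continuous_image continuous_on_subset[OF Hc]) auto
    then show ?thesis using compact_imp_bounded bounded_iff by (metis imageI)
  qed
  then obtain B where B: "\<And>v x. x \<in> cball 0 1 \<Longrightarrow> norm (H x v) \<le> B v" by metis
  define C where "C = (\<Sum>b\<in>Basis. \<bar>B b\<bar>)"
  have C0: "C \<ge> 0" unfolding C_def by (intro sum_nonneg) auto
  have HC: "norm (H x v) \<le> C * norm v" if "x \<in> cball 0 1" for x v
  proof -
    have lin: "linear (H x)" using H has_derivative_linear by blast
    have "H x v = H x (\<Sum>b\<in>Basis. (v \<bullet> b) *\<^sub>R b)" by (simp add: euclidean_representation)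
    also have "\<dots> = (\<Sum>b\<in>Basis. (v \<bullet> b) *\<^sub>R H x b)"
      by (simp add: linear_sum[OF lin] linear_scale[OF lin])
    also have "norm \<dots> \<le> (\<Sum>b\<in>Basis. norm v * \<bar>B b\<bar>)"
    proof (rule order_trans[OF norm_sum], rule sum_mono)
      fix b :: 'a assume "b \<in> Basis"
      then have "\<bar>v \<bullet> b\<bar> \<le> norm v" by (rule Basis_le_norm)
      moreover have "norm (H x b) \<le> \<bar>B b\<bar>" using B[OF that, of b] by simp
      ultimately show "norm ((v \<bullet> b) *\<^sub>R H x b) \<le> norm v * \<bar>B b\<bar>"
        by (simp add: mult_mono)
    qed
    also have "\<dots> = C * norm v" by (simp add: C_def sum_distrib_left mult.commute)
    finally show ?thesis .
  qed
  have GC: "norm (G x - G 0) \<le> C * norm x" if "x \<in> cball 0 1" for x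
  proof -
    have "norm (G x - G 0) \<le> C * norm (x - 0)"
      by (rule differentiable_bound[of "cball 0 1" G H])
         (use that H HC in \<open>auto intro: has_derivative_at_withinI onorm_le\<close>)
    then show ?thesis by simp
  qed
  have "\<bar>g y - g 0 - G 0 \<bullet> y\<bar> \<le> C * (norm y)\<^sup>2" if y: "norm y \<le> 1" for y
  proof -
    have "norm ((g y - G 0 \<bullet> y) - (g 0 - G 0 \<bullet> 0)) \<le> (C * norm y) * norm (y - 0)"
    proof (rule differentiable_bound[of "cball 0 (norm y)" "\<lambda>y. g y - G 0 \<bullet> y" "\<lambda>x h. G x \<bullet> h - G 0 \<bullet> h"])
      fix x :: 'a assume x: "x \<in> cball 0 (norm y)"
      show "((\<lambda>y. g y - G 0 \<bullet> y) has_derivative (\<lambda>h. G x \<bullet> h - G 0 \<bullet> h)) (at x within cball 0 (norm y))"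
        by (intro has_derivative_diff has_derivative_at_withinI[OF G] has_derivative_inner_right has_derivative_ident)
      show "onorm (\<lambda>h. G x \<bullet> h - G 0 \<bullet> h) \<le> C * norm y"
      proof (rule onorm_le)
        fix h
        have "norm (G x \<bullet> h - G 0 \<bullet> h) \<le> norm (G x - G 0) * norm h"
          using Cauchy_Schwarz_ineq2[of "G x - G 0" h] by (simp add: inner_diff_left)
        also have "\<dots> \<le> (C * norm y) * norm h"
          using GC[of x] x y C0 by (intro mult_right_mono order_trans[OF GC] mult_left_mono) auto
        finally show "norm (G x \<bullet> h - G 0 \<bullet> h) \<le> C * norm y * norm h" .
      qed
    qed auto
    then show ?thesis by (simp add: power2_eq_square algebra_simps)
  qed
  then show ?thesis using that[OF C0] by blast
qed

text \<open>The Taylor remainder traps the boundary between two spheres tangent at the origin. The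
  interior ball carries the barrier; the exterior condition controls the negative part of
  \<open>x \<bullet> e\<close> in the moment estimate.\<close>

lemma C2_boundary_tangent_balls:
  fixes \<Omega> :: "'a::euclidean_space set"
  assumes \<Omega>: "open \<Omega>" "0 \<in> frontier \<Omega>" and C2: "C2_boundary_near \<Omega> 0"
  obtains e c C where "norm e = 1" "c > 0" "\<And>x. x \<bullet> e > c * (x \<bullet> x) \<Longrightarrow> x \<in> \<Omega>"
    "C \<ge> 0" "\<And>x. x \<in> \<Omega> \<Longrightarrow> x \<bullet> e \<ge> - C * (x \<bullet> x)"
proof -
  obtain r e0 g where r: "r > 0" and e0: "norm e0 = 1"
    and loc: "\<Omega> \<inter> ball 0 r = {x \<in> ball 0 r. x \<bullet> e0 > g (x - (x \<bullet> e0) *\<^sub>R e0)}" and g: "C2_fun g"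
    using C2 unfolding C2_boundary_near_def local_graph_def by blast
  have e01: "e0 \<bullet> e0 = 1" using e0 by (simp add: norm_eq_1)
  define P where "P x = x - (x \<bullet> e0) *\<^sub>R e0" for x
  have in_iff: "x \<in> \<Omega> \<longleftrightarrow> x \<bullet> e0 > g (P x)" if "norm x < r" for x
  proof -
    have "x \<in> ball 0 r" using that by simp
    then show ?thesis using loc unfolding P_def by blast
  qed
  obtain K B where K: "K \<ge> 0" "\<And>y. norm y \<le> 1 \<Longrightarrow> \<bar>g y - g 0 - B \<bullet> y\<bar> \<le> K * (norm y)\<^sup>2"
    using C2_fun_Taylor[OF g] by metis
  have zero_notin: "0 \<notin> \<Omega>" using \<Omega> by (simp add: frontier_def interior_open)
  have contg: "continuous_on UNIV g"
    using g unfolding C2_fun_def by (meson continuous_at_imp_continuous_on has_derivative_continuous)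
  have "g 0 \<ge> 0" using in_iff[of 0] zero_notin r by (simp add: P_def)
  moreover have "g 0 \<le> 0"
  proof (rule ccontr)
    assume neg: "\<not> g 0 \<le> 0"
    have "open {x. x \<bullet> e0 < g (P x)}"
      unfolding P_def by (intro open_Collect_less continuous_intros continuous_on_compose2[OF contg]) auto
    then have "open ({x. x \<bullet> e0 < g (P x)} \<inter> ball 0 r)" by (intro open_Int open_ball)
    moreover have "0 \<in> {x. x \<bullet> e0 < g (P x)} \<inter> ball 0 r" using neg r by (simp add: P_def)
    moreover have "0 \<in> closure \<Omega>" using \<Omega> by (simp add: frontier_def)
    ultimately have "({x. x \<bullet> e0 < g (P x)} \<inter> ball 0 r) \<inter> \<Omega> \<noteq> {}"
      using open_Int_closure_eq_empty by blast
    then obtain x where "x \<bullet> e0 < g (P x)" "norm x < r" "x \<in> \<Omega>" by auto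
    then show False using in_iff[of x] by simp
  qed
  ultimately have g0: "g 0 = 0" by simp
  \<comment> \<open>The gradient at the origin of \<open>x \<bullet> e0 - g (P x)\<close>, an inward
    normal. Its component along \<open>e0\<close> is one, so its length is at least one and
    normalising it does not spoil the inequalities.\<close>
  define n where "n = e0 - P B"
  have ne0: "n \<bullet> e0 = 1"
    by (simp add: n_def P_def inner_diff_left e01)
  have n1: "norm n \<ge> 1"
    using Cauchy_Schwarz_ineq2[of n e0] ne0 e0 by simp
  have Pnorm: "norm (P x) \<le> norm x" for x
  proof -
    have "(norm (P x))\<^sup>2 = (norm x)\<^sup>2 - (x \<bullet> e0)\<^sup>2"
      unfolding power2_norm_eq_inner by (simp add: P_def e01 algebra_simps inner_commute power2_eq_square)
    then have "(norm (P x))\<^sup>2 \<le> (norm x)\<^sup>2" by simp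
    then show ?thesis by (rule power2_le_imp_le) simp
  qed
  have expand: "\<bar>(x \<bullet> e0 - g (P x)) - x \<bullet> n\<bar> \<le> K * (x \<bullet> x)" if "norm x \<le> 1" for x
  proof -
    have "x \<bullet> n = x \<bullet> e0 - B \<bullet> P x"
      by (simp add: n_def P_def algebra_simps inner_commute)
    then have "\<bar>(x \<bullet> e0 - g (P x)) - x \<bullet> n\<bar> \<le> K * (norm (P x))\<^sup>2"
      using K(2)[of "P x"] Pnorm[of x] that g0 by (simp add: abs_minus_commute)
    also have "\<dots> \<le> K * (norm x)\<^sup>2"
      by (intro mult_left_mono power_mono Pnorm K) auto
    finally show ?thesis by (simp add: power2_norm_eq_inner)
  qed
  define m where "m = min r 1"
  have m: "m > 0" "m \<le> r" "m \<le> 1" using r by (auto simp: m_def)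
  define e where "e = n /\<^sub>R norm n"
  \<comment> \<open>\<open>K\<close> dominates the Taylor remainder. The summand
    \<open>1 / m\<close> keeps the interior ball inside the range of the graph, and makes the
    exterior inequality trivial for \<open>norm x \<ge> m\<close>.\<close>
  define c where "c = K + 1 + 1 / m"
  have e: "norm e = 1" 
  proof -
    have "n \<noteq> 0" using n1 by auto
    then show ?thesis by (simp add: e_def)
  qed
  have xn: "x \<bullet> n = norm n * (x \<bullet> e)" for x 
  proof -
    have "norm n \<noteq> 0" using n1 by linarith
    then have "norm n * inverse (norm n) = 1" by (rule right_inverse)
    then show ?thesis unfolding e_def inner_scaleR_right mult.assoc[symmetric] by (simp only: mult_1)
  qed
  have c: "c > 0" "c \<ge> K" "c > 1 / m" using K m by (auto simp: c_def intro: add_nonneg_pos)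
  have inside: "x \<in> \<Omega>" if x: "x \<bullet> e > c * (x \<bullet> x)" for x
  proof -
    have x0: "x \<noteq> 0" using x by auto
    have "c * (norm x)\<^sup>2 < norm x"
      using x Cauchy_Schwarz_ineq2[of x e] e by (simp add: power2_norm_eq_inner)
    then have "c * norm x < 1" using x0 by (simp add: power2_eq_square)
    moreover have "norm x / m < c * norm x"
      using c(3) x0 mult_strict_right_mono[of "1 / m" c "norm x"] by simp
    ultimately have "norm x / m < 1" by linarith
    then have nx: "norm x < m" using m(1) by simp
    have "c * (x \<bullet> x) \<ge> 0" using c by simp
    then have "1 * (x \<bullet> e) \<le> norm n * (x \<bullet> e)" using n1 x by (intro mult_right_mono) auto
    moreover have "K * (x \<bullet> x) \<le> c * (x \<bullet> x)" using c by (intro mult_right_mono) auto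
    ultimately have "x \<bullet> n > K * (x \<bullet> x)" unfolding xn using x by linarith
    then have "x \<bullet> e0 > g (P x)" using expand[of x] nx m by (auto simp: abs_le_iff)
    then show ?thesis using in_iff[of x] nx m by simp
  qed
  have outside: "x \<bullet> e \<ge> - c * (x \<bullet> x)" if x: "x \<in> \<Omega>" for x
  proof (cases "norm x < m")
    case True
    then have "x \<bullet> e0 > g (P x)" using in_iff[of x] x m by simp
    then have *: "norm n * (x \<bullet> e) \<ge> - (K * (x \<bullet> x))"
      using expand[of x] True m unfolding xn by (auto simp: abs_le_iff)
    have "K * (x \<bullet> x) \<le> c * (x \<bullet> x)" using c by (intro mult_right_mono) auto
    moreover have "x \<bullet> e \<ge> - (K * (x \<bullet> x))"
    proof (cases "x \<bullet> e \<ge> 0")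
      case True
      moreover have "K * (x \<bullet> x) \<ge> 0" using K by simp
      ultimately show ?thesis by linarith
    next
      case False
      then have "norm n * (x \<bullet> e) \<le> 1 * (x \<bullet> e)" using n1 by (intro mult_right_mono_neg) auto
      then show ?thesis using * by simp
    qed
    ultimately show ?thesis by simp
  next
    case False
    then have "1 \<le> c * norm x"
      using c m mult_mono[of "1 / m" c m "norm x"] by simp
    then have "norm x * 1 \<le> norm x * (c * norm x)" by (intro mult_left_mono) auto
    then have "norm x \<le> c * (x \<bullet> x)" by (simp add: power2_norm_eq_inner[symmetric] power2_eq_square mult_ac)
    moreover have "\<bar>x \<bullet> e\<bar> \<le> norm x" using Cauchy_Schwarz_ineq2[of x e] e by simp
    ultimately show ?thesis by simp
  qed
  show ?thesis using that[OF e c(1) inside _ outside] c by auto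
qed

text \<open>Summing over the shells \<open>R e\<^sup>-\<^sup>j\<^sup>-\<^sup>1 \<le> \<bar>x\<bar> < R e\<^sup>-\<^sup>j\<close>, each of which contributes a bounded amount.\<close>

lemma shell_bound:
  fixes x :: "'a::euclidean_space"
  assumes R: "norm x < R" "R > 0" and \<eta>: "\<eta> = R * exp (- real J)"
  shows "exp (- (real DIM('a) / 2) * ln (x \<bullet> x + \<eta>\<^sup>2))
      \<le> (\<Sum>j\<le>J. (R * exp (- real j - 1)) powr (- real DIM('a)) * indicator (ball 0 (R * exp (- real j))) x)"
proof -
  define n where "n = real DIM('a)"
  define t where "t = sqrt (x \<bullet> x + \<eta>\<^sup>2)"
  have \<eta>0: "\<eta> > 0" using R \<eta> by simp
  have t0: "t > 0" using \<eta>0 by (simp add: t_def add_nonneg_pos)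
  have t2: "x \<bullet> x + \<eta>\<^sup>2 = t\<^sup>2" by (simp add: t_def)
  have tx: "t \<ge> norm x" "t \<ge> \<eta>"
    using \<eta>0 by (auto simp: t_def norm_eq_sqrt_inner intro: real_le_rsqrt)
  have lhs: "exp (- (n / 2) * ln (x \<bullet> x + \<eta>\<^sup>2)) = t powr (- n)"
    unfolding t2 using t0 by (simp add: powr_def ln_realpow)
  have terms: "0 \<le> (R * exp (- real j - 1)) powr (- n) * indicator (ball 0 (R * exp (- real j))) x" for j
    by simp
  have pick: "t powr (- n) \<le> (\<Sum>j\<le>J. (R * exp (- real j - 1)) powr (- n) * indicator (ball 0 (R * exp (- real j))) x)"
    if "j \<le> J" "norm x < R * exp (- real j)" "t \<ge> R * exp (- real j - 1)" for j
  proof -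
    have "t powr (- n) \<le> (R * exp (- real j - 1)) powr (- n)"
      using that R by (intro powr_mono2') (auto simp: n_def)
    also have "\<dots> = (R * exp (- real j - 1)) powr (- n) * indicator (ball 0 (R * exp (- real j))) x"
      using that by simp
    also have "\<dots> \<le> (\<Sum>j\<le>J. (R * exp (- real j - 1)) powr (- n) * indicator (ball 0 (R * exp (- real j))) x)"
      using that terms by (intro member_le_sum) auto
    finally show ?thesis .
  qed
  show ?thesis
  proof (cases "norm x < R * exp (- real J)")
    \<comment> \<open>Below the smallest scale the regularisation still gives
      \<open>t \<ge> \<eta>\<close>, so the last summand suffices.\<close>
    case True
    have "R * exp (- real J - 1) \<le> \<eta>" using R by (simp add: \<eta>)
    then show ?thesis using pick[of J] True tx lhs by (simp add: n_def)
  next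
    case False
    define Q where "Q j \<longleftrightarrow> \<not> norm x < R * exp (- real j)" for j
    have QJ: "Q J" using False by (simp add: Q_def)
    \<comment> \<open>The least index whose radius does not exceed \<open>norm x\<close>. It is not
      zero because \<open>norm x < R\<close>, and its predecessor indexes the shell containing
      \<open>x\<close>.\<close>
    define j where "j = (LEAST j. Q j)"
    have j: "\<not> norm x < R * exp (- real j)" using LeastI[of Q, OF QJ] by (simp add: Q_def j_def)
    have "j \<noteq> 0" using j R by (intro notI) simp
    then obtain i where i: "j = Suc i" by (cases j) auto
    have "norm x < R * exp (- real i)"
      using not_less_Least[of i Q] i by (auto simp: j_def Q_def)
    moreover have "j \<le> J" unfolding j_def by (rule Least_le[of Q, OF QJ])
    moreover have "t \<ge> R * exp (- real i - 1)"
    proof -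
      have "- real j = - real i - 1" using i by simp
      then have "R * exp (- real i - 1) = R * exp (- real j)" by simp
      then show ?thesis using j tx by linarith
    qed
    ultimately show ?thesis using pick[of i] i lhs by (simp add: n_def)
  qed
qed

section \<open>Logarithmic growth of the moment along the normal\<close>

context supersolution
begin

text \<open>The weight is a regularised \<open>|x|^(-n)\<close>, the borderline power. In each shell
  the height \<open>(R exp (- j - 1))^(-n)\<close> times a volume of at most
  \<open>|B_1| (R exp (- j))^n\<close> is at most \<open>|B_1| exp n\<close>, whatever
  \<open>j\<close> is, and there are \<open>J + 1\<close> shells.\<close>

lemma critical_weight_integral:
  assumes R: "\<Omega> \<subseteq> ball 0 R" "R > 0"
  shows "\<exists>C\<ge>0. \<forall>J \<eta>. \<eta> = R * exp (- real J) \<longrightarrow>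
      integral\<^sup>L M (\<lambda>x. exp (- (real DIM('a) / 2) * ln (x \<bullet> x + \<eta>\<^sup>2))) \<le> C * (real J + 1)"
proof -
  define n where "n = real DIM('a)"
  define C where "C = measure lebesgue (ball (0::'a) 1) * exp n"
  have "integral\<^sup>L M (\<lambda>x. exp (- (n / 2) * ln (x \<bullet> x + \<eta>\<^sup>2))) \<le> C * (real J + 1)"
    if \<eta>: "\<eta> = R * exp (- real J)" for J \<eta>
  proof -
    have \<eta>0: "\<eta> > 0" using R \<eta> by simp
    have pos: "x \<bullet> x + \<eta>\<^sup>2 > 0" for x :: 'a using \<eta>0 by (simp add: add_nonneg_pos)
    let ?S = "\<lambda>x. \<Sum>j\<le>J. (R * exp (- real j - 1)) powr (- n) * indicat_real (ball 0 (R * exp (- real j))) x"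
    have ind: "integrable M (indicat_real (ball 0 \<rho>))" for \<rho> :: real
    proof (rule bounded_integrable[of _ 1])
      show "indicat_real (ball 0 \<rho>) \<in> borel_measurable M"
        by (intro measurable_restrict_space1 borel_measurable_indicator) simp
    qed (auto simp: indicator_def)
    have meas_le: "integral\<^sup>L M (indicat_real (ball 0 \<rho>)) \<le> measure lebesgue (ball (0::'a) 1) * \<rho> powr n"
      if "\<rho> > 0" for \<rho>
    proof -
      have "integral\<^sup>L M (indicat_real (ball 0 \<rho>)) = measure M (ball 0 \<rho> \<inter> \<Omega>)"
        by (simp add: space_M)
      also have "\<dots> = measure lebesgue (ball 0 \<rho> \<inter> \<Omega>)"
        using sets_dom by (intro measure_restrict_space) auto
      also have "\<dots> \<le> measure lebesgue (ball (0::'a) \<rho>)"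
        using sets_dom by (intro measure_mono_fmeasurable) auto
      also have "\<dots> = \<rho> powr n * measure lebesgue (ball (0::'a) 1)"
        using content_ball_conv_unit_ball[of \<rho> "0::'a"] that by (simp add: n_def powr_realpow measure_completion)
      finally show ?thesis by (simp add: mult.commute)
    qed
    have shell: "(R * exp (- real j - 1)) powr (- n) * integral\<^sup>L M (indicat_real (ball 0 (R * exp (- real j)))) \<le> C" for j
    proof -
      have "(R * exp (- real j - 1)) powr (- n) * integral\<^sup>L M (indicat_real (ball 0 (R * exp (- real j))))
          \<le> (R * exp (- real j - 1)) powr (- n) * (measure lebesgue (ball (0::'a) 1) * (R * exp (- real j)) powr n)"
        using R by (intro mult_left_mono meas_le) auto
      also have "\<dots> = measure lebesgue (ball (0::'a) 1) * ((R * exp (- real j - 1)) powr (- n) * (R * exp (- real j)) powr n)"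
        by (simp add: mult_ac)
      also have "(R * exp (- real j - 1)) powr (- n) * (R * exp (- real j)) powr n = exp n"
        using R by (simp add: powr_def ln_mult algebra_simps flip: exp_add)
      finally show ?thesis by (simp add: C_def)
    qed
    have "integral\<^sup>L M (\<lambda>x. exp (- (n / 2) * ln (x \<bullet> x + \<eta>\<^sup>2))) \<le> integral\<^sup>L M ?S"
    proof (rule integral_mono')
      show "integrable M ?S"
        by (intro Bochner_Integration.integrable_sum integrable_mult_right ind)
      fix x assume "x \<in> space M"
      then have "norm x < R" using R by (auto simp: space_M)
      then show "exp (- (n / 2) * ln (x \<bullet> x + \<eta>\<^sup>2)) \<le> ?S x"
        unfolding n_def by (rule shell_bound[OF _ R(2) \<eta>])
      show "0 \<le> ?S x" by (intro sum_nonneg) auto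
    qed
    also have "\<dots> = (\<Sum>j\<le>J. (R * exp (- real j - 1)) powr (- n) * integral\<^sup>L M (indicat_real (ball 0 (R * exp (- real j)))))"
      by (subst Bochner_Integration.integral_sum)
         (simp_all only: integrable_mult_right ind integral_mult_right_zero)
    also have "\<dots> \<le> (\<Sum>j\<le>J. C)"
      by (intro sum_mono shell)
    also have "\<dots> = C * (real J + 1)" by (simp add: algebra_simps)
    finally show ?thesis .
  qed
  moreover have "C \<ge> 0" by (simp add: C_def)
  ultimately show ?thesis unfolding n_def by blast
qed

text \<open>The field \<open>(\<bar>x\<bar>\<^sup>2 + \<eta>\<^sup>2)\<^sup>-\<^sup>n\<^sup>/\<^sup>4 e\<close> has divergence \<open>- (n/2) (x \<bullet> e) (\<bar>x\<bar>\<^sup>2 + \<eta>\<^sup>2)\<^sup>-\<^sup>n\<^sup>/\<^sup>4\<^sup>-\<^sup>1\<close>, and its \<open>L\<^sup>2\<close> norm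
  grows like the square root of \<open>ln (1/\<eta>)\<close>. This takes the place of a Hardy inequality for \<open>u\<close>.\<close>

lemma normal_moment_bound:
  assumes R: "\<Omega> \<subseteq> ball 0 R" "R > 0"
    and e: "norm e = 1" and C: "C \<ge> 0" "\<And>x. x \<in> \<Omega> \<Longrightarrow> x \<bullet> e \<ge> - C * (x \<bullet> x)"
  obtains K where "\<And>J \<eta>. \<eta> = R * exp (- real J) \<Longrightarrow>
      integrable M (\<lambda>x. u x * (max (x \<bullet> e) 0 * exp (- (real DIM('a) / 4) * ln (x \<bullet> x + \<eta>\<^sup>2)) / (x \<bullet> x + \<eta>\<^sup>2)))"
    "\<And>J \<eta>. \<eta> = R * exp (- real J) \<Longrightarrow>
      integral\<^sup>L M (\<lambda>x. u x * (max (x \<bullet> e) 0 * exp (- (real DIM('a) / 4) * ln (x \<bullet> x + \<eta>\<^sup>2)) / (x \<bullet> x + \<eta>\<^sup>2)))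
        \<le> K * sqrt (real J + 1)"
proof -
  define n where "n = real DIM('a)"
  have n: "n > 0" by (simp add: n_def)
  obtain C1 where C1: "C1 \<ge> 0" "\<And>J \<eta>. \<eta> = R * exp (- real J) \<Longrightarrow>
      integral\<^sup>L M (\<lambda>x. exp (- (n / 2) * ln (x \<bullet> x + \<eta>\<^sup>2))) \<le> C1 * (real J + 1)"
    using critical_weight_integral[OF R, folded n_def] by blast
  define D where "D = integral\<^sup>L M (\<lambda>x. (Du x \<bullet> e)\<^sup>2)"
  define U where "U = integral\<^sup>L M (\<lambda>x. (u x)\<^sup>2)"
  have DU: "D \<ge> 0" "U \<ge> 0" unfolding D_def U_def by (intro integral_nonneg_AE AE_I2 zero_le_power2)+
  \<comment> \<open>The first summand bounds the integral of \<open>u (x \<bullet> e) k\<close>,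
    where \<open>2 / n\<close> inverts the factor in the divergence; the second pays for passing to
    the positive part of \<open>x \<bullet> e\<close>.\<close>
  define K where "K = (2 / n) * sqrt (D * C1) + C * sqrt (U * C1)"
  have "integrable M (\<lambda>x. u x * (max (x \<bullet> e) 0 * exp (- (n / 4) * ln (x \<bullet> x + \<eta>\<^sup>2)) / (x \<bullet> x + \<eta>\<^sup>2))) \<and>
    integral\<^sup>L M (\<lambda>x. u x * (max (x \<bullet> e) 0 * exp (- (n / 4) * ln (x \<bullet> x + \<eta>\<^sup>2)) / (x \<bullet> x + \<eta>\<^sup>2))) \<le> K * sqrt (real J + 1)"
    if \<eta>: "\<eta> = R * exp (- real J)" for J \<eta>
  proof -
    have \<eta>0: "\<eta> > 0" using R \<eta> by simp
    have pos: "x \<bullet> x + \<eta>\<^sup>2 > 0" for x :: 'a using \<eta>0 by (simp add: add_nonneg_pos)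
    have nz: "x \<bullet> x + \<eta>\<^sup>2 \<noteq> 0" for x :: 'a using pos[of x] by simp
    define h where "h x = exp (- (n / 4) * ln (x \<bullet> x + \<eta>\<^sup>2))" for x :: 'a
    define k where "k x = h x / (x \<bullet> x + \<eta>\<^sup>2)" for x
    have hpos: "h x > 0" and kpos: "k x > 0" for x using pos by (auto simp: h_def k_def)
    have hcont: "continuous_on A h" for A
      unfolding h_def using nz by (intro continuous_intros) auto
    have kcont: "continuous_on A k" for A
      unfolding k_def using nz by (intro continuous_intros hcont) auto
    have hder: "(h has_derivative (\<lambda>w. (- (n / 2) * k x) *\<^sub>R x \<bullet> w)) (at x)" for x
      unfolding h_def k_def using pos[of x] nz[of x]
      by (auto intro!: derivative_eq_intros simp: field_simps inner_commute)
    have meas: "continuous_on UNIV f \<Longrightarrow> f \<in> borel_measurable M" for f :: "'a \<Rightarrow> real"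
      by (rule continuous_meas) (rule continuous_on_subset, auto)
    have uint: "integrable M (\<lambda>x. u x * f x)" if "continuous_on UNIV f" for f
      using continuous_bounded[OF that] u_times_bounded[OF meas[OF that]] by blast
    have Hv: "continuous_on UNIV (\<lambda>x. ((- (n / 2) * k x) *\<^sub>R x) \<bullet> e)"
      by (intro continuous_intros kcont)
    note ibp = integration_by_parts[OF hder Hv]
    have h2: "(h x)\<^sup>2 = exp (- (n / 2) * ln (x \<bullet> x + \<eta>\<^sup>2))" for x
      by (simp add: h_def power2_eq_square flip: exp_add)
    have h2int: "integrable M (\<lambda>x. (h x)\<^sup>2)"
    proof -
      have c: "continuous_on UNIV (\<lambda>x. (h x)\<^sup>2)" by (intro continuous_intros hcont)
      then show ?thesis using continuous_bounded[OF c] bounded_integrable[OF meas[OF c]] by blast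
    qed
    have h2le: "integral\<^sup>L M (\<lambda>x. (h x)\<^sup>2) \<le> C1 * (real J + 1)"
      unfolding h2 by (rule C1(2)[OF \<eta>])
    have a: "integral\<^sup>L M (\<lambda>x. (Du x \<bullet> e) * h x) \<le> sqrt (D * C1) * sqrt (real J + 1)"
    proof -
      have "(integral\<^sup>L M (\<lambda>x. (Du x \<bullet> e) * h x))\<^sup>2 \<le> D * integral\<^sup>L M (\<lambda>x. (h x)\<^sup>2)"
        unfolding D_def by (rule integral_Cauchy_Schwarz[OF Du_component(2) h2int ibp(1)])
      also have "\<dots> \<le> D * (C1 * (real J + 1))" by (intro mult_left_mono h2le DU)
      finally have "integral\<^sup>L M (\<lambda>x. (Du x \<bullet> e) * h x) \<le> sqrt (D * (C1 * (real J + 1)))"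
        by (rule real_le_rsqrt)
      then show ?thesis by (simp add: real_sqrt_mult mult.assoc)
    qed
    have b: "integral\<^sup>L M (\<lambda>x. u x * h x) \<le> sqrt (U * C1) * sqrt (real J + 1)"
    proof -
      have "(integral\<^sup>L M (\<lambda>x. u x * h x))\<^sup>2 \<le> U * integral\<^sup>L M (\<lambda>x. (h x)\<^sup>2)"
        unfolding U_def by (rule integral_Cauchy_Schwarz[OF u_L2 h2int uint[OF hcont]])
      also have "\<dots> \<le> U * (C1 * (real J + 1))" by (intro mult_left_mono h2le DU)
      finally have "integral\<^sup>L M (\<lambda>x. u x * h x) \<le> sqrt (U * (C1 * (real J + 1)))"
        by (rule real_le_rsqrt)
      then show ?thesis by (simp add: real_sqrt_mult mult.assoc)
    qed
    have i1: "integrable M (\<lambda>x. u x * ((x \<bullet> e) * k x))"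
      by (intro uint continuous_intros kcont)
    have "integral\<^sup>L M (\<lambda>x. u x * (((- (n / 2) * k x) *\<^sub>R x) \<bullet> e)) = - (n / 2) * integral\<^sup>L M (\<lambda>x. u x * ((x \<bullet> e) * k x))"
      by (subst integral_mult_right_zero[symmetric]) (simp add: mult_ac)
    with ibp(3) have I: "integral\<^sup>L M (\<lambda>x. u x * ((x \<bullet> e) * k x)) = (2 / n) * integral\<^sup>L M (\<lambda>x. (Du x \<bullet> e) * h x)"
      using n by (simp add: field_simps)
    have i2: "integrable M (\<lambda>x. u x * (max (x \<bullet> e) 0 * k x))"
      by (intro uint continuous_intros kcont)
    have "integral\<^sup>L M (\<lambda>x. u x * (max (x \<bullet> e) 0 * k x)) \<le> integral\<^sup>L M (\<lambda>x. u x * ((x \<bullet> e) * k x) + C * (u x * h x))"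
    proof (rule integral_mono[OF i2])
      show "integrable M (\<lambda>x. u x * ((x \<bullet> e) * k x) + C * (u x * h x))"
        using i1 uint[OF hcont] by simp
      fix x assume "x \<in> space M"
      then have x: "x \<in> \<Omega>" by (simp add: space_M)
      \<comment> \<open>By the exterior condition the negative part of \<open>x \<bullet> e\<close>
        is at most \<open>C |x|^2\<close>, and \<open>|x|^2 k \<le> h\<close>; the correction is
        thus a multiple of \<open>u h\<close>.\<close>
      have "max (x \<bullet> e) 0 \<le> x \<bullet> e + C * (x \<bullet> x)"
        using C(2)[OF x] C(1) by (simp add: max_def)
      then have "max (x \<bullet> e) 0 * k x \<le> (x \<bullet> e + C * (x \<bullet> x)) * k x"
        using kpos[of x] by (intro mult_right_mono) auto
      also have "\<dots> \<le> (x \<bullet> e) * k x + C * h x"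
      proof -
        have "(x \<bullet> x) * k x \<le> (x \<bullet> x + \<eta>\<^sup>2) * k x"
          using kpos[of x] by (intro mult_right_mono) auto
        also have "\<dots> = h x" using nz[of x] by (simp add: k_def)
        finally have "C * ((x \<bullet> x) * k x) \<le> C * h x" using C(1) by (rule mult_left_mono)
        then show ?thesis by (simp add: algebra_simps)
      qed
      finally have "u x * (max (x \<bullet> e) 0 * k x) \<le> u x * ((x \<bullet> e) * k x + C * h x)"
        using u_nonneg[OF x] by (rule mult_left_mono)
      then show "u x * (max (x \<bullet> e) 0 * k x) \<le> u x * ((x \<bullet> e) * k x) + C * (u x * h x)"
        by (simp add: algebra_simps)
    qed
    also have "\<dots> = (2 / n) * integral\<^sup>L M (\<lambda>x. (Du x \<bullet> e) * h x) + C * integral\<^sup>L M (\<lambda>x. u x * h x)"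
      using i1 uint[OF hcont] I by simp
    also have "\<dots> \<le> (2 / n) * (sqrt (D * C1) * sqrt (real J + 1)) + C * (sqrt (U * C1) * sqrt (real J + 1))"
      using n C by (intro add_mono mult_left_mono a b) auto
    also have "\<dots> = K * sqrt (real J + 1)" by (simp add: K_def algebra_simps)
    finally show ?thesis using i2 by (simp add: k_def h_def)
  qed
  then show ?thesis unfolding n_def by (intro that[of K]) blast+
qed

end

section \<open>The barrier at the contact point\<close>

lemma has_lap_ln:
  assumes "has_lap S w W L" "\<And>x. x \<in> S \<Longrightarrow> w x > 0"
  shows "has_lap S (\<lambda>x. ln (w x)) (\<lambda>x. inverse (w x) *\<^sub>R W x) (\<lambda>x. - (inverse (w x))\<^sup>2 * (norm (W x))\<^sup>2 + inverse (w x) * L x)"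
  by (rule has_lap_compose[OF assms(1), where \<phi> = ln and ?\<phi>1.0 = inverse and ?\<phi>2.0 = "\<lambda>t. - (inverse t)\<^sup>2"])
     (use assms(2) in \<open>auto intro!: derivative_eq_intros simp: inverse_eq_divide power2_eq_square less_imp_neq[THEN not_sym]\<close>)

text \<open>Read \<open>\<gamma> = 1 / (A E)\<close>, \<open>p = \<psi>\<close>,
  \<open>k = \<kappa>\<close>; \<open>d\<close> and \<open>r\<close> are the difference and sum of
  \<open>\<kappa>^2 / E\<close> and \<open>1 / A\<close>. The terms with \<open>f1\<close> cancel,
  and so do the terms without the factor \<open>q\<close>. What is left of \<open>f\<close> combines
  through \<open>rel\<close>.\<close>

lemma barrier_algebra:
  fixes n k q d r \<gamma> p f f1 f2 :: real
  assumes rel: "r = (1 - 2 * k * q) * \<gamma>"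
  shows "q * (p * (f2 * \<gamma> + f1 * ((n - 2) * d)) + 2 * (- (n / 4) * p * f1 * (2 * d)) +
        f * (n\<^sup>2 / 16 * p * (4 * (1 - 4 * k * q) * \<gamma>) + - (n / 4) * p * ((2 * n - 4) * r))) +
      2 * (p * f1 * (q * d) + f * (- (n / 4) * p * (2 * q * r - 4 * k))) +
      p * f * (- 2 * k * n) = q * p * \<gamma> * (f2 - n\<^sup>2 / 4 * f)"
proof -
  define m where "m = n / 4"
  have n: "n = 4 * m" "n / 4 = m" "n\<^sup>2 / 16 = m\<^sup>2" "n\<^sup>2 / 4 = 4 * m\<^sup>2"
    by (simp_all add: m_def power2_eq_square)
  show ?thesis
    unfolding n(2,3,4) unfolding n(1) rel by algebra
qed

text \<open>The ball \<open>{q > 0}\<close> touches its boundary at \<open>0\<close> and has \<open>e / \<kappa>\<close> as the antipode of \<open>0\<close>.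
  Inversion in the unit sphere maps it to a half space, on which \<open>y\<^sub>n \<bar>y\<bar>\<^sup>-\<^sup>n\<^sup>/\<^sup>2 f (ln \<bar>y\<bar>)\<close> is the critical
  profile of the Hardy operator; pulled back by the Kelvin transform (after moving the boundary of the half space to
  the origin) it becomes the barrier below. Compared with the obvious profile \<open>q \<bar>x\<bar>\<^sup>-\<^sup>n\<^sup>/\<^sup>2 f (- ln \<bar>x\<bar>)\<close>, every
  error term keeps the factor \<open>q\<close>, so there is nothing to absorb at the boundary.\<close>

locale touching_ball =
  fixes e :: "'a::euclidean_space" and \<kappa> :: real
  assumes norm_e: "norm e = 1" and \<kappa>_pos: "\<kappa> > 0"
begin

definition A :: "'a \<Rightarrow> real" where "A x = x \<bullet> x"
definition E :: "'a \<Rightarrow> real" where "E x = (\<kappa> *\<^sub>R x - e) \<bullet> (\<kappa> *\<^sub>R x - e)"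
definition q :: "'a \<Rightarrow> real" where "q x = x \<bullet> e - \<kappa> * (x \<bullet> x)"
text \<open>The condition \<open>A x < E x\<close> means \<open>\<tau> x > 0\<close> and keeps the
  set away from the antipode, where \<open>E\<close> vanishes.\<close>

definition S :: "'a set" where "S = {x. q x > 0 \<and> A x < E x}"
text \<open>The level sets are the Apollonius spheres of the contact point and its antipode;
  \<open>\<tau>\<close> tends to infinity at the contact point.\<close>

definition \<tau> :: "'a \<Rightarrow> real" where "\<tau> x = (ln (E x) - ln (A x)) / 2"
definition \<psi> :: "'a \<Rightarrow> real" where "\<psi> x = exp (- (real DIM('a) / 4) * (ln (A x) + ln (E x)))"

lemma e_e: "e \<bullet> e = 1"
  using norm_e by (simp add: norm_eq_1)

lemma E_eq: "E x = 1 - 2 * \<kappa> * q x - \<kappa>\<^sup>2 * A x"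
  by (simp add: E_def q_def A_def e_e algebra_simps inner_commute power2_eq_square)

lemma continuous_AEq: "continuous_on T A" "continuous_on T E" "continuous_on T q"
  unfolding A_def E_def q_def by (intro continuous_intros)+

lemma open_S: "open S"
  unfolding S_def by (intro open_Collect_conj open_Collect_less continuous_intros continuous_AEq)

text \<open>The lower bound for \<open>E\<close> combines
  \<open>1 \<le> \<kappa> |x| + |\<kappa> x - e|\<close> with \<open>|x| < |\<kappa> x - e|\<close>.
  Together with \<open>E < 1\<close> it shows that \<open>\<tau>\<close> differs from
  \<open>- ln |x|\<close> by a bounded amount.\<close>

lemma S_facts:
  assumes "x \<in> S"
  shows "A x > 0" "E x > 0" "A x < E x" "E x < 1" "q x > 0" "\<tau> x > 0" "E x > inverse ((1 + \<kappa>)\<^sup>2)"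
    "A x = E x * exp (- 2 * \<tau> x)"
proof -
  show q: "q x > 0" and AE: "A x < E x" using assms by (auto simp: S_def)
  have "x \<noteq> 0" using q by (auto simp: q_def)
  then show A0: "A x > 0" by (simp add: A_def)
  then show E0: "E x > 0" using AE by simp
  have "\<kappa> * q x > 0" "\<kappa>\<^sup>2 * A x > 0" using \<kappa>_pos q A0 by simp_all
  then show "E x < 1" by (simp add: E_eq)
  show "\<tau> x > 0" using A0 AE by (simp add: \<tau>_def)
  have "ln (A x) = ln (E x) - 2 * \<tau> x" by (simp add: \<tau>_def field_simps)
  then have "exp (ln (A x)) = exp (ln (E x) - 2 * \<tau> x)" by simp
  then show "A x = E x * exp (- 2 * \<tau> x)" using A0 E0 by (simp add: exp_diff exp_minus field_simps)
  have "norm x < norm (\<kappa> *\<^sub>R x - e)"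
    using AE by (simp add: A_def E_def norm_eq_sqrt_inner)
  moreover have "norm e \<le> \<kappa> * norm x + norm (\<kappa> *\<^sub>R x - e)"
    using norm_triangle_ineq4[of "\<kappa> *\<^sub>R x" "\<kappa> *\<^sub>R x - e"] \<kappa>_pos by simp
  moreover have "\<kappa> * norm x < \<kappa> * norm (\<kappa> *\<^sub>R x - e)"
    using calculation(1) \<kappa>_pos by simp
  ultimately have "1 < (1 + \<kappa>) * norm (\<kappa> *\<^sub>R x - e)"
    using norm_e by (simp add: algebra_simps)
  then have "1\<^sup>2 < ((1 + \<kappa>) * norm (\<kappa> *\<^sub>R x - e))\<^sup>2"
    by (intro power_strict_mono) auto
  then have "1 < (1 + \<kappa>)\<^sup>2 * E x"
    by (simp add: power_mult_distrib power2_norm_eq_inner E_def)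
  then show "E x > inverse ((1 + \<kappa>)\<^sup>2)"
    using \<kappa>_pos by (simp add: inverse_eq_divide divide_less_eq mult.commute)
qed

text \<open>The Laplacian of the barrier carries \<open>1 / (A E)\<close>, the Hardy potential
  \<open>1 / A\<close>; this measures the mismatch. From \<open>A = E exp (- 2 \<tau>)\<close> one
  gets \<open>|x| \<le> exp (- \<tau>)\<close>, and \<open>1 - E\<close> is at most
  \<open>2 \<kappa> (x \<bullet> e)\<close>.\<close>

lemma one_minus_E:
  assumes "x \<in> S"
  shows "0 \<le> 1 - E x" "1 - E x \<le> 2 * \<kappa> * exp (- \<tau> x)" "A x * E x \<le> exp (- \<tau> x)" "A x \<le> 1"
proof -
  note f = S_facts[OF assms]
  show "0 \<le> 1 - E x" using f(4) by simp
  show "A x \<le> 1" using f(3,4) by linarith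
  have t1: "exp (- \<tau> x) \<le> 1" using f(6) by simp
  have "A x \<le> exp (- 2 * \<tau> x)"
    using f(2,4) by (subst f(8)) simp
  then have A2: "A x \<le> (exp (- \<tau> x))\<^sup>2" by (simp flip: exp_double)
  have "norm x \<le> exp (- \<tau> x)"
  proof (rule power2_le_imp_le)
    show "(norm x)\<^sup>2 \<le> (exp (- \<tau> x))\<^sup>2" using A2 unfolding A_def power2_norm_eq_inner .
  qed simp
  moreover have "x \<bullet> e \<le> norm x"
    using Cauchy_Schwarz_ineq2[of x e] norm_e by simp
  ultimately have "x \<bullet> e \<le> exp (- \<tau> x)" by linarith
  moreover have "1 - E x = 2 * \<kappa> * (x \<bullet> e) - \<kappa>\<^sup>2 * A x"
    by (simp add: E_eq q_def A_def algebra_simps power2_eq_square)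
  moreover have "\<kappa>\<^sup>2 * A x \<ge> 0" using f(1) by simp
  ultimately show "1 - E x \<le> 2 * \<kappa> * exp (- \<tau> x)"
    using mult_left_mono[of "x \<bullet> e" "exp (- \<tau> x)" "2 * \<kappa>"] less_imp_le[OF \<kappa>_pos] by linarith
  have "A x * E x \<le> A x * 1" using f(1,4) by (intro mult_left_mono) auto
  also have "\<dots> \<le> exp (- \<tau> x) * exp (- \<tau> x)" using A2 by (simp add: power2_eq_square)
  also have "\<dots> \<le> exp (- \<tau> x) * 1" by (intro mult_left_mono t1) auto
  finally show "A x * E x \<le> exp (- \<tau> x)" by simp
qed

lemma smooth_pieces: "smooth_on S q" "smooth_on S \<tau>" "smooth_on S \<psi>"
proof -
  have A: "smooth_on S A" unfolding A_def by (rule smooth_on_norm2)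
  show q: "smooth_on S q"
    unfolding q_def by (intro smooth_on_diff smooth_on_mult smooth_on_const smooth_on_inner_left smooth_on_norm2)
  have E: "smooth_on S E"
    unfolding E_eq by (intro smooth_on_diff smooth_on_mult smooth_on_const q A)
  have lA: "smooth_on S (\<lambda>x. ln (A x))" and lE: "smooth_on S (\<lambda>x. ln (E x))"
    using S_facts by (auto intro!: smooth_on_ln A E)
  have "smooth_on S (\<lambda>x. (ln (E x) - ln (A x)) * (1 / 2))"
    by (intro smooth_on_mult smooth_on_diff smooth_on_const lA lE)
  then show "smooth_on S \<tau>" by (simp add: \<tau>_def[abs_def])
  show "smooth_on S \<psi>"
    unfolding \<psi>_def by (intro smooth_on_exp smooth_on_mult smooth_on_add smooth_on_const lA lE)
qed

text \<open>With \<open>y = \<kappa> x - e\<close> one has \<open>x \<bullet> x = A\<close>,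
  \<open>y \<bullet> y = E\<close>, \<open>x \<bullet> y = - q\<close>, and \<open>e\<close> is a
  combination of \<open>x\<close> and \<open>y\<close>. Every inner product of gradients thus
  reduces to \<open>A\<close>, \<open>E\<close> and \<open>q\<close>; in particular the squared
  gradient of \<open>\<tau>\<close> is the conformal factor \<open>1 / (A E)\<close>.\<close>

lemma barrier_laplacian:
  assumes d1: "\<And>t. (f has_real_derivative f1 t) (at t)" and d2: "\<And>t. (f1 has_real_derivative f2 t) (at t)"
  shows "\<exists>V. has_lap S (\<lambda>x. q x * (\<psi> x * f (\<tau> x))) V
    (\<lambda>x. q x * \<psi> x / (A x * E x) * (f2 (\<tau> x) - (real DIM('a))\<^sup>2 / 4 * f (\<tau> x)))"
proof -
  define n where "n = real DIM('a)"
  define a b where "a x = inverse (A x)" and "b x = inverse (E x)" for x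
  define y where "y x = \<kappa> *\<^sub>R x - e" for x
  have A: "has_lap S A (\<lambda>x. 2 *\<^sub>R x) (\<lambda>x. 2 * n)"
    using has_lap_norm2_shift[of S 1 0] by (simp add: A_def[abs_def] n_def)
  have E: "has_lap S E (\<lambda>x. (2 * \<kappa>) *\<^sub>R y x) (\<lambda>x. 2 * \<kappa>\<^sup>2 * n)"
    using has_lap_norm2_shift[of S \<kappa> e] by (simp add: E_def[abs_def] y_def n_def)
  have q: "has_lap S q (\<lambda>x. e - (2 * \<kappa>) *\<^sub>R x) (\<lambda>x. - 2 * \<kappa> * n)"
    using has_lap_add[OF has_lap_inner_left[of S e] has_lap_cmult[OF A, of "- \<kappa>"]]
    by (simp add: q_def[abs_def] A_def algebra_simps)
  have lA: "has_lap S (\<lambda>x. ln (A x)) (\<lambda>x. (2 * a x) *\<^sub>R x) (\<lambda>x. (2 * n - 4) * a x)"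
  proof (rule has_lap_cong_deriv[OF has_lap_ln[OF A S_facts(1)] open_S])
    fix x assume "x \<in> S"
    then have "A x \<noteq> 0" using S_facts(1) by force
    moreover have "(norm (2 *\<^sub>R x))\<^sup>2 = 4 * A x"
      by (simp add: A_def power_mult_distrib power2_norm_eq_inner)
    ultimately show "- (inverse (A x))\<^sup>2 * (norm (2 *\<^sub>R x))\<^sup>2 + inverse (A x) * (2 * n) = (2 * n - 4) * a x"
      by (simp only: a_def) (simp add: field_simps power2_eq_square)
  qed (simp_all add: a_def)
  have lE: "has_lap S (\<lambda>x. ln (E x)) (\<lambda>x. (2 * \<kappa> * b x) *\<^sub>R y x) (\<lambda>x. (2 * n - 4) * (\<kappa>\<^sup>2 * b x))"
  proof (rule has_lap_cong_deriv[OF has_lap_ln[OF E S_facts(2)] open_S])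
    fix x assume "x \<in> S"
    then have "E x \<noteq> 0" using S_facts(2) by force
    moreover have "(norm ((2 * \<kappa>) *\<^sub>R y x))\<^sup>2 = 4 * \<kappa>\<^sup>2 * E x"
      by (simp add: E_def y_def power_mult_distrib power2_norm_eq_inner)
    ultimately show "- (inverse (E x))\<^sup>2 * (norm ((2 * \<kappa>) *\<^sub>R y x))\<^sup>2 + inverse (E x) * (2 * \<kappa>\<^sup>2 * n) = (2 * n - 4) * (\<kappa>\<^sup>2 * b x)"
      by (simp only: b_def) (simp add: field_simps power2_eq_square)
  qed (simp_all add: b_def mult_ac)
  define s where "s x = ln (A x) + ln (E x)" for x
  define gs where "gs x = (2 * a x) *\<^sub>R x + (2 * \<kappa> * b x) *\<^sub>R y x" for x
  define gt where "gt x = (\<kappa> * b x) *\<^sub>R y x - a x *\<^sub>R x" for x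
  have s: "has_lap S s gs (\<lambda>x. (2 * n - 4) * (a x + \<kappa>\<^sup>2 * b x))"
    using has_lap_add[OF lA lE] by (simp add: s_def[abs_def] gs_def[abs_def] algebra_simps)
  have t: "has_lap S \<tau> gt (\<lambda>x. (n - 2) * (\<kappa>\<^sup>2 * b x - a x))"
    by (rule has_lap_cong_deriv[OF has_lap_add[OF has_lap_cmult[OF lE, of "1/2"] has_lap_cmult[OF lA, of "-1/2"]] open_S])
       (simp_all add: \<tau>_def gt_def field_simps)
  have psi: "has_lap S \<psi> (\<lambda>x. (- (n / 4) * \<psi> x) *\<^sub>R gs x)
     (\<lambda>x. n\<^sup>2 / 16 * \<psi> x * (norm (gs x))\<^sup>2 + - (n / 4) * \<psi> x * ((2 * n - 4) * (a x + \<kappa>\<^sup>2 * b x)))"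
  proof -
    have "has_lap S (\<lambda>x. (\<lambda>t. exp (- (n / 4) * t)) (s x)) (\<lambda>x. (\<lambda>t. - (n / 4) * exp (- (n / 4) * t)) (s x) *\<^sub>R gs x)
       (\<lambda>x. (\<lambda>t. n\<^sup>2 / 16 * exp (- (n / 4) * t)) (s x) * (norm (gs x))\<^sup>2
          + (\<lambda>t. - (n / 4) * exp (- (n / 4) * t)) (s x) * ((2 * n - 4) * (a x + \<kappa>\<^sup>2 * b x)))"
      by (rule has_lap_compose[OF s]) (auto intro!: derivative_eq_intros simp: power2_eq_square)
    then show ?thesis by (simp add: \<psi>_def[abs_def] s_def n_def)
  qed
  have ft: "has_lap S (\<lambda>x. f (\<tau> x)) (\<lambda>x. f1 (\<tau> x) *\<^sub>R gt x)
     (\<lambda>x. f2 (\<tau> x) * (norm (gt x))\<^sup>2 + f1 (\<tau> x) * ((n - 2) * (\<kappa>\<^sup>2 * b x - a x)))"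
    by (rule has_lap_compose[OF t]) (use d1 d2 in auto)
  note full = has_lap_mult[OF q has_lap_mult[OF psi ft]]
  show ?thesis
  proof (rule exI, rule has_lap_cong_deriv[OF full open_S])
    fix x assume x: "x \<in> S"
    have nz: "A x \<noteq> 0" "E x \<noteq> 0" using S_facts(1,2)[OF x] by simp_all
    define g where "g = inverse (A x * E x)"
    have aA: "a x * A x = 1" and bE: "b x * E x = 1" and ab: "a x * b x = g"
      using nz by (simp_all add: a_def b_def g_def)
    have xx: "x \<bullet> x = A x" and yy: "y x \<bullet> y x = E x" and xy: "x \<bullet> y x = - q x"
      and e: "e = \<kappa> *\<^sub>R x - y x"
      by (simp_all add: A_def E_def y_def q_def algebra_simps)
    have rel: "a x + \<kappa>\<^sup>2 * b x = (1 - 2 * \<kappa> * q x) * g"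
    proof -
      have "(1 - 2 * \<kappa> * q x) * g = (E x + \<kappa>\<^sup>2 * A x) * (a x * b x)"
        unfolding ab by (simp add: E_eq)
      also have "\<dots> = a x * (b x * E x) + \<kappa>\<^sup>2 * b x * (a x * A x)"
        by (simp add: algebra_simps)
      finally show ?thesis unfolding aA bE by simp
    qed
    have qs: "(e - (2 * \<kappa>) *\<^sub>R x) \<bullet> gs x = 2 * q x * (a x + \<kappa>\<^sup>2 * b x) - 4 * \<kappa>"
    proof -
      have "(e - (2 * \<kappa>) *\<^sub>R x) \<bullet> gs x = 2 * a x * q x - 2 * \<kappa> * (a x * A x) + 2 * \<kappa>\<^sup>2 * b x * q x - 2 * \<kappa> * (b x * E x)"
        by (subst e) (simp add: gs_def inner_add_right inner_diff_left xx yy xy inner_commute[of "y x" x] algebra_simps power2_eq_square)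
      then show ?thesis unfolding aA bE by (simp only:) (simp add: algebra_simps)
    qed
    have qt: "(e - (2 * \<kappa>) *\<^sub>R x) \<bullet> gt x = q x * (\<kappa>\<^sup>2 * b x - a x)"
    proof -
      have "(e - (2 * \<kappa>) *\<^sub>R x) \<bullet> gt x = \<kappa>\<^sup>2 * b x * q x - \<kappa> * (b x * E x) - a x * q x + \<kappa> * (a x * A x)"
        by (subst e) (simp add: gt_def inner_diff_right inner_diff_left xx yy xy inner_commute[of "y x" x] algebra_simps power2_eq_square)
      then show ?thesis unfolding aA bE by (simp only:) (simp add: algebra_simps)
    qed
    have ss: "(norm (gs x))\<^sup>2 = 4 * (1 - 4 * \<kappa> * q x) * g"
    proof -
      have "(norm (gs x))\<^sup>2 = 4 * (a x * (a x * A x) + \<kappa>\<^sup>2 * b x * (b x * E x)) - 8 * \<kappa> * q x * (a x * b x)"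
        unfolding power2_norm_eq_inner gs_def
        by (simp add: inner_add_right inner_add_left xx yy xy inner_commute[of "y x" x] algebra_simps power2_eq_square)
      also have "\<dots> = 4 * (a x + \<kappa>\<^sup>2 * b x) - 8 * \<kappa> * q x * g" by (simp only: aA bE ab mult_1_right)
      finally show ?thesis unfolding rel by (simp add: algebra_simps)
    qed
    have tt: "(norm (gt x))\<^sup>2 = g"
    proof -
      have "(norm (gt x))\<^sup>2 = (a x * (a x * A x) + \<kappa>\<^sup>2 * b x * (b x * E x)) + 2 * \<kappa> * q x * (a x * b x)"
        unfolding power2_norm_eq_inner gt_def
        by (simp add: inner_diff_right inner_diff_left xx yy xy inner_commute[of "y x" x] algebra_simps power2_eq_square)
      also have "\<dots> = (a x + \<kappa>\<^sup>2 * b x) + 2 * \<kappa> * q x * g" by (simp only: aA bE ab mult_1_right)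
      finally show ?thesis unfolding rel by (simp add: algebra_simps)
    qed
    have st: "gs x \<bullet> gt x = 2 * (\<kappa>\<^sup>2 * b x - a x)"
    proof -
      have "gs x \<bullet> gt x = 2 * (\<kappa>\<^sup>2 * b x * (b x * E x) - a x * (a x * A x))"
        by (simp add: gs_def gt_def inner_diff_right inner_add_left xx yy xy inner_commute[of "y x" x] algebra_simps power2_eq_square)
      then show ?thesis unfolding aA bE by (simp only: mult_1_right)
    qed
    have m: "q x * \<psi> x / (A x * E x) = q x * \<psi> x * g" by (simp add: g_def divide_inverse)
    have c: "(- (n / 4) * \<psi> x) *\<^sub>R gs x \<bullet> f1 (\<tau> x) *\<^sub>R gt x = - (n / 4) * \<psi> x * f1 (\<tau> x) * (2 * (\<kappa>\<^sup>2 * b x - a x))"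
      by (simp add: st)
    have d: "(e - (2 * \<kappa>) *\<^sub>R x) \<bullet> (\<psi> x *\<^sub>R f1 (\<tau> x) *\<^sub>R gt x + f (\<tau> x) *\<^sub>R (- (n / 4) * \<psi> x) *\<^sub>R gs x) =
        \<psi> x * f1 (\<tau> x) * (q x * (\<kappa>\<^sup>2 * b x - a x)) + f (\<tau> x) * (- (n / 4) * \<psi> x * (2 * q x * (a x + \<kappa>\<^sup>2 * b x) - 4 * \<kappa>))"
      unfolding inner_add_right inner_scaleR_right qs qt by (simp add: mult_ac)
    show "q x * (\<psi> x * (f2 (\<tau> x) * (norm (gt x))\<^sup>2 + f1 (\<tau> x) * ((n - 2) * (\<kappa>\<^sup>2 * b x - a x))) +
          2 * ((- (n / 4) * \<psi> x) *\<^sub>R gs x \<bullet> f1 (\<tau> x) *\<^sub>R gt x) +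
          f (\<tau> x) * (n\<^sup>2 / 16 * \<psi> x * (norm (gs x))\<^sup>2 + - (n / 4) * \<psi> x * ((2 * n - 4) * (a x + \<kappa>\<^sup>2 * b x)))) +
        2 * ((e - (2 * \<kappa>) *\<^sub>R x) \<bullet> (\<psi> x *\<^sub>R f1 (\<tau> x) *\<^sub>R gt x + f (\<tau> x) *\<^sub>R (- (n / 4) * \<psi> x) *\<^sub>R gs x)) +
        \<psi> x * f (\<tau> x) * (- 2 * \<kappa> * n) =
        q x * \<psi> x / (A x * E x) * (f2 (\<tau> x) - (real DIM('a))\<^sup>2 / 4 * f (\<tau> x))"
      unfolding m c d ss tt n_def[symmetric] by (rule barrier_algebra[OF rel])
  qed simp_all
qed

end

text \<open>The exponential makes the profile convex enough to absorb the terms of size \<open>exp (- t)\<close>; the quadratic term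
  brings it back to zero before \<open>t = k\<close>.\<close>

definition profile :: "real \<Rightarrow> real \<Rightarrow> real \<Rightarrow> real" where
  "profile K k t = t - 4 * K * (1 - exp (- t / 2)) - t\<^sup>2 / k"

definition profile1 :: "real \<Rightarrow> real \<Rightarrow> real \<Rightarrow> real" where
  "profile1 K k t = 1 - 2 * K * exp (- t / 2) - 2 * t / k"

definition profile2 :: "real \<Rightarrow> real \<Rightarrow> real \<Rightarrow> real" where
  "profile2 K k t = K * exp (- t / 2) - 2 / k"

lemma profile_deriv:
  "(profile K k has_real_derivative profile1 K k t) (at t)"
  "(profile1 K k has_real_derivative profile2 K k t) (at t)"
proof -
  have sq: "((\<lambda>t. t\<^sup>2 / k) has_real_derivative 2 * t / k) (at t)"
    by (rule DERIV_cdivide) (auto intro!: derivative_eq_intros)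
  have ex: "((\<lambda>t. exp (- t / 2)) has_real_derivative - exp (- t / 2) / 2) (at t)"
    by (auto intro!: derivative_eq_intros)
  show "(profile K k has_real_derivative profile1 K k t) (at t)"
    unfolding profile_def[abs_def] profile1_def
    by (rule DERIV_cong, rule DERIV_diff[OF DERIV_diff[OF DERIV_ident DERIV_cmult[OF DERIV_diff[OF DERIV_const ex]]] sq]) simp
  have li: "((\<lambda>t. 2 * t / k) has_real_derivative 2 / k) (at t)"
    by (rule DERIV_cdivide) (auto intro!: derivative_eq_intros)
  show "(profile1 K k has_real_derivative profile2 K k t) (at t)"
    unfolding profile1_def[abs_def] profile2_def
    by (rule DERIV_cong, rule DERIV_diff[OF DERIV_diff[OF DERIV_const DERIV_cmult[OF ex]] li]) simp
qed

lemma profile_bounds: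
  assumes "K \<ge> 0" "k > 0" "t > 0"
  shows "profile K k t \<le> t" "profile K k t > 0 \<Longrightarrow> t < k"
proof -
  have "4 * K * (1 - exp (- t / 2)) \<ge> 0" using assms by (intro mult_nonneg_nonneg) auto
  then have le: "profile K k t \<le> t - t\<^sup>2 / k" by (simp add: profile_def)
  have "t\<^sup>2 / k \<ge> 0" using assms by simp
  then show "profile K k t \<le> t" using le by simp
  assume "profile K k t > 0"
  then have "t\<^sup>2 / k < t" using le by simp
  then have "t * t < t * k" using assms by (simp add: power2_eq_square divide_less_eq mult.commute)
  then show "t < k" using assms by simp
qed

text \<open>Disposes of the error proportional to the cut-off level.\<close>

lemma le_if_le_small_perturbation:
  fixes a b G d0 :: real
  assumes "d0 > 0" "\<And>d. 0 < d \<Longrightarrow> d \<le> d0 \<Longrightarrow> a \<le> b + d * G"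
  shows "a \<le> b"
proof -
  have "((\<lambda>d. b + d * G) \<longlongrightarrow> b + 0 * G) (at_right 0)"
    by (intro tendsto_intros)
  moreover have "eventually (\<lambda>d. a \<le> b + d * G) (at_right 0)"
    using eventually_at_right_less[of 0] eventually_at_right_real[OF assms(1)]
    by eventually_elim (use assms(2) in auto)
  ultimately show ?thesis
    using tendsto_lowerbound[of "\<lambda>d. b + d * G" "b + 0 * G" "at_right 0" a] by simp
qed

section \<open>Vanishing near the contact point\<close>

locale contact = supersolution \<Omega> u Du c lam + touching_ball e \<kappa>
  for \<Omega> :: "'a::euclidean_space set" and u :: "'a \<Rightarrow> real" and Du :: "'a \<Rightarrow> 'a"
    and c lam :: real and e :: 'a and \<kappa> :: real +
  assumes c_eq: "c = (real DIM('a))\<^sup>2 / 4"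
    and ball_inside: "\<And>x. x \<bullet> e > \<kappa> * (x \<bullet> x) \<Longrightarrow> x \<in> \<Omega>"
begin

lemma S_inside: "S \<subseteq> \<Omega>"
  using ball_inside by (auto simp: S_def q_def)

definition \<epsilon> :: real where "\<epsilon> = inverse ((1 + \<kappa>)\<^sup>2)"

lemma \<epsilon>_pos: "\<epsilon> > 0" using \<kappa>_pos by (simp add: \<epsilon>_def)

definition barrier :: "real \<Rightarrow> real \<Rightarrow> 'a \<Rightarrow> real" where
  "barrier K k x = q x * (\<psi> x * profile K k (\<tau> x))"

text \<open>The factor of \<open>f'' - c f\<close> in the Laplacian of the barrier, and the density
  against which \<open>u\<close> is finally measured.\<close>

definition dens :: "'a \<Rightarrow> real" where
  "dens x = q x * \<psi> x / (A x * E x)"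

lemma \<psi>_pos: "\<psi> x > 0"
  by (simp add: \<psi>_def)

lemma barrier_smooth: "smooth_on S (barrier K k)"
proof -
  have "smooth_on S (\<lambda>x. q x * (\<psi> x * (\<tau> x - 4 * K * (1 - exp (\<tau> x * (- 1 / 2))) - \<tau> x * \<tau> x * (1 / k))))"
    by (intro smooth_on_mult smooth_on_diff smooth_on_exp smooth_on_const smooth_pieces)
  then show ?thesis by (simp add: barrier_def[abs_def] profile_def power2_eq_square)
qed

text \<open>Positivity of the profile confines \<open>\<tau>\<close> below \<open>k\<close>, hence
  keeps \<open>x\<close> at a distance of order \<open>exp (- k)\<close> from the singularity, where
  \<open>\<psi>\<close> is bounded.\<close>

lemma barrier_positive:
  assumes "x \<in> S" "barrier K k x > 0" "K \<ge> 0" "k > 0"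
  shows "profile K k (\<tau> x) > 0" "\<tau> x < k" "A x \<ge> \<epsilon> * exp (- 2 * k)"
    "\<psi> x \<le> exp (- (real DIM('a) / 4) * (2 * ln \<epsilon> - 2 * k))"
proof -
  note f = S_facts[OF assms(1)]
  show p: "profile K k (\<tau> x) > 0"
    using assms(2) f(5) \<psi>_pos[of x] by (simp add: barrier_def zero_less_mult_iff)
  show k: "\<tau> x < k" using profile_bounds(2)[OF assms(3,4) f(6) p] .
  have "\<epsilon> * exp (- 2 * k) \<le> E x * exp (- 2 * \<tau> x)"
    using f(2,7) k by (intro mult_mono) (auto simp: \<epsilon>_def)
  then show A: "A x \<ge> \<epsilon> * exp (- 2 * k)" using f(8) by simp
  have "ln \<epsilon> \<le> ln (E x)" using f(2,7) \<epsilon>_pos by (simp add: \<epsilon>_def)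
  moreover have "ln (A x) = ln (E x) - 2 * \<tau> x" by (simp add: \<tau>_def field_simps)
  ultimately have "2 * ln \<epsilon> - 2 * k \<le> ln (A x) + ln (E x)" using k by linarith
  then have "(real DIM('a) / 4) * (2 * ln \<epsilon> - 2 * k) \<le> (real DIM('a) / 4) * (ln (A x) + ln (E x))"
    by (rule mult_left_mono) simp
  then show "\<psi> x \<le> exp (- (real DIM('a) / 4) * (2 * ln \<epsilon> - 2 * k))"
    by (simp add: \<psi>_def)
qed

text \<open>As \<open>S\<close> is open, the set is enclosed in a closed \<open>T\<close> inside
  \<open>S\<close>. With \<open>\<psi> \<le> B\<close> the barrier is at most
  \<open>q B \<tau>\<close>: the bound \<open>\<tau> < k\<close> then forces
  \<open>q \<ge> q0\<close>, and \<open>2 \<kappa> q \<le> 1\<close> forces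
  \<open>\<tau> \<ge> t1\<close>.\<close>

lemma barrier_superlevel_compact:
  assumes \<delta>: "\<delta> > 0" and K: "K \<ge> 0" and k: "k > 0"
  shows "compact {x \<in> S. barrier K k x \<ge> \<delta>}"
proof -
  define B where "B = exp (- (real DIM('a) / 4) * (2 * ln \<epsilon> - 2 * k))"
  have B: "B > 0" by (simp add: B_def)
  define q0 where "q0 = \<delta> / (B * k)"
  define t1 where "t1 = 2 * \<kappa> * \<delta> / B"
  have q0: "q0 > 0" and t1: "t1 > 0" using \<delta> B k \<kappa>_pos by (auto simp: q0_def t1_def)
  define T where "T = {x. q x \<ge> q0 \<and> exp (2 * t1) * A x \<le> E x}"
  have closedT: "closed T"
    unfolding T_def by (intro closed_Collect_conj closed_Collect_le continuous_intros continuous_AEq)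
  have TS: "T \<subseteq> S"
  proof
    fix x assume x: "x \<in> T"
    then have qx: "q x > 0" using q0 by (auto simp: T_def)
    then have "x \<noteq> 0" by (auto simp: q_def)
    then have A0: "A x > 0" by (simp add: A_def)
    have "1 * A x < exp (2 * t1) * A x" using A0 t1 by (intro mult_strict_right_mono) auto
    then show "x \<in> S" using x qx by (auto simp: S_def T_def)
  qed
  have sub: "x \<in> T" if x: "x \<in> S" "barrier K k x \<ge> \<delta>" for x
  proof -
    note f = S_facts[OF x(1)]
    have bp: "barrier K k x > 0" using x \<delta> by simp
    note p = barrier_positive[OF x(1) bp K k]
    have pt: "profile K k (\<tau> x) \<le> \<tau> x" by (rule profile_bounds(1)[OF K k f(6)])
    have up: "\<psi> x * profile K k (\<tau> x) \<le> B * \<tau> x"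
      using p(1,4) pt \<psi>_pos[of x] f(6) by (intro mult_mono) (auto simp: B_def)
    have le: "\<delta> \<le> q x * (B * \<tau> x)"
      using x(2) mult_left_mono[OF up less_imp_le[OF f(5)]] unfolding barrier_def by linarith
    have "q x * (B * \<tau> x) \<le> q x * (B * k)"
      using f(5) B p(2) by (intro mult_left_mono) auto
    then have "q x \<ge> q0" using le B k by (simp add: q0_def divide_le_eq)
    moreover have "\<tau> x \<ge> t1"
    proof -
      have "\<kappa>\<^sup>2 * A x \<ge> 0" using f(1) by simp
      then have "2 * \<kappa> * q x \<le> 1" using f(2) E_eq[of x] by linarith
      then have "(2 * \<kappa> * q x) * (B * \<tau> x) \<le> 1 * (B * \<tau> x)"
        using B f(6) by (intro mult_right_mono) auto
      moreover have "2 * \<kappa> * \<delta> \<le> 2 * \<kappa> * (q x * (B * \<tau> x))"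
        using le \<kappa>_pos by (intro mult_left_mono) auto
      ultimately have "2 * \<kappa> * \<delta> \<le> B * \<tau> x" by (simp add: mult_ac)
      then show ?thesis using B by (simp add: t1_def divide_le_eq mult.commute)
    qed
    moreover have "exp (2 * t1) * A x \<le> E x"
    proof -
      have "exp (2 * t1) * A x \<le> exp (2 * \<tau> x) * A x"
        using \<open>\<tau> x \<ge> t1\<close> f(1) by (intro mult_right_mono) auto
      also have "\<dots> = E x * (exp (2 * \<tau> x) * exp (- 2 * \<tau> x))" by (subst f(8)) (simp only: mult_ac)
      also have "\<dots> = E x" by (simp flip: exp_add)
      finally show ?thesis .
    qed
    ultimately show ?thesis by (simp add: T_def)
  qed
  have "closed (T \<inter> barrier K k -` {\<delta>..})"
    by (rule continuous_closed_preimage[OF continuous_on_subset[OF smooth_on_continuous[OF barrier_smooth] TS] closedT]) simp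
  moreover have eq: "T \<inter> barrier K k -` {\<delta>..} = {x \<in> S. barrier K k x \<ge> \<delta>}"
    using sub TS by auto
  moreover have "bounded {x \<in> S. barrier K k x \<ge> \<delta>}"
    using S_inside by (intro bounded_subset[OF bounded_dom]) auto
  ultimately show ?thesis by (simp add: compact_eq_bounded_closed)
qed

text \<open>The choice of \<open>K\<close> lets the convex part of the profile absorb the mismatch
  of the potential and the term with \<open>lam\<close>, its summand \<open>1\<close> leaving the
  gain \<open>exp (- \<tau> / 2)\<close>. The quadratic part of the profile costs
  \<open>2 / k\<close>, the cut the last term.\<close>

lemma barrier_comparison:
  assumes x: "x \<in> S" and \<delta>: "\<delta> > 0" and k: "k > 0" and K: "K = 2 * \<kappa> * c + lam + 1"
    and v: "v = (\<lambda>x. 1 / \<delta> * barrier K k x + - 1)" and v0: "v x > 0"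
    and L: "L = (\<lambda>x. 1 / \<delta> * (dens x * (profile2 K k (\<tau> x) - c * profile K k (\<tau> x))) + 0)"
  shows "\<delta> * comparison S v L x \<le> - (dcpos (v x) * dens x * exp (- \<tau> x / 2)) + 2 / k * dens x + \<delta> * (2 * c / A x)"
proof -
  note f = S_facts[OF x] and g = one_minus_E[OF x]
  define F where "F = profile K k (\<tau> x)"
  define D where "D = dcpos (v x)"
  define m where "m = dens x"
  define h where "h = D * (v x + 1) - cpos (v x)"
  have K0: "2 * \<kappa> * c + lam \<ge> 0" using \<kappa>_pos c_nonneg lam_nonneg by simp
  then have Kpos: "K \<ge> 0" using K by simp
  have w: "barrier K k x = \<delta> * (v x + 1)" using \<delta> by (simp add: v)
  then have wpos: "barrier K k x > 0" using \<delta> v0 by simp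
  have F0: "F > 0" and F\<tau>: "F \<le> \<tau> x"
    unfolding F_def using barrier_positive(1)[OF x wpos Kpos k] profile_bounds(1)[OF Kpos k f(6)] by auto
  have m0: "m \<ge> 0" unfolding m_def dens_def using f \<psi>_pos[of x] by simp
  have D: "D \<ge> 0" "D \<le> 1" unfolding D_def by (rule cpos_deriv_bounds)+
  have h: "h \<ge> 0" "h \<le> 2" unfolding h_def D_def by (rule cpos_defect)+
  have wm: "barrier K k x = m * A x * E x * F"
    using f(1,2) by (simp add: barrier_def m_def dens_def F_def field_simps)
  have cp: "\<delta> * cpos (v x) = D * (m * A x * E x * F) - \<delta> * h"
    unfolding wm[symmetric] w h_def by (simp add: algebra_simps)
  have nA: "(norm x)\<^sup>2 = A x" by (simp add: A_def power2_norm_eq_inner)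
  have "\<delta> * comparison S v L x = - (D * (\<delta> * L x)) - (c / A x - lam) * (\<delta> * cpos (v x))"
    using x by (simp add: comparison_def D_def nA algebra_simps)
  also have "\<delta> * L x = m * (profile2 K k (\<tau> x) - c * F)"
    using \<delta> by (simp add: L m_def F_def)
  \<comment> \<open>The critical terms \<open>c F\<close> cancel up to the factor
    \<open>1 - E\<close>, because the barrier is \<open>m A E F\<close>; \<open>h\<close> collects
    the defect of the truncation.\<close>
  also have "- (D * (m * (profile2 K k (\<tau> x) - c * F))) - (c / A x - lam) * (\<delta> * cpos (v x)) =
      D * m * (- profile2 K k (\<tau> x) + (c * (1 - E x) + lam * (A x * E x)) * F) + (c / A x - lam) * (\<delta> * h)"
    unfolding cp using f(1) by (simp add: field_simps)
  also have "\<dots> \<le> D * m * (- exp (- \<tau> x / 2) + 2 / k) + c / A x * (\<delta> * 2)"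
  proof (rule add_mono)
    have "(c * (1 - E x) + lam * (A x * E x)) * F \<le> ((2 * \<kappa> * c + lam) * exp (- \<tau> x)) * \<tau> x"
    proof (rule mult_mono)
      have "c * (1 - E x) \<le> c * (2 * \<kappa> * exp (- \<tau> x))" by (rule mult_left_mono[OF g(2) c_nonneg])
      moreover have "lam * (A x * E x) \<le> lam * exp (- \<tau> x)" by (rule mult_left_mono[OF g(3) lam_nonneg])
      ultimately show "c * (1 - E x) + lam * (A x * E x) \<le> (2 * \<kappa> * c + lam) * exp (- \<tau> x)"
        by (simp add: algebra_simps)
    qed (use F0 F\<tau> K0 in auto)
    also have "\<dots> = (2 * \<kappa> * c + lam) * (exp (- \<tau> x) * \<tau> x)" by simp
    also have "\<dots> \<le> (2 * \<kappa> * c + lam) * exp (- \<tau> x / 2)"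
    proof (rule mult_left_mono[OF _ K0])
      \<comment> \<open>The aim is \<open>\<tau> \<le> exp (\<tau> / 2)\<close>, so that half of the
        decay absorbs the linear growth of the profile.\<close>
      have "\<tau> x \<le> 1 + \<tau> x / 2 + (\<tau> x / 2)\<^sup>2 / 2"
        using zero_le_power2[of "\<tau> x - 2"] by (simp add: power2_eq_square field_simps)
      also have "\<dots> \<le> exp (\<tau> x / 2)"
        using f(6) by (intro exp_lower_Taylor_quadratic) simp
      finally have "exp (- \<tau> x) * \<tau> x \<le> exp (- \<tau> x) * exp (\<tau> x / 2)" by (intro mult_left_mono) auto
      also have "\<dots> = exp (- \<tau> x / 2)" by (simp flip: exp_add)
      finally show "exp (- \<tau> x) * \<tau> x \<le> exp (- \<tau> x / 2)" .
    qed
    finally have "- profile2 K k (\<tau> x) + (c * (1 - E x) + lam * (A x * E x)) * F \<le> - exp (- \<tau> x / 2) + 2 / k"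
      unfolding profile2_def K by (simp add: algebra_simps)
    then show "D * m * (- profile2 K k (\<tau> x) + (c * (1 - E x) + lam * (A x * E x)) * F) \<le> D * m * (- exp (- \<tau> x / 2) + 2 / k)"
      using D m0 by (intro mult_left_mono) auto
    have "(c / A x - lam) * (\<delta> * h) \<le> c / A x * (\<delta> * h)"
      using lam_nonneg \<delta> h by (intro mult_right_mono) auto
    also have "\<dots> \<le> c / A x * (\<delta> * 2)"
      using c_nonneg f(1) \<delta> h by (intro mult_left_mono) auto
    finally show "(c / A x - lam) * (\<delta> * h) \<le> c / A x * (\<delta> * 2)" .
  qed
  also have "\<dots> \<le> - (D * m * exp (- \<tau> x / 2)) + 2 / k * m + \<delta> * (2 * c / A x)"
  proof -
    have "D * (m * (2 / k)) \<le> 1 * (m * (2 / k))" using D m0 k by (intro mult_right_mono) auto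
    then show ?thesis by (simp add: algebra_simps)
  qed
  finally show ?thesis by (simp add: D_def m_def)
qed

text \<open>Where \<open>\<eta>^2 \<le> A\<close> the regularised \<open>A + \<eta>^2\<close> is at
  most \<open>2 A\<close>, and powers of \<open>E\<close> are absorbed by its lower bound
  \<open>\<epsilon>\<close>; \<open>q\<close> is at most the positive part of
  \<open>x \<bullet> e\<close>.\<close>

lemma dens_le_moment:
  assumes x: "x \<in> S" and \<eta>: "\<eta> > 0" "\<eta>\<^sup>2 \<le> A x"
  shows "dens x \<le> 2 * exp (real DIM('a) / 4 * (ln 2 - ln \<epsilon>)) / \<epsilon> *
    (max (x \<bullet> e) 0 * exp (- (real DIM('a) / 4) * ln (x \<bullet> x + \<eta>\<^sup>2)) / (x \<bullet> x + \<eta>\<^sup>2))"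
proof -
  note f = S_facts[OF x]
  define n where "n = real DIM('a) / 4"
  have n: "n \<ge> 0" by (simp add: n_def)
  define P where "P = A x + \<eta>\<^sup>2"
  have P: "P > 0" "P \<le> 2 * A x" using f(1) \<eta> by (auto simp: P_def add_pos_nonneg)
  have "\<kappa> * (x \<bullet> x) \<ge> 0" using \<kappa>_pos by simp
  then have q: "q x \<le> max (x \<bullet> e) 0" unfolding q_def by (simp add: le_max_iff_disj)
  have "ln P \<le> ln (2 * A x)" using P f(1) by simp
  then have "ln P \<le> ln 2 + ln (A x)" using f(1) by (simp add: ln_mult)
  moreover have "ln \<epsilon> \<le> ln (E x)" using f(2,7) \<epsilon>_pos by (simp add: \<epsilon>_def)
  ultimately have "ln P - (ln 2 - ln \<epsilon>) \<le> ln (A x) + ln (E x)" by simp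
  from mult_left_mono[OF this n] have p: "\<psi> x \<le> exp (n * (ln 2 - ln \<epsilon>)) * exp (- n * ln P)"
    by (simp add: \<psi>_def n_def algebra_simps flip: exp_add)
  have "P * \<epsilon> \<le> (2 * A x) * E x"
    using P f \<epsilon>_pos by (intro mult_mono) (auto simp: \<epsilon>_def)
  then have "1 / (A x * E x) \<le> 2 / (P * \<epsilon>)"
    using P(1) \<epsilon>_pos f(1,2) by (simp add: divide_simps mult_ac)
  moreover have "q x * \<psi> x \<le> max (x \<bullet> e) 0 * (exp (n * (ln 2 - ln \<epsilon>)) * exp (- n * ln P))"
    using q p \<psi>_pos[of x] by (intro mult_mono) auto
  ultimately have "(q x * \<psi> x) * (1 / (A x * E x)) \<le>
      (max (x \<bullet> e) 0 * (exp (n * (ln 2 - ln \<epsilon>)) * exp (- n * ln P))) * (2 / (P * \<epsilon>))"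
    using f(1,2) by (rule_tac mult_mono) auto
  then show ?thesis by (simp add: dens_def n_def P_def A_def field_simps)
qed

text \<open>The mass \<open>I0\<close> of \<open>u\<close> on a fixed open set \<open>U\<close> and
  the gain \<open>\<theta>\<close> do not depend on \<open>k\<close>, whereas their product is
  bounded by a multiple of \<open>sqrt (k + J0 + 1) / k\<close>.\<close>

lemma vanishes_near_contact:
  assumes C: "C \<ge> 0" "\<And>x. x \<in> \<Omega> \<Longrightarrow> x \<bullet> e \<ge> - C * (x \<bullet> x)"
  shows "\<exists>U. open U \<and> U \<noteq> {} \<and> U \<subseteq> \<Omega> \<and> (\<forall>x\<in>U. u x = 0)"
proof -
  define K where "K = 2 * \<kappa> * c + lam + 1"
  have K1: "K \<ge> 1" using \<kappa>_pos c_nonneg lam_nonneg by (simp add: K_def)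
  \<comment> \<open>The convex correction in the profile never exceeds \<open>4 K\<close>, so just
    beyond this level the profile is bounded below uniformly in large \<open>k\<close>.\<close>
  define t0 where "t0 = 4 * K + 1"
  \<comment> \<open>On the normal \<open>\<tau>\<close> is
    \<open>ln ((1 - \<kappa> \<sigma>) / \<sigma>)\<close>; this \<open>\<sigma>\<close> solves
    \<open>\<tau> = t0\<close>.\<close>
  define \<sigma> where "\<sigma> = inverse (exp t0 + \<kappa>)"
  define x0 where "x0 = \<sigma> *\<^sub>R e"
  have \<sigma>: "\<sigma> > 0" using \<kappa>_pos by (simp add: \<sigma>_def add_pos_pos)
  have \<sigma>1: "1 - \<kappa> * \<sigma> = exp t0 * \<sigma>"
  proof -
    have "(exp t0 + \<kappa>) * \<sigma> = 1" unfolding \<sigma>_def using \<kappa>_pos by (intro right_inverse) (simp add: add_pos_pos less_imp_neq[THEN not_sym])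
    then show ?thesis by (simp add: algebra_simps)
  qed
  have Ax0: "A x0 = \<sigma>\<^sup>2" by (simp add: A_def x0_def e_e power2_eq_square)
  have Ex0: "E x0 = (exp t0 * \<sigma>)\<^sup>2"
    unfolding \<sigma>1[symmetric] by (simp add: E_def x0_def e_e algebra_simps power2_eq_square)
  have qx0: "q x0 > 0"
  proof -
    have "q x0 = \<sigma> * (1 - \<kappa> * \<sigma>)" by (simp add: q_def x0_def e_e algebra_simps)
    also have "\<dots> > 0" unfolding \<sigma>1 using \<sigma> by simp
    finally show ?thesis .
  qed
  have \<tau>x0: "\<tau> x0 = t0"
    unfolding \<tau>_def Ax0 Ex0 using \<sigma> by (simp add: ln_realpow ln_mult)
  have x0S: "x0 \<in> S"
  proof -
    have "t0 > 0" using K1 by (simp add: t0_def)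
    then have "1 * \<sigma> < exp t0 * \<sigma>" using \<sigma> by (intro mult_strict_right_mono) auto
    then have "\<sigma>\<^sup>2 < (exp t0 * \<sigma>)\<^sup>2" using \<sigma> by (intro power_strict_mono) auto
    then show ?thesis using qx0 by (simp add: S_def Ax0 Ex0)
  qed
  define q1 where "q1 = q x0 * \<psi> x0 / 2"
  have q1: "q1 > 0" using qx0 \<psi>_pos[of x0] by (simp add: q1_def)
  define U where "U = {x \<in> S. 4 * K + 1/2 < \<tau> x \<and> \<tau> x < 4 * K + 2 \<and> q1 < q x * \<psi> x}"
  have cont: "continuous_on S \<tau>" "continuous_on S (\<lambda>x. q x * \<psi> x)"
    by (intro smooth_on_continuous smooth_pieces continuous_on_mult)+
  have openU: "open U"
  proof -
    have "open (S \<inter> \<tau> -` {4 * K + 1/2 <..< 4 * K + 2})" "open (S \<inter> (\<lambda>x. q x * \<psi> x) -` {q1 <..})"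
      by (rule continuous_open_preimage[OF cont(1) open_S], simp,
          rule continuous_open_preimage[OF cont(2) open_S], simp)
    then have "open ((S \<inter> \<tau> -` {4 * K + 1/2 <..< 4 * K + 2}) \<inter> (S \<inter> (\<lambda>x. q x * \<psi> x) -` {q1 <..}))"
      by (rule open_Int)
    moreover have "U = (S \<inter> \<tau> -` {4 * K + 1/2 <..< 4 * K + 2}) \<inter> (S \<inter> (\<lambda>x. q x * \<psi> x) -` {q1 <..})"
      by (auto simp: U_def)
    ultimately show ?thesis by simp
  qed
  have "q1 < q x0 * \<psi> x0" using q1 unfolding q1_def by linarith
  then have "x0 \<in> U" using x0S by (simp add: U_def \<tau>x0 t0_def)
  have U\<Omega>: "U \<subseteq> \<Omega>" using S_inside by (auto simp: U_def)
  have indU: "integrable M (\<lambda>x. u x * indicator U x)"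
  proof (rule u_times_bounded[where B = 1])
    show "indicat_real U \<in> borel_measurable M"
      using openU by (intro measurable_restrict_space1 borel_measurable_indicator) (simp add: borel_open)
  qed (simp add: indicator_def)
  have uint: "integrable M u"
    using u_times_bounded[of "\<lambda>_. 1" 1] by simp
  define I0 where "I0 = integral\<^sup>L M (\<lambda>x. u x * indicator U x)"
  define I1 where "I1 = integral\<^sup>L M u"
  obtain R0 where R0: "\<And>x. x \<in> \<Omega> \<Longrightarrow> norm x \<le> R0"
    using bounded_dom by (auto simp: bounded_iff)
  define R where "R = \<bar>R0\<bar> + 1"
  have R: "\<Omega> \<subseteq> ball 0 R" "R > 0" using R0 by (force simp: R_def)+
  let ?W = "\<lambda>\<eta> x. max (x \<bullet> e) 0 * exp (- (real DIM('a) / 4) * ln (x \<bullet> x + \<eta>\<^sup>2)) / (x \<bullet> x + \<eta>\<^sup>2)"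
  obtain K2 where W: "\<And>J \<eta>. \<eta> = R * exp (- real J) \<Longrightarrow> integrable M (\<lambda>x. u x * ?W \<eta> x)"
    "\<And>J \<eta>. \<eta> = R * exp (- real J) \<Longrightarrow> integral\<^sup>L M (\<lambda>x. u x * ?W \<eta> x) \<le> K2 * sqrt (real J + 1)"
    by (rule normal_moment_bound[OF R norm_e C], assumption) (rule that, blast+)
  \<comment> \<open>The shift by \<open>J0\<close> scales \<open>\<eta>\<close> so that
    \<open>\<eta>^2 \<le> A\<close> wherever the barrier is positive.\<close>
  obtain J0 :: nat where J0: "real J0 \<ge> ln (R / sqrt \<epsilon>)" using real_arch_simple by blast
  define C3 where "C3 = 2 * exp (real DIM('a) / 4 * (ln 2 - ln \<epsilon>)) / \<epsilon>"
  have C3: "C3 \<ge> 0" using \<epsilon>_pos by (simp add: C3_def)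
  \<comment> \<open>On \<open>U\<close> the three factors bound \<open>cpos' (v)\<close>,
    \<open>dens\<close> and \<open>exp (- \<tau> / 2)\<close> from below; the last one uses
    \<open>\<tau> < 4 K + 2\<close>.\<close>
  define \<theta> where "\<theta> = exp (- 1) * q1 * exp (- (2 * K + 1))"
  have \<theta>: "\<theta> > 0" using q1 by (simp add: \<theta>_def)
  \<comment> \<open>The threshold for \<open>k\<close> makes \<open>\<tau>^2 / k \<le> 1 / 4\<close>
    on \<open>U\<close>, so the profile is at least \<open>1 / 4\<close> there.\<close>
  have main: "\<theta> * I0 \<le> 2 / real k * C3 * (K2 * sqrt (real (k + J0) + 1))"
    if k: "real k \<ge> 4 * (4 * K + 2)\<^sup>2" for k :: nat
  proof -
    have "4 * (4 * K + 2)\<^sup>2 > 0" using K1 by simp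
    then have k0: "real k > 0" using k by linarith
    define \<eta> where "\<eta> = R * exp (- real (k + J0))"
    have \<eta>0: "\<eta> > 0" using R by (simp add: \<eta>_def)
    have \<eta>2: "\<eta>\<^sup>2 \<le> \<epsilon> * exp (- 2 * real k)"
    proof -
      have "R / sqrt \<epsilon> \<le> exp (real J0)"
        using J0 R \<epsilon>_pos by (metis divide_pos_pos exp_le_cancel_iff exp_ln real_sqrt_gt_zero)
      then have "R * exp (- real J0) \<le> sqrt \<epsilon>"
        using \<epsilon>_pos by (simp add: exp_minus divide_simps mult.commute)
      then have "R * exp (- real J0) * exp (- real k) \<le> sqrt \<epsilon> * exp (- real k)"
        by (rule mult_right_mono) simp
      then have "\<eta> \<le> sqrt \<epsilon> * exp (- real k)"
        by (simp add: \<eta>_def exp_diff exp_minus field_simps)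
      then have "\<eta>\<^sup>2 \<le> (sqrt \<epsilon> * exp (- real k))\<^sup>2"
        using \<eta>0 by (intro power_mono) auto
      also have "\<dots> = \<epsilon> * exp (- 2 * real k)"
        using \<epsilon>_pos by (simp add: power_mult_distrib flip: exp_double)
      finally show ?thesis .
    qed
    note W = W[OF \<eta>_def]
    \<comment> \<open>With \<open>\<delta> \<le> q1 / 8\<close> the barrier is at least
      \<open>q1 / 4 \<ge> 2 \<delta>\<close> on \<open>U\<close>, hence \<open>v \<ge> 1\<close>
      there. The coefficient of the error depends on \<open>k\<close> through \<open>\<eta>\<close>,
      but not on \<open>\<delta>\<close>.\<close>
    have step: "\<theta> * I0 \<le> 2 / real k * C3 * integral\<^sup>L M (\<lambda>x. u x * ?W \<eta> x) + \<delta> * (2 * c / \<eta>\<^sup>2 * I1)"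
      if \<delta>: "0 < \<delta>" "\<delta> \<le> q1 / 8" for \<delta>
    proof -
      define v where "v = (\<lambda>x. 1 / \<delta> * barrier K (real k) x + - 1)"
      define L where "L = (\<lambda>x. 1 / \<delta> * (dens x * (profile2 K (real k) (\<tau> x) - c * profile K (real k) (\<tau> x))) + 0)"
      obtain V where "has_lap S (barrier K (real k)) V
          (\<lambda>x. q x * \<psi> x / (A x * E x) * (profile2 K (real k) (\<tau> x) - (real DIM('a))\<^sup>2 / 4 * profile K (real k) (\<tau> x)))"
        using barrier_laplacian[OF profile_deriv] unfolding barrier_def[abs_def] by blast
      from has_lap_add[OF has_lap_cmult[OF this, of "1 / \<delta>"] has_lap_const[of S "- 1"]]
      have lap: "has_lap S v (\<lambda>x. (1 / \<delta>) *\<^sub>R V x + 0) L"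
        by (simp add: v_def L_def dens_def c_eq)
      have smv: "smooth_on S v"
        unfolding v_def by (intro smooth_on_add smooth_on_mult smooth_on_const barrier_smooth)
      have contL: "continuous_on S L"
      proof -
        have "A x \<noteq> 0" "E x \<noteq> 0" if "x \<in> S" for x using S_facts(1,2)[OF that] by auto
        then show ?thesis
          unfolding L_def dens_def profile_def profile2_def using k0
          by (intro continuous_intros cont continuous_AEq) auto
      qed
      have vset: "{x \<in> S. v x \<ge> 0} = {x \<in> S. barrier K (real k) x \<ge> \<delta>}"
        using \<delta>(1) by (auto simp: v_def field_simps)
      have comp: "compact {x \<in> S. v x \<ge> 0}"
        unfolding vset using K1 k0 \<delta>(1) by (intro barrier_superlevel_compact) auto
      have sub: "{x \<in> S. v x \<ge> 0} \<subseteq> \<Omega>" using S_inside by auto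
      note cmp = comparison_inequality[OF open_S smv lap contL comp sub]
      \<comment> \<open>A majorant on the whole domain: where \<open>v \<le> 0\<close> or outside
        \<open>S\<close>, \<open>comparison\<close> is zero and \<open>Y\<close> is nonnegative,
        because such points lie outside \<open>U\<close>.\<close>
      define Y where "Y x = - \<theta> * indicator U x + 2 / real k * C3 * ?W \<eta> x + \<delta> * (2 * c / \<eta>\<^sup>2)" for x
      have W0: "?W \<eta> x \<ge> 0" for x
        by (intro divide_nonneg_nonneg mult_nonneg_nonneg add_nonneg_nonneg) auto
      have pt: "\<delta> * comparison S v L x \<le> Y x" if x\<Omega>: "x \<in> \<Omega>" for x
      proof -
        have vU: "v x \<ge> 1" if "x \<in> U" for x
        proof -
          have xU: "x \<in> S" "4 * K + 1/2 < \<tau> x" "\<tau> x < 4 * K + 2" "q1 < q x * \<psi> x"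
            using that by (auto simp: U_def)
          have "(\<tau> x)\<^sup>2 \<le> (4 * K + 2)\<^sup>2" using xU K1 by (intro power_mono) auto
          then have "(\<tau> x)\<^sup>2 / real k \<le> 1 / 4" using k k0 by (simp add: divide_le_eq)
          moreover have "4 * K * exp (- \<tau> x / 2) \<ge> 0" using K1 by simp
          moreover have "profile K (real k) (\<tau> x) = \<tau> x - 4 * K + 4 * K * exp (- \<tau> x / 2) - (\<tau> x)\<^sup>2 / real k"
            by (simp add: profile_def algebra_simps)
          ultimately have "profile K (real k) (\<tau> x) \<ge> 1 / 4" using xU by linarith
          then have "q1 * (1 / 4) \<le> (q x * \<psi> x) * profile K (real k) (\<tau> x)"
            using xU q1 by (intro mult_mono) auto
          then have "barrier K (real k) x \<ge> 2 * \<delta>" using \<delta> by (simp add: barrier_def mult.assoc)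
          then show ?thesis using \<delta>(1) by (simp add: v_def field_simps)
        qed
        show ?thesis
        proof (cases "x \<in> S \<and> v x > 0")
          case True
          then have xS: "x \<in> S" and vx: "v x > 0" by auto
          note f = S_facts[OF xS]
          have bpos: "barrier K (real k) x > 0" using vx \<delta>(1) by (simp add: v_def field_simps)
          have "K \<ge> 0" using K1 by simp
          then have A\<eta>: "\<eta>\<^sup>2 \<le> A x"
            using barrier_positive(3)[OF xS bpos _ k0] \<eta>2 by linarith
          have d0: "dens x \<ge> 0" using f \<psi>_pos[of x] by (simp add: dens_def)
          have "\<delta> * comparison S v L x \<le> - (dcpos (v x) * dens x * exp (- \<tau> x / 2)) + 2 / real k * dens x + \<delta> * (2 * c / A x)"
            by (rule barrier_comparison[OF xS \<delta>(1) k0 K_def v_def vx L_def])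
          moreover have "2 / real k * dens x \<le> 2 / real k * (C3 * ?W \<eta> x)"
            unfolding C3_def using dens_le_moment[OF xS \<eta>0 A\<eta>] k0 by (intro mult_left_mono) auto
          moreover have "\<delta> * (2 * c / A x) \<le> \<delta> * (2 * c / \<eta>\<^sup>2)"
            using \<delta>(1) c_nonneg A\<eta> \<eta>0 f(1) by (intro mult_left_mono divide_left_mono mult_pos_pos) auto
          moreover have "\<theta> * indicator U x \<le> dcpos (v x) * dens x * exp (- \<tau> x / 2)"
          proof (cases "x \<in> U")
            case True
            have "q x * \<psi> x \<le> dens x"
            proof -
              have "A x * E x \<le> 1 * 1" using f one_minus_E(4)[OF xS] by (intro mult_mono) auto
              then have "q x * \<psi> x * 1 \<le> q x * \<psi> x * (1 / (A x * E x))"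
                using f(1,2,5) \<psi>_pos[of x] by (intro mult_left_mono) auto
              then show ?thesis by (simp add: dens_def)
            qed
            then have "q1 \<le> dens x" using True by (auto simp: U_def)
            moreover have "exp (- 1) \<le> dcpos (v x)" by (rule cpos_deriv_bounds(3)[OF vU[OF True]])
            moreover have "exp (- (2 * K + 1)) \<le> exp (- \<tau> x / 2)" using True by (simp add: U_def)
            ultimately show ?thesis
              unfolding \<theta>_def using True q1 d0 cpos_deriv_bounds(1)[of "v x"] by (simp add: mult_mono)
          next
            case False
            then show ?thesis using d0 cpos_deriv_bounds(1)[of "v x"] by simp
          qed
          ultimately show ?thesis unfolding Y_def by (simp add: mult.assoc)
        next
          case False
          then have "x \<notin> U" using vU[of x] by (auto simp: U_def)
          then have "Y x = 2 / real k * C3 * ?W \<eta> x + \<delta> * (2 * c / \<eta>\<^sup>2)" by (simp add: Y_def)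
          moreover have "2 / real k * C3 * ?W \<eta> x \<ge> 0"
            by (intro mult_nonneg_nonneg[OF _ W0]) (use k0 C3 in auto)
          moreover have "\<delta> * (2 * c / \<eta>\<^sup>2) \<ge> 0" using \<delta>(1) c_nonneg by simp
          moreover have "comparison S v L x = 0"
            using False by (auto simp: comparison_def bump_def cpos_def)
          ultimately show ?thesis by simp
        qed
      qed
      have "0 \<le> \<delta> * integral\<^sup>L M (\<lambda>x. u x * comparison S v L x)"
        using cmp(3) \<delta>(1) by simp
      also have "\<dots> = integral\<^sup>L M (\<lambda>x. \<delta> * (u x * comparison S v L x))" by simp
      also have "\<dots> \<le> integral\<^sup>L M (\<lambda>x. - \<theta> * (u x * indicator U x) + 2 / real k * C3 * (u x * ?W \<eta> x) + \<delta> * (2 * c / \<eta>\<^sup>2) * u x)"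
      proof (rule integral_mono)
        show "integrable M (\<lambda>x. \<delta> * (u x * comparison S v L x))"
          by (intro integrable_mult_right cmp(2))
        show "integrable M (\<lambda>x. - \<theta> * (u x * indicator U x) + 2 / real k * C3 * (u x * ?W \<eta> x) + \<delta> * (2 * c / \<eta>\<^sup>2) * u x)"
          by (intro Bochner_Integration.integrable_add integrable_mult_right indU W(1) uint)
        fix x assume "x \<in> space M"
        then have x: "x \<in> \<Omega>" by (simp add: space_M)
        have "u x * (\<delta> * comparison S v L x) \<le> u x * Y x"
          by (rule mult_left_mono[OF pt[OF x] u_nonneg[OF x]])
        also have "\<dots> = - \<theta> * (u x * indicator U x) + 2 / real k * C3 * (u x * ?W \<eta> x) + \<delta> * (2 * c / \<eta>\<^sup>2) * u x"
          unfolding Y_def by (simp only: distrib_left mult_ac)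
        finally show "\<delta> * (u x * comparison S v L x) \<le> - \<theta> * (u x * indicator U x) + 2 / real k * C3 * (u x * ?W \<eta> x) + \<delta> * (2 * c / \<eta>\<^sup>2) * u x"
          by (simp only: mult.left_commute)
      qed
      also have "\<dots> = - \<theta> * I0 + 2 / real k * C3 * integral\<^sup>L M (\<lambda>x. u x * ?W \<eta> x) + \<delta> * (2 * c / \<eta>\<^sup>2) * I1"
        unfolding I0_def I1_def
        by (subst Bochner_Integration.integral_add Bochner_Integration.integral_add,
            intro Bochner_Integration.integrable_add integrable_mult_right indU W(1) uint,
            intro integrable_mult_right uint,
            subst Bochner_Integration.integral_add,
            intro integrable_mult_right indU, intro integrable_mult_right W(1),
            simp only: integral_mult_right_zero)
      finally show ?thesis by (simp add: mult.assoc)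
    qed
    have "\<theta> * I0 \<le> 2 / real k * C3 * integral\<^sup>L M (\<lambda>x. u x * ?W \<eta> x)"
      by (rule le_if_le_small_perturbation[of "q1 / 8", OF _ step]) (use q1 in simp)
    also have "\<dots> \<le> 2 / real k * C3 * (K2 * sqrt (real (k + J0) + 1))"
      using k0 C3 by (intro mult_left_mono W(2)) auto
    finally show ?thesis .
  qed
  have "\<theta> * I0 \<le> 0"
  proof (rule LIMSEQ_le_const)
    \<comment> \<open>The bound in \<open>main\<close> with \<open>1 / k\<close> moved under the
      root.\<close>
    have "(\<lambda>k. 2 * C3 * K2 * sqrt (1 / real k + (real J0 + 1) * (1 / real k * (1 / real k)))) \<longlonglongrightarrow> 2 * C3 * K2 * sqrt (0 + (real J0 + 1) * (0 * 0))"
      by (intro tendsto_intros lim_1_over_n)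
    then show "(\<lambda>k. 2 * C3 * K2 * sqrt (1 / real k + (real J0 + 1) * (1 / real k * (1 / real k)))) \<longlonglongrightarrow> 0" by simp
    obtain k1 :: nat where k1: "real k1 \<ge> 4 * (4 * K + 2)\<^sup>2" using real_arch_simple by blast
    show "\<exists>N. \<forall>k\<ge>N. \<theta> * I0 \<le> 2 * C3 * K2 * sqrt (1 / real k + (real J0 + 1) * (1 / real k * (1 / real k)))"
    proof (intro exI[of _ "Suc k1"] allI impI)
      fix k assume k: "Suc k1 \<le> k"
      then have kp: "real k > 0" by simp
      have "real k1 \<le> real k" using k by simp
      then have kk: "real k \<ge> 4 * (4 * K + 2)\<^sup>2" using k1 by linarith
      have "1 / real k + (real J0 + 1) * (1 / real k * (1 / real k)) = (real (k + J0) + 1) / (real k)\<^sup>2"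
        using kp by (simp add: field_simps power2_eq_square)
      then have "sqrt (1 / real k + (real J0 + 1) * (1 / real k * (1 / real k))) = sqrt (real (k + J0) + 1) / real k"
        using kp by (simp add: real_sqrt_divide)
      then show "\<theta> * I0 \<le> 2 * C3 * K2 * sqrt (1 / real k + (real J0 + 1) * (1 / real k * (1 / real k)))"
        using main[OF kk] by (simp add: mult_ac)
    qed
  qed
  then have "I0 \<le> 0" using \<theta> by (simp add: mult_le_0_iff)
  moreover have "I0 \<ge> 0" unfolding I0_def
    using u_nonneg by (intro integral_nonneg_AE AE_I2) (simp add: space_M)
  ultimately have "integral\<^sup>L M (\<lambda>x. u x * indicator U x) = 0" by (simp add: I0_def)
  then have "AE x in M. u x * indicator U x = 0"
    using indU u_nonneg by (subst (asm) integral_nonneg_eq_0_iff_AE) (auto simp: space_M intro!: AE_I2)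
  then have ae: "AE x in M. x \<in> U \<longrightarrow> u x = 0" by (rule eventually_mono) auto
  have "u x = 0" if "x \<in> U" for x
    by (rule AE_zero_imp_zero[OF openU U\<Omega> continuous_on_subset[OF u_cont U\<Omega>] ae that])
  then show ?thesis using openU \<open>x0 \<in> U\<close> U\<Omega> by blast
qed

end

theorem theorem4p1:
  fixes \<Omega> :: "'a::euclidean_space set" and u :: "'a \<Rightarrow> real" and Du :: "'a \<Rightarrow> 'a"
    and lam :: real
  assumes "DIM('a) \<ge> 2"
    and "bounded \<Omega>" and "lipschitz_domain \<Omega>"
    and "0 \<in> frontier \<Omega>" and "C2_boundary_near \<Omega> 0"
    and "lam \<ge> 0"
    and "H10_with_grad \<Omega> u Du" and "continuous_on \<Omega> u"
    and "\<forall>x\<in>\<Omega>. u x \<ge> 0"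
    and "\<forall>\<phi>. test_fun \<Omega> \<phi> \<and> (\<forall>x. \<phi> x \<ge> 0) \<longrightarrow>
          (LINT x:\<Omega>|lebesgue. Du x \<bullet> grad \<phi> x)
            - (real DIM('a))\<^sup>2 / 4 * (LINT x:\<Omega>|lebesgue. u x * \<phi> x / (norm x)\<^sup>2)
          \<ge> - lam * (LINT x:\<Omega>|lebesgue. u x * \<phi> x)"
  shows "\<forall>x\<in>\<Omega>. u x = 0"
proof -
  have op: "open \<Omega>" and con: "connected \<Omega>"
    using assms(3) by (auto simp: lipschitz_domain_def)
  interpret weak_setting \<Omega> u Du
    using op assms(2,7) by unfold_locales
  have "0 \<notin> \<Omega>" using assms(4) op by (simp add: frontier_def interior_open)
  then interpret supersolution \<Omega> u Du "(real DIM('a))\<^sup>2 / 4" lam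
    by unfold_locales (use assms in \<open>auto simp: set_lebesgue_integral_M\<close>)
  obtain e \<kappa> C where e: "norm e = 1" "\<kappa> > 0" "\<And>x. x \<bullet> e > \<kappa> * (x \<bullet> x) \<Longrightarrow> x \<in> \<Omega>"
    and C: "C \<ge> 0" "\<And>x. x \<in> \<Omega> \<Longrightarrow> x \<bullet> e \<ge> - C * (x \<bullet> x)"
    using C2_boundary_tangent_balls[OF op assms(4,5)] by metis
  interpret contact \<Omega> u Du "(real DIM('a))\<^sup>2 / 4" lam e \<kappa>
    by unfold_locales (use e in auto)
  obtain U where "open U" "U \<noteq> {}" "U \<subseteq> \<Omega>" "\<And>x. x \<in> U \<Longrightarrow> u x = 0"
    using vanishes_near_contact[OF C] by blast
  then show ?thesis using zero_on_domain[OF con, of U] by blast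
qed

end
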